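(* Let $m\ge 2$ be an integer and let $\Bbbk$ be an algebraically closed field of positive characteristic. Then the rings of invariants $B_5^\theta$, $B_6^\theta$ and $B_7^\theta$ of the three locally finite iterative higher derivations $\theta$ on $B_5$, $B_6$, $B_7$ over $\Bbbk$ (depending on $m$) defined in the context are finitely generated $\Bbbk$-algebras.
   Context: For a $\Bbbk$-algebra $B$ and a $\Bbbk$-algebra homomorphism $\theta:B\to B[U]$ ($U$ an indeterminate), write $\theta(b)=\sum_{n\ge 0}\theta^{(n)}(b)U^n$. Then $\theta$ is called a locally finite iterative higher derivation (lfihd) if $\theta^{(0)}=\mathrm{id}_B$ and $\theta^{(j)}(\theta^{(k)}(b))=\binom{j+k}{j}\theta^{(j+k)}(b)$ for all $j,k\ge 0$, $b\in B$; these correspond to algebraic actions of the additive group $\mathbb{G}_a$ on $B$. The ring of invariants is $B^\theta=\{b\in B\mid \theta^{(n)}(b)=0 \text{ for all } n\ge 1\}=\{b\in B\mid\theta(b)=b\}$. The three examples, for a fixed integer $m\ge 2$, each a polynomial ring over $\Bbbk$ with a $\Bbbk$-algebra homomorphism $\theta$ (which is an lfihd) given on the variables: (DF5-m) $B_5=\Bbbk[x,s,t,u,v]$ with $\theta(x)=x$, $\theta(s)=s+x^{m+1}U$, $\theta(t)=t+2sU+x^{m+1}U^2$, $\theta(u)=u+3tU+3sU^2+x^{m+1}U^3$, $\theta(v)=v+x^mU$. (F6-m) $B_6=\Bbbk[x,y,s,t,u,v]$ with $\theta(x)=x$, $\theta(y)=y$, $\theta(s)=s+x^{m+1}U$, $\theta(t)=t+2y^{m+1}sU+x^{m+1}y^{m+1}U^2$,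 $\theta(u)=u+3y^{m+1}tU+3y^{2(m+1)}sU^2+x^{m+1}y^{2(m+1)}U^3$, $\theta(v)=v+x^my^mU$. (R7-m) $B_7=\Bbbk[x_1,x_2,x_3,y_1,y_2,y_3,v]$ with $\theta(x_i)=x_i$, $\theta(y_i)=y_i+x_i^{m+1}U$ for $i=1,2,3$, and $\theta(v)=v+x_1^mx_2^mx_3^mU$. *)

theory Defs
  imports "HOL-Computational_Algebra.Computational_Algebra" "HOL-Library.Poly_Mapping"
begin

text \<open>
  A commutative algebra over \<open>'k\<close> is given by a commutative ring type \<open>'b\<close> together with its
  structure map \<open>\<iota> :: 'k \<Rightarrow> 'b\<close>.
\<close>

definition algebra_hom ::
  "('k \<Rightarrow> 'b) \<Rightarrow> ('k \<Rightarrow> 'c) \<Rightarrow> ('b::comm_ring_1 \<Rightarrow> 'c::comm_ring_1) \<Rightarrow> bool"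
where
  "algebra_hom \<iota> \<kappa> h \<longleftrightarrow>
     (\<forall>c. h (\<iota> c) = \<kappa> c) \<and> h 1 = 1 \<and>
     (\<forall>a b. h (a + b) = h a + h b) \<and> (\<forall>a b. h (a * b) = h a * h b)"

text \<open>
  In a ring \<open>'b poly\<close> playing the role of \<open>B[U]\<close>, the indeterminate \<open>U\<close> is \<open>[:0, 1:]\<close> and
  the \<open>n\<close>-th component of the higher derivation \<open>\<theta>\<close> at \<open>b\<close> is \<open>coeff (\<theta> b) n\<close>.
\<close>

definition lfihd :: "('k \<Rightarrow> 'b) \<Rightarrow> ('b::comm_ring_1 \<Rightarrow> 'b poly) \<Rightarrow> bool"
where
  "lfihd \<iota> \<theta> \<longleftrightarrow>
     algebra_hom \<iota> (\<lambda>c. [:\<iota> c:]) \<theta> \<and>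
     (\<forall>b. coeff (\<theta> b) 0 = b) \<and>
     (\<forall>j k b. coeff (\<theta> (coeff (\<theta> b) k)) j = of_nat ((j + k) choose j) * coeff (\<theta> b) (j + k))"

definition invariants :: "('b::comm_ring_1 \<Rightarrow> 'b poly) \<Rightarrow> 'b set"
where
  "invariants \<theta> = {b. \<forall>n\<ge>1. coeff (\<theta> b) n = 0}"

lemma invariants_eq_fixed:
  assumes "lfihd \<iota> \<theta>"
  shows "invariants \<theta> = {b. \<theta> b = [:b:]}"
proof -
  have "coeff (\<theta> b) 0 = b" for b
    using assms by (simp add: lfihd_def)
  then have "(\<forall>n\<ge>1. coeff (\<theta> b) n = 0) \<longleftrightarrow> \<theta> b = [:b:]" for b
    by (auto simp: poly_eq_iff coeff_pCons Suc_le_eq gr0_conv_Suc split: nat.splits)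
  then show ?thesis by (simp add: invariants_def)
qed

text \<open>Closure under negation is automatic, since \<open>-1\<close> is a scalar.\<close>

definition is_subalgebra :: "('k \<Rightarrow> 'b) \<Rightarrow> 'b::comm_ring_1 set \<Rightarrow> bool"
where
  "is_subalgebra \<iota> A \<longleftrightarrow>
     range \<iota> \<subseteq> A \<and> (\<forall>a\<in>A. \<forall>b\<in>A. a + b \<in> A) \<and> (\<forall>a\<in>A. \<forall>b\<in>A. a * b \<in> A)"

definition finitely_generated_algebra :: "('k \<Rightarrow> 'b) \<Rightarrow> 'b::comm_ring_1 set \<Rightarrow> bool"
where
  "finitely_generated_algebra \<iota> A \<longleftrightarrow> (\<exists>G. finite G \<and> is_subalgebra \<iota> hull G = A)"

lemma is_subalgebra_hull: "is_subalgebra \<iota> (is_subalgebra \<iota> hull G)"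
  by (rule hull_in) (auto simp: is_subalgebra_def subset_iff)

lemma is_subalgebra_invariants:
  assumes "lfihd \<iota> \<theta>"
  shows "is_subalgebra \<iota> (invariants \<theta>)"
  using assms unfolding invariants_eq_fixed[OF assms]
  by (auto simp: is_subalgebra_def lfihd_def algebra_hom_def)

text \<open>
  The polynomial ring over \<open>'k\<close> in the indeterminates \<open>'v\<close>, as finitely supported functions
  from exponent vectors to coefficients, with the convolution product.
\<close>

type_synonym ('v, 'k) mpoly = "('v \<Rightarrow>\<^sub>0 nat) \<Rightarrow>\<^sub>0 'k"

definition Const :: "'k::comm_ring_1 \<Rightarrow> ('v, 'k) mpoly"
  where "Const c = Poly_Mapping.single 0 c"

definition Var :: "'v \<Rightarrow> ('v, 'k::comm_ring_1) mpoly"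
  where "Var i = Poly_Mapping.single (Poly_Mapping.single i 1) 1"

text \<open>Evaluation at \<open>f\<close>, with coefficients transported along \<open>\<kappa>\<close>.\<close>

definition mpoly_eval ::
  "('k::comm_ring_1 \<Rightarrow> 'b) \<Rightarrow> ('v \<Rightarrow> 'b) \<Rightarrow> ('v, 'k) mpoly \<Rightarrow> 'b::comm_ring_1"
where
  "mpoly_eval \<kappa> f p =
     (\<Sum>e\<in>Poly_Mapping.keys p. \<kappa> (Poly_Mapping.lookup p e) *
        (\<Prod>i\<in>Poly_Mapping.keys e. f i ^ Poly_Mapping.lookup e i))"

text \<open>
  The \<open>'k\<close>-algebra homomorphism \<open>B \<rightarrow> B[U]\<close> with prescribed values on the variables of \<open>B\<close>;
  existence and uniqueness are \<open>algebra_hom_hom_by_values\<close>, \<open>hom_by_values_Var\<close> and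
  \<open>algebra_hom_mpoly_ext\<close>.
\<close>

definition hom_by_values ::
  "('v \<Rightarrow> ('v, 'k) mpoly poly) \<Rightarrow> ('v, 'k::comm_ring_1) mpoly \<Rightarrow> ('v, 'k) mpoly poly"
where
  "hom_by_values = mpoly_eval (\<lambda>c. [:Const c:])"

lemma Const_hom:
  "Const 0 = 0" "Const 1 = 1"
  "Const (a + b) = Const a + Const b" "Const (a * b) = Const a * Const b"
  by (simp_all add: Const_def single_add mult_single)

lemma mpoly_sum_monomials:
  "p = (\<Sum>e\<in>Poly_Mapping.keys p. Poly_Mapping.single e (Poly_Mapping.lookup p e))"
proof (rule poly_mapping_eqI)
  fix d
  have "Poly_Mapping.lookup (\<Sum>e\<in>Poly_Mapping.keys p. Poly_Mapping.single e (Poly_Mapping.lookup p e)) d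
        = (\<Sum>e\<in>Poly_Mapping.keys p. if e = d then Poly_Mapping.lookup p e else 0)"
    by (simp add: lookup_sum lookup_single when_def)
  also have "\<dots> = Poly_Mapping.lookup p d"
    by (simp add: in_keys_iff)
  finally show "Poly_Mapping.lookup p d =
    Poly_Mapping.lookup (\<Sum>e\<in>Poly_Mapping.keys p. Poly_Mapping.single e (Poly_Mapping.lookup p e)) d" ..
qed

lemma mpoly_induct [case_names Const Var add mult]:
  fixes P :: "('v, 'k::comm_ring_1) mpoly \<Rightarrow> bool"
  assumes C: "\<And>c. P (Const c)" and V: "\<And>i. P (Var i)"
    and A: "\<And>p q. P p \<Longrightarrow> P q \<Longrightarrow> P (p + q)" and M: "\<And>p q. P p \<Longrightarrow> P q \<Longrightarrow> P (p * q)"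
  shows "P p"
proof -
  have P0: "P 0" and P1: "P 1"
    using C[of 0] C[of 1] by (simp_all add: Const_hom)
  have pow: "P (Poly_Mapping.single (Poly_Mapping.single i n) 1)" for i n
  proof (induction n)
    case 0 then show ?case using P1 by simp
  next
    case (Suc n)
    have "Poly_Mapping.single (Poly_Mapping.single i (Suc n)) (1::'k) =
        Var i * Poly_Mapping.single (Poly_Mapping.single i n) 1"
      by (simp add: Var_def mult_single flip: single_add)
    then show ?case using M[OF V Suc.IH] by simp
  qed
  have mon: "P (Poly_Mapping.single (\<Sum>i\<in>I. Poly_Mapping.single i (n i)) 1)"
    if "finite I" for I :: "'v set" and n
    using that
  proof induction
    case empty then show ?case using P1 by simp
  next
    case (insert i I)
    have "Poly_Mapping.single (\<Sum>i\<in>insert i I. Poly_Mapping.single i (n i)) (1::'k) =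
        Poly_Mapping.single (Poly_Mapping.single i (n i)) 1 *
        Poly_Mapping.single (\<Sum>i\<in>I. Poly_Mapping.single i (n i)) 1"
      using insert by (simp add: mult_single)
    then show ?case using M[OF pow insert.IH] by simp
  qed
  have single: "P (Poly_Mapping.single e c)" for e c
  proof -
    have "P (Poly_Mapping.single e 1)"
      using mon[of "Poly_Mapping.keys e" "Poly_Mapping.lookup e"]
      by (simp flip: mpoly_sum_monomials)
    moreover have "Poly_Mapping.single e c = Const c * Poly_Mapping.single e 1"
      by (simp add: Const_def mult_single)
    ultimately show ?thesis using M[OF C] by simp
  qed
  have "P (\<Sum>e\<in>E. Poly_Mapping.single e (Poly_Mapping.lookup p e))" if "finite E" for E
    using that by induction (auto intro: P0 A single)
  then show ?thesis
    by (subst mpoly_sum_monomials) simp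
qed

lemma algebra_hom_mpoly_ext:
  assumes "algebra_hom Const \<kappa> g" "algebra_hom Const \<kappa> h" "\<And>i. g (Var i) = h (Var i)"
  shows "g = h"
proof
  show "g p = h p" for p
    by (induction p rule: mpoly_induct) (use assms in \<open>auto simp: algebra_hom_def\<close>)
qed

lemma mpoly_eval_superset:
  assumes "\<kappa> 0 = 0" "finite E" "Poly_Mapping.keys p \<subseteq> E"
  shows "mpoly_eval \<kappa> f p = (\<Sum>e\<in>E. \<kappa> (Poly_Mapping.lookup p e) *
        (\<Prod>i\<in>Poly_Mapping.keys e. f i ^ Poly_Mapping.lookup e i))"
  unfolding mpoly_eval_def
  by (rule sum.mono_neutral_left) (use assms in \<open>auto simp: in_keys_iff\<close>)

lemma monomial_value_add:
  fixes f :: "'v \<Rightarrow> 'b::comm_ring_1"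
  shows "(\<Prod>i\<in>Poly_Mapping.keys (d + e). f i ^ Poly_Mapping.lookup (d + e) i) =
    (\<Prod>i\<in>Poly_Mapping.keys d. f i ^ Poly_Mapping.lookup d i) *
    (\<Prod>i\<in>Poly_Mapping.keys e. f i ^ Poly_Mapping.lookup e i)"
proof -
  let ?K = "Poly_Mapping.keys d \<union> Poly_Mapping.keys e"
  have *: "(\<Prod>i\<in>Poly_Mapping.keys a. f i ^ Poly_Mapping.lookup a i) =
      (\<Prod>i\<in>?K. f i ^ Poly_Mapping.lookup a i)" if "Poly_Mapping.keys a \<subseteq> ?K" for a
    by (rule prod.mono_neutral_left) (use that in \<open>auto simp: in_keys_iff\<close>)
  show ?thesis
    by (subst (1 2 3) *) (auto simp: lookup_add power_add prod.distrib in_keys_iff)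
qed

lemma algebra_hom_mpoly_eval:
  fixes \<kappa> :: "'k::comm_ring_1 \<Rightarrow> 'b::comm_ring_1"
  assumes k: "\<kappa> 0 = 0" "\<kappa> 1 = 1" "\<And>a b. \<kappa> (a + b) = \<kappa> a + \<kappa> b" "\<And>a b. \<kappa> (a * b) = \<kappa> a * \<kappa> b"
  shows "algebra_hom Const \<kappa> (mpoly_eval \<kappa> f)"
proof -
  let ?h = "mpoly_eval \<kappa> f"
  have single: "?h (Poly_Mapping.single e c) = \<kappa> c * (\<Prod>i\<in>Poly_Mapping.keys e. f i ^ Poly_Mapping.lookup e i)"
    for e c
    by (subst mpoly_eval_superset[where E = "{e}"]) (simp_all add: k)
  have add: "?h (p + q) = ?h p + ?h q" for p q
    using keys_add[of p q]
    by (subst (1 2 3) mpoly_eval_superset[where E = "Poly_Mapping.keys p \<union> Poly_Mapping.keys q"])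
       (auto simp: k lookup_add sum.distrib distrib_right)
  have const: "?h (Const c) = \<kappa> c" for c
    by (simp add: Const_def single)
  have zero: "?h 0 = 0" by (simp add: mpoly_eval_def)
  have sum: "?h (sum g I) = (\<Sum>i\<in>I. ?h (g i))" for g and I :: "('v \<Rightarrow>\<^sub>0 nat) set"
    by (induction I rule: infinite_finite_induct) (auto simp: add zero)
  have single_mult: "?h (Poly_Mapping.single d a * Poly_Mapping.single e b) =
      ?h (Poly_Mapping.single d a) * ?h (Poly_Mapping.single e b)" for a b d e
    by (simp add: mult_single single monomial_value_add k mult_ac)
  have "?h (p * q) = ?h p * ?h q" for p q
  proof -
    let ?S = "\<lambda>p::('v, 'k) mpoly. \<Sum>e\<in>Poly_Mapping.keys p. Poly_Mapping.single e (Poly_Mapping.lookup p e)"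
    have "?h (?S p * ?S q) = ?h (?S p) * ?h (?S q)"
      by (simp only: sum_product sum single_mult)
    then show ?thesis by (simp flip: mpoly_sum_monomials)
  qed
  moreover have "?h 1 = 1"
    using const[of 1] by (simp add: Const_hom k)
  ultimately show ?thesis
    by (simp add: algebra_hom_def const add)
qed

lemma mpoly_eval_Var:
  assumes "\<kappa> 0 = 0" "\<kappa> 1 = 1"
  shows "mpoly_eval \<kappa> f (Var i) = f i"
  by (subst mpoly_eval_superset[where E = "{Poly_Mapping.single i 1}"]) (simp_all add: Var_def assms)

lemma algebra_hom_hom_by_values: "algebra_hom Const (\<lambda>c. [:Const c:]) (hom_by_values f)"
  unfolding hom_by_values_def
  by (rule algebra_hom_mpoly_eval) (simp_all add: Const_hom)

lemma hom_by_values_Var: "hom_by_values f (Var i) = f i"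
  unfolding hom_by_values_def
  by (rule mpoly_eval_Var) (simp_all add: Const_hom)

lemma coeff_pcompose_add_indeterminates:
  fixes p :: "'b::comm_ring_1 poly"
  shows "coeff (coeff (pcompose (map_poly (\<lambda>a. [:a:]) p) [:[:0, 1:], 1:]) k) j =
    of_nat ((j + k) choose j) * coeff p (j + k)"
proof (induction p arbitrary: j k)
  case 0
  then show ?case by simp
next
  case (pCons a p)
  have "map_poly (\<lambda>a. [:a:]) (pCons a p) = pCons [:a:] (map_poly (\<lambda>a. [:a:]) p)"
    by (simp add: map_poly_pCons)
  then show ?case
    by (cases j; cases k)
       (simp_all add: pcompose_pCons mult_pCons_left pCons.IH algebra_simps
         del: coeff_pcompose_0)
qed

lemma lfihd_hom_by_values:
  fixes f :: "'v \<Rightarrow> ('v, 'k::comm_ring_1) mpoly poly"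
  assumes 0: "\<And>i. coeff (f i) 0 = Var i"
    and iter: "\<And>i. map_poly (hom_by_values f) (f i) = pcompose (map_poly (\<lambda>a. [:a:]) (f i)) [:[:0, 1:], 1:]"
  shows "lfihd Const (hom_by_values f)"
proof -
  let ?\<theta> = "hom_by_values f"
  have \<theta>: "algebra_hom Const (\<lambda>c. [:Const c:]) ?\<theta>"
    by (rule algebra_hom_hom_by_values)
  note h = \<theta>[unfolded algebra_hom_def]
  have h0: "?\<theta> 0 = 0"
    using h Const_hom(1) pCons_0_0 by metis
  have "(\<lambda>b. coeff (?\<theta> b) 0) = id"
    by (rule algebra_hom_mpoly_ext[where \<kappa> = Const])
       (use h in \<open>auto simp: algebra_hom_def hom_by_values_Var 0 coeff_mult\<close>)
  then have coeff0: "coeff (?\<theta> b) 0 = b" for b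
    by (metis id_apply)
  have \<theta>_sum: "?\<theta> (sum g I) = (\<Sum>i\<in>I. ?\<theta> (g i))" for g and I :: "nat set"
    by (induction I rule: infinite_finite_induct) (use h h0 in auto)
  have map_add: "map_poly ?\<theta> (p + q) = map_poly ?\<theta> p + map_poly ?\<theta> q" for p q
    using h h0 by (simp add: poly_eq_iff coeff_map_poly)
  have map_mult: "map_poly ?\<theta> (p * q) = map_poly ?\<theta> p * map_poly ?\<theta> q" for p q
    by (rule poly_eqI) (use h h0 in \<open>simp add: coeff_map_poly coeff_mult \<theta>_sum\<close>)
  let ?c = "map_poly (\<lambda>a::('v, 'k) mpoly. [:a:])"
  have c_add: "?c (p + q) = ?c p + ?c q" for p q
    by (rule poly_eqI) (simp add: coeff_map_poly)
  have const_sum: "[:sum g I:] = (\<Sum>i\<in>I. [:g i:])" for g :: "nat \<Rightarrow> ('v, 'k) mpoly" and I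
  proof (induction I rule: infinite_finite_induct)
    case (insert i I)
    have "[:sum g (insert i I):] = [:g i:] + [:sum g I:]"
      using insert.hyps by simp
    then show ?case using insert.hyps unfolding insert.IH by simp
  qed auto
  have c_mult: "?c (p * q) = ?c p * ?c q" for p q
    by (rule poly_eqI) (simp add: coeff_map_poly coeff_mult const_sum mult.commute)
  have "(\<lambda>b. map_poly ?\<theta> (?\<theta> b)) = (\<lambda>b. pcompose (?c (?\<theta> b)) [:[:0, 1:], 1:])"
  proof (rule algebra_hom_mpoly_ext[where \<kappa> = "\<lambda>c. [:[:Const c:]:]"])
    show "algebra_hom Const (\<lambda>c. [:[:Const c:]:]) (\<lambda>b. map_poly ?\<theta> (?\<theta> b))"
      using h h0 by (simp add: algebra_hom_def map_add map_mult map_poly_pCons)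
    show "algebra_hom Const (\<lambda>c. [:[:Const c:]:]) (\<lambda>b. pcompose (?c (?\<theta> b)) [:[:0, 1:], 1:])"
      using h by (simp add: algebra_hom_def c_add c_mult pcompose_add pcompose_mult map_poly_pCons
          pcompose_pCons pcompose_1)
  qed (simp add: hom_by_values_Var iter)
  then have eq: "map_poly ?\<theta> (?\<theta> b) = pcompose (?c (?\<theta> b)) [:[:0, 1:], 1:]" for b
    by meson
  have "coeff (?\<theta> (coeff (?\<theta> b) k)) j = of_nat ((j + k) choose j) * coeff (?\<theta> b) (j + k)" for j k b
    using arg_cong[OF eq, of "\<lambda>p. coeff (coeff p k) j" b]
    by (simp add: coeff_map_poly h0 coeff_pcompose_add_indeterminates)
  with \<theta> coeff0 show ?thesis
    by (simp add: lfihd_def)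
qed

text \<open>Each value below is the list of coefficients of \<open>1\<close>, \<open>U\<close>, \<open>U\<^sup>2\<close>, ...\<close>

datatype var5 = X5 | S5 | T5 | U5 | V5

fun values5 :: "nat \<Rightarrow> var5 \<Rightarrow> (var5, 'k::comm_ring_1) mpoly poly"
where
  "values5 m X5 = [:Var X5:]"
| "values5 m S5 = [:Var S5, Var X5 ^ (m + 1):]"
| "values5 m T5 = [:Var T5, 2 * Var S5, Var X5 ^ (m + 1):]"
| "values5 m U5 = [:Var U5, 3 * Var T5, 3 * Var S5, Var X5 ^ (m + 1):]"
| "values5 m V5 = [:Var V5, Var X5 ^ m:]"

definition theta5 :: "nat \<Rightarrow> (var5, 'k::comm_ring_1) mpoly \<Rightarrow> (var5, 'k) mpoly poly"
  where "theta5 m = hom_by_values (values5 m)"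

datatype var6 = X6 | Y6 | S6 | T6 | U6 | V6

fun values6 :: "nat \<Rightarrow> var6 \<Rightarrow> (var6, 'k::comm_ring_1) mpoly poly"
where
  "values6 m X6 = [:Var X6:]"
| "values6 m Y6 = [:Var Y6:]"
| "values6 m S6 = [:Var S6, Var X6 ^ (m + 1):]"
| "values6 m T6 = [:Var T6, 2 * Var Y6 ^ (m + 1) * Var S6, Var X6 ^ (m + 1) * Var Y6 ^ (m + 1):]"
| "values6 m U6 = [:Var U6, 3 * Var Y6 ^ (m + 1) * Var T6, 3 * Var Y6 ^ (2 * (m + 1)) * Var S6,
     Var X6 ^ (m + 1) * Var Y6 ^ (2 * (m + 1)):]"
| "values6 m V6 = [:Var V6, Var X6 ^ m * Var Y6 ^ m:]"

definition theta6 :: "nat \<Rightarrow> (var6, 'k::comm_ring_1) mpoly \<Rightarrow> (var6, 'k) mpoly poly"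
  where "theta6 m = hom_by_values (values6 m)"

datatype var7 = X7_1 | X7_2 | X7_3 | Y7_1 | Y7_2 | Y7_3 | V7

fun values7 :: "nat \<Rightarrow> var7 \<Rightarrow> (var7, 'k::comm_ring_1) mpoly poly"
where
  "values7 m X7_1 = [:Var X7_1:]"
| "values7 m X7_2 = [:Var X7_2:]"
| "values7 m X7_3 = [:Var X7_3:]"
| "values7 m Y7_1 = [:Var Y7_1, Var X7_1 ^ (m + 1):]"
| "values7 m Y7_2 = [:Var Y7_2, Var X7_2 ^ (m + 1):]"
| "values7 m Y7_3 = [:Var Y7_3, Var X7_3 ^ (m + 1):]"
| "values7 m V7 = [:Var V7, Var X7_1 ^ m * Var X7_2 ^ m * Var X7_3 ^ m:]"

definition theta7 :: "nat \<Rightarrow> (var7, 'k::comm_ring_1) mpoly \<Rightarrow> (var7, 'k) mpoly poly"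
  where "theta7 m = hom_by_values (values7 m)"

lemma hom_by_values_simps:
  "hom_by_values f (a + b) = hom_by_values f a + hom_by_values f b"
  "hom_by_values f (a * b) = hom_by_values f a * hom_by_values f b"
  "hom_by_values f 0 = 0"
  "hom_by_values f 1 = 1"
  "hom_by_values f (a ^ n) = hom_by_values f a ^ n"
  "hom_by_values f (numeral w) = numeral w"
proof -
  note h = algebra_hom_hom_by_values[of f, unfolded algebra_hom_def]
  show add: "hom_by_values f (a + b) = hom_by_values f a + hom_by_values f b" for a b
    using h by blast
  show mult: "hom_by_values f (a * b) = hom_by_values f a * hom_by_values f b" for a b
    using h by blast
  show 0: "hom_by_values f 0 = 0"
    using h Const_hom(1) pCons_0_0 by metis
  show 1: "hom_by_values f 1 = 1"
    using h by blast
  show "hom_by_values f (a ^ n) = hom_by_values f a ^ n"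
    by (induction n) (simp_all add: mult 1)
  show "hom_by_values f (numeral w) = numeral w"
    by (induction w) (simp_all only: numeral.simps add 1)
qed

lemma const_power: "[:a:] ^ n = [:a ^ n:]" for a :: "'a::comm_ring_1"
  by (induction n) (simp_all add: one_pCons)

lemma map_poly_eq_pcompose_degree3:
  fixes h :: "'b::comm_ring_1 \<Rightarrow> 'b poly"
  assumes "h 0 = 0"
    and "h a0 = [:a0, a1, a2, a3:]" "h a1 = [:a1, 2 * a2, 3 * a3:]" "h a2 = [:a2, 3 * a3:]" "h a3 = [:a3:]"
  shows "map_poly h [:a0, a1, a2, a3:] =
    pcompose (map_poly (\<lambda>a. [:a:]) [:a0, a1, a2, a3:]) [:[:0, 1:], 1:]"
  using assms by (simp add: map_poly_pCons pcompose_pCons algebra_simps)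

lemma power_Suc_Suc_double: "a ^ Suc (Suc (m + m)) = a ^ Suc m * a ^ Suc m" for a :: "'a::comm_ring_1"
  by (simp add: power_add mult_ac)

lemma lfihd_hom_by_values_degree3:
  fixes f :: "'v \<Rightarrow> ('v, 'k::comm_ring_1) mpoly poly"
  assumes "\<And>i. \<exists>a1 a2 a3. f i = [:Var i, a1, a2, a3:] \<and> hom_by_values f a1 = [:a1, 2 * a2, 3 * a3:] \<and>
    hom_by_values f a2 = [:a2, 3 * a3:] \<and> hom_by_values f a3 = [:a3:]"
  shows "lfihd Const (hom_by_values f)"
proof (rule lfihd_hom_by_values)
  fix i
  obtain a1 a2 a3 where eq: "f i = [:Var i, a1, a2, a3:]"
    and *: "hom_by_values f a1 = [:a1, 2 * a2, 3 * a3:]" "hom_by_values f a2 = [:a2, 3 * a3:]"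
      "hom_by_values f a3 = [:a3:]"
    using assms[of i] by blast
  have "hom_by_values f (Var i) = [:Var i, a1, a2, a3:]"
    using eq by (simp add: hom_by_values_Var)
  then have "map_poly (hom_by_values f) [:Var i, a1, a2, a3:] =
      pcompose (map_poly (\<lambda>a. [:a:]) [:Var i, a1, a2, a3:]) [:[:0, 1:], 1:]"
    by (rule map_poly_eq_pcompose_degree3[OF hom_by_values_simps(3) _ *])
  with eq show "map_poly (hom_by_values f) (f i) =
      pcompose (map_poly (\<lambda>a. [:a:]) (f i)) [:[:0, 1:], 1:]"
    by (simp only:)
  from eq show "coeff (f i) 0 = Var i"
    by simp
qed

lemma lfihd_theta5: "lfihd Const (theta5 m)"
  unfolding theta5_def
proof (rule lfihd_hom_by_values_degree3)
  let ?h = "hom_by_values (values5 m)"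
  show "\<exists>a1 a2 a3. values5 m i = [:Var i, a1, a2, a3:] \<and> ?h a1 = [:a1, 2 * a2, 3 * a3:] \<and>
      ?h a2 = [:a2, 3 * a3:] \<and> ?h a3 = [:a3:]" for i
    by (cases i; rule exI[of _ "coeff (values5 m i) 1"];
        rule exI[of _ "coeff (values5 m i) 2"]; rule exI[of _ "coeff (values5 m i) 3"])
       (simp_all add: hom_by_values_simps hom_by_values_Var const_power numeral_poly
         numeral_2_eq_2 numeral_3_eq_3 mult_ac power_Suc_Suc_double del: power_Suc)
qed

lemma lfihd_theta6: "lfihd Const (theta6 m)"
  unfolding theta6_def
proof (rule lfihd_hom_by_values_degree3)
  let ?h = "hom_by_values (values6 m)"
  show "\<exists>a1 a2 a3. values6 m i = [:Var i, a1, a2, a3:] \<and> ?h a1 = [:a1, 2 * a2, 3 * a3:] \<and>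
      ?h a2 = [:a2, 3 * a3:] \<and> ?h a3 = [:a3:]" for i
    by (cases i; rule exI[of _ "coeff (values6 m i) 1"];
        rule exI[of _ "coeff (values6 m i) 2"]; rule exI[of _ "coeff (values6 m i) 3"])
       (simp_all add: hom_by_values_simps hom_by_values_Var const_power numeral_poly
         numeral_2_eq_2 numeral_3_eq_3 mult_ac power_Suc_Suc_double del: power_Suc)
qed

lemma lfihd_theta7: "lfihd Const (theta7 m)"
  unfolding theta7_def
proof (rule lfihd_hom_by_values_degree3)
  let ?h = "hom_by_values (values7 m)"
  show "\<exists>a1 a2 a3. values7 m i = [:Var i, a1, a2, a3:] \<and> ?h a1 = [:a1, 2 * a2, 3 * a3:] \<and>
      ?h a2 = [:a2, 3 * a3:] \<and> ?h a3 = [:a3:]" for i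
    by (cases i; rule exI[of _ "coeff (values7 m i) 1"];
        rule exI[of _ "coeff (values7 m i) 2"]; rule exI[of _ "coeff (values7 m i) 3"])
       (simp_all add: hom_by_values_simps hom_by_values_Var const_power numeral_poly
         numeral_2_eq_2 numeral_3_eq_3 mult_ac power_Suc_Suc_double del: power_Suc)
qed

end

theory Submission
  imports Defs "HOL-Library.Countable"
begin

text \<open>
  In each example \<open>B = R[v]\<close> with \<open>R\<close> stable under \<open>\<theta>\<close> and \<open>\<theta>(v) = v + cU\<close>. The leading coefficient in \<open>v\<close>
  of an invariant is an invariant of \<open>R\<close>. Hence, as in Hilbert's basis theorem, \<open>B\<^sup>\<theta>\<close> is a finitely generated
  module over \<open>R\<^sup>\<theta>[w]\<close> as soon as \<open>R\<^sup>\<theta>\<close> is finitely generated and some invariant \<open>w\<close> is monic in \<open>v\<close>.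

  The monic invariant is where positive characteristic \<open>p\<close> enters. For \<open>p \<noteq> 3\<close> take a cubic over \<open>R\<close> with leading
  coefficient \<open>a\<close> whose roots are translated by \<open>U\<close>, let \<open>e = \<lfloor>2p/3\<rfloor>\<close> and let \<open>q\<^sub>j\<close> be the coefficient of \<open>W\<^sup>j\<close> in
  the \<open>e\<close>-th power of the reciprocal cubic. Modulo \<open>p\<close> one finds \<open>\<theta>(q\<^sub>p) = q\<^sub>p + a\<^sup>e U\<^sup>p\<close> if \<open>p \<equiv> 2\<close> modulo 3, and
  \<open>\<theta>(q\<^sub>p) = q\<^sub>p - q\<^sub>p\<^sub>-\<^sub>1 U + a\<^sup>e U\<^sup>p\<close> with \<open>q\<^sub>p\<^sub>-\<^sub>1\<close> invariant if \<open>p \<equiv> 1\<close>, so that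
  \<open>v\<^sup>p - c\<^sup>p a\<^sup>-\<^sup>e q\<^sub>p\<close>, respectively \<open>v\<^sup>p - c\<^sup>p a\<^sup>-\<^sup>e q\<^sub>p - c\<^sup>p\<^sup>-\<^sup>1 a\<^sup>-\<^sup>e q\<^sub>p\<^sub>-\<^sub>1 v\<close>, is invariant. The denominators cancel
  because \<open>e \<le> 2p/3 \<le> mp/(m+1)\<close>; this uses \<open>m \<ge> 2\<close>. For \<open>p = 3\<close>
  a monic invariant is written down directly.

  The ring \<open>R\<^sup>\<theta>\<close> is computed by localizing at a variable \<open>x\<close>, where a slice exists, and by checking that explicit
  invariants generate an algebra \<open>C\<close> with \<open>C \<inter> xR = xC\<close>; for the latter, \<open>C\<close> is spanned modulo \<open>x\<close> by monomials in the
  generators that remain distinct monomials after setting further variables to zero.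
\<close>

section \<open>Hilbert's basis theorem for subrings\<close>

text \<open>The multipliers \<open>A\<close> may be any set: a module over \<open>A[w]\<close> is
  described by taking \<open>w\<close> and the constants from \<open>A\<close> as
  multipliers.\<close>

definition submodule_over :: "'a::comm_ring_1 set \<Rightarrow> 'a set \<Rightarrow> bool"
  where "submodule_over A M \<longleftrightarrow>
     0 \<in> M \<and> (\<forall>a\<in>M. \<forall>b\<in>M. a + b \<in> M) \<and> (\<forall>a\<in>A. \<forall>b\<in>M. a * b \<in> M)"

lemma submodule_over_hull: "submodule_over A (submodule_over A hull F)"
  by (rule hull_in) (auto simp: submodule_over_def)

lemma submodule_over_add: "submodule_over A M \<Longrightarrow> a \<in> M \<Longrightarrow> b \<in> M \<Longrightarrow> a + b \<in> M"
  and submodule_over_mult: "submodule_over A M \<Longrightarrow> c \<in> A \<Longrightarrow> b \<in> M \<Longrightarrow> c * b \<in> M"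
  and submodule_over_zero: "submodule_over A M \<Longrightarrow> 0 \<in> M"
  by (auto simp: submodule_over_def)

lemma submodule_over_diff:
  assumes "submodule_over A M" "-1 \<in> A" "a \<in> M" "b \<in> M"
  shows "a - b \<in> M"
  using submodule_over_add[OF assms(1,3) submodule_over_mult[OF assms(1,2,4)]] by simp

definition noetherian_on :: "'a::comm_ring_1 set \<Rightarrow> bool"
  where "noetherian_on A \<longleftrightarrow>
     (\<forall>I\<subseteq>A. submodule_over A I \<longrightarrow> (\<exists>F. finite F \<and> F \<subseteq> I \<and> submodule_over A hull F = I))"

lemma submodule_over_Union_chain:
  assumes "\<And>k::nat. submodule_over A (J k)" and "\<And>k. J k \<subseteq> J (Suc k)"
  shows "submodule_over A (\<Union>k. J k)"
proof -
  have mono: "J i \<subseteq> J j" if "i \<le> j" for i j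
    using assms(2) that by (rule lift_Suc_mono_le)
  have "a + b \<in> (\<Union>k. J k)" if ab: "a \<in> J i" "b \<in> J j" for a b i j
  proof -
    have "a \<in> J (max i j)" "b \<in> J (max i j)"
      using ab mono[of i "max i j"] mono[of j "max i j"] by auto
    then show ?thesis
      using submodule_over_add[OF assms(1)] by blast
  qed
  moreover have "0 \<in> (\<Union>k. J k)"
    using submodule_over_zero[OF assms(1)] by blast
  moreover have "c * b \<in> (\<Union>k. J k)" if "c \<in> A" "b \<in> J j" for b c j
    using submodule_over_mult[OF assms(1) that] by blast
  ultimately show ?thesis
    unfolding submodule_over_def by (metis UN_E)
qed

text \<open>The union of the chain is again an ideal, and its finitely many generators all lie in
  one member.\<close>

lemma noetherian_on_chain_stabilizes:
  assumes A: "noetherian_on A" and J: "\<And>k::nat. submodule_over A (J k)" "\<And>k. J k \<subseteq> J (Suc k)" "\<And>k. J k \<subseteq> A"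
  shows "\<exists>K. \<forall>k\<ge>K. J (Suc k) \<subseteq> J k"
proof -
  have mono: "J i \<subseteq> J j" if "i \<le> j" for i j
    using J(2) that by (rule lift_Suc_mono_le)
  obtain F where F: "finite F" "F \<subseteq> (\<Union>k. J k)" "submodule_over A hull F = (\<Union>k. J k)"
    using A submodule_over_Union_chain[of A J, OF J(1,2)] J(3)
    unfolding noetherian_on_def by (metis UN_least)
  obtain k where k: "\<And>f. f \<in> F \<Longrightarrow> f \<in> J (k f)"
    using F(2) by (metis UN_E subsetD)
  define K where "K = (\<Sum>f\<in>F. k f)"
  have "F \<subseteq> J i" if "i \<ge> K" for i
  proof
    fix f assume "f \<in> F"
    then have "k f \<le> i"
      using that F(1) member_le_sum[of f F k] unfolding K_def by auto
    then show "f \<in> J i"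
      using mono k[OF \<open>f \<in> F\<close>] by blast
  qed
  then have "(\<Union>k. J k) \<subseteq> J i" if "i \<ge> K" for i
    using that J(1) F(3) by (metis hull_minimal)
  then show ?thesis by blast
qed

lemma coeff_mult_degree_le:
  fixes p q :: "'a::comm_semiring_0 poly"
  assumes "degree p \<le> n" "degree q \<le> m"
  shows "coeff (p * q) (n + m) = coeff p n * coeff q m"
proof -
  have "coeff (p * q) (n + m) = (\<Sum>i\<le>n + m. coeff p i * coeff q (n + m - i))"
    by (simp add: coeff_mult)
  also have "\<dots> = (\<Sum>i\<in>{n}. coeff p i * coeff q (n + m - i))"
  proof (rule sum.mono_neutral_right)
    show "\<forall>i\<in>{..n + m} - {n}. coeff p i * coeff q (n + m - i) = 0"
    proof
      fix i assume i: "i \<in> {..n + m} - {n}"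
      show "coeff p i * coeff q (n + m - i) = 0"
        using i assms by (cases "i > n") (auto simp: coeff_eq_0)
    qed
  qed auto
  finally show ?thesis by simp
qed

text \<open>Hilbert's basis argument with a monic \<open>w\<close> in place of the indeterminate; of
  the coefficients of members of \<open>P\<close> only the leading ones lie in \<open>A\<close>. For
  \<open>w = [:0, 1:]\<close> it gives the basis theorem, and for an invariant monic in
  \<open>v\<close> it gives finiteness of the invariants over \<open>A[w]\<close>.\<close>

lemma finitely_generated_by_leading_coeffs:
  fixes P :: "'a::comm_ring_1 poly set" and w :: "'a poly"
  assumes A: "noetherian_on A" and A0: "0 \<in> A" and A1: "-1 \<in> A"
    and P: "submodule_over (insert w ((\<lambda>a. [:a:]) ` A)) P"
    and lead: "\<And>p. p \<in> P \<Longrightarrow> lead_coeff p \<in> A"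
    and w: "lead_coeff w = 1" "degree w > 0"
  shows "\<exists>F. finite F \<and> F \<subseteq> P \<and> submodule_over (insert w ((\<lambda>a. [:a:]) ` A)) hull F = P"
proof -
  let ?S = "insert w ((\<lambda>a. [:a:]) ` A)"
  let ?n = "degree w"
  have one: "-1 \<in> ?S"
    using A1 by (auto simp: one_pCons)
  have smult: "smult a p \<in> M" if "submodule_over ?S M" "a \<in> A" "p \<in> M" for M a p
    using submodule_over_mult[OF that(1), of "[:a:]" p] that by simp
  \<comment> \<open>The bound \<open>degree p \<le> d\<close> instead of equality makes
    \<open>I M d\<close> contain 0 and closes it under sums.\<close>
  define I where "I M d = {coeff p d | p. p \<in> M \<and> degree p \<le> d}" for M :: "'a poly set" and d
  have I_sub: "submodule_over A (I M d)" if M: "submodule_over ?S M" for M d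
    unfolding submodule_over_def
  proof (intro conjI ballI)
    show "0 \<in> I M d"
      unfolding I_def using submodule_over_zero[OF M] by force
    fix a b
    assume "b \<in> I M d"
    then obtain q where q: "b = coeff q d" "q \<in> M" "degree q \<le> d"
      unfolding I_def by blast
    {
      assume "a \<in> I M d"
      then obtain p where p: "a = coeff p d" "p \<in> M" "degree p \<le> d"
        unfolding I_def by blast
      have "a + b = coeff (p + q) d" "p + q \<in> M" "degree (p + q) \<le> d"
        using p q submodule_over_add[OF M] by (auto intro: degree_add_le)
      then show "a + b \<in> I M d"
        unfolding I_def by blast
    next
      assume "a \<in> A"
      then have "a * b = coeff (smult a q) d" "smult a q \<in> M" "degree (smult a q) \<le> d"
        using q smult[OF M] by (auto intro: order_trans[OF degree_smult_le])
      then show "a * b \<in> I M d"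
        unfolding I_def by blast
    }
  qed
  have I_A: "I P d \<subseteq> A" for d
  proof -
    have "coeff p d \<in> A" if "p \<in> P" "degree p \<le> d" for p
      using lead[OF that(1)] that(2) A0 by (cases "degree p = d") (auto simp: coeff_eq_0)
    then show ?thesis unfolding I_def by blast
  qed
  have shift: "coeff (w * p) (?n + d) = coeff p d" "degree (w * p) \<le> ?n + d" if "degree p \<le> d" for p d
  proof -
    show "degree (w * p) \<le> ?n + d"
      using degree_mult_le[of w p] that by linarith
    show "coeff (w * p) (?n + d) = coeff p d"
      using coeff_mult_degree_le[OF order_refl that, of w] w by simp
  qed
  have I_mono: "I P d \<subseteq> I P (?n + d)" for d
  proof
    fix c assume "c \<in> I P d"
    then obtain p where p: "c = coeff p d" "p \<in> P" "degree p \<le> d"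
      unfolding I_def by blast
    then show "c \<in> I P (?n + d)"
      unfolding I_def using shift[of p d] submodule_over_mult[OF P, of w p] by force
  qed
  \<comment> \<open>Multiplication by \<open>w\<close> raises degrees by \<open>?n\<close>, so the
    ideals increase along each residue class \<open>j\<close> modulo \<open>?n\<close> and stabilize
    there.\<close>
  have "\<exists>K. \<forall>k\<ge>K. I P (?n * Suc k + j) \<subseteq> I P (?n * k + j)" for j
    by (rule noetherian_on_chain_stabilizes[OF A])
       (use I_mono[of "?n * _ + j"] in \<open>auto simp: I_sub[OF P] I_A algebra_simps\<close>)
  then obtain K where K: "\<And>j k. k \<ge> K j \<Longrightarrow> I P (?n * Suc k + j) \<subseteq> I P (?n * k + j)"
    by metis
  \<comment> \<open>The sum dominates every \<open>K j\<close>, so \<open>D\<close> lies beyond the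
    stabilization of all residue classes at once.\<close>
  define D where "D = ?n * Suc (\<Sum>j<?n. K j)"
  have I_stable: "I P d \<subseteq> I P (d - ?n)" if "d \<ge> D + ?n" for d
  proof -
    let ?k = "(d - ?n) div ?n" and ?j = "(d - ?n) mod ?n"
    have "K ?j \<le> (\<Sum>j<?n. K j)"
      using w(2) by (intro member_le_sum) auto
    also have "\<dots> \<le> ?k"
      using that w(2) unfolding D_def by (subst less_eq_div_iff_mult_less_eq) (auto simp: mult.commute)
    finally have "I P (?n * Suc ?k + ?j) \<subseteq> I P (?n * ?k + ?j)"
      by (rule K)
    moreover have "?n * ?k + ?j = d - ?n" "?n * Suc ?k + ?j = d"
      using that by (simp_all add: algebra_simps)
    ultimately show ?thesis by simp
  qed
  have "\<forall>d. \<exists>F. finite F \<and> F \<subseteq> I P d \<and> submodule_over A hull F = I P d"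
    using A I_sub[OF P] I_A unfolding noetherian_on_def by blast
  then obtain G where G: "\<And>d. finite (G d)" "\<And>d. G d \<subseteq> I P d" "\<And>d. submodule_over A hull (G d) = I P d"
    by metis
  have "\<forall>d. \<forall>c\<in>G d. \<exists>p. p \<in> P \<and> degree p \<le> d \<and> coeff p d = c"
    using G(2) unfolding I_def by blast
  then obtain lift where lift: "\<And>d c. c \<in> G d \<Longrightarrow> lift d c \<in> P \<and> degree (lift d c) \<le> d \<and> coeff (lift d c) d = c"
    by metis
  \<comment> \<open>Lifted ideal generators for the low degrees, where multiplication by
    \<open>w\<close> does not yet reach every leading coefficient.\<close>
  define F where "F = (\<Union>d<D + ?n. lift d ` G d)"
  have F: "finite F" "F \<subseteq> P"
    unfolding F_def using G(1) lift by auto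
  define M where "M = submodule_over ?S hull F"
  have M: "submodule_over ?S M"
    unfolding M_def by (rule submodule_over_hull)
  have MP: "M \<subseteq> P"
    unfolding M_def using F(2) P by (rule hull_minimal)
  have FM: "F \<subseteq> M"
    unfolding M_def by (rule hull_subset)
  have "p \<in> M" if "p \<in> P" for p
    using that
  proof (induction "degree p" arbitrary: p rule: less_induct)
    case less
    let ?d = "degree p"
    \<comment> \<open>Some element of \<open>M\<close> shares the leading term of \<open>p\<close>:
      in low degree by the lifted generators, in high degree as \<open>w\<close> times an element of
      smaller degree, to which the induction hypothesis applies.\<close>
    have "\<exists>f\<in>M. degree f \<le> ?d \<and> coeff f ?d = lead_coeff p"
    proof (cases "?d < D + ?n")
      case True
      have "G ?d \<subseteq> I M ?d"
      proof
        fix c assume c: "c \<in> G ?d"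
        then have "lift ?d c \<in> M"
          using True FM unfolding F_def by blast
        then show "c \<in> I M ?d"
          unfolding I_def using lift[OF c] by (intro CollectI exI[of _ "lift ?d c"]) auto
      qed
      then have "I P ?d \<subseteq> I M ?d"
        using hull_minimal[of "G ?d" "I M ?d" "submodule_over A"] I_sub[OF M] G(3) by metis
      moreover have "lead_coeff p \<in> I P ?d"
        unfolding I_def using less.prems by blast
      ultimately show ?thesis
        unfolding I_def by force
    next
      case False
      have "lead_coeff p \<in> I P ?d"
        unfolding I_def using less.prems by blast
      then obtain q where q: "q \<in> P" "degree q \<le> ?d - ?n" "coeff q (?d - ?n) = lead_coeff p"
        using I_stable[of ?d] False unfolding I_def by force
      have "degree q < ?d"
        using q(2) False w(2) by linarith
      then have "w * q \<in> M"
        using less.hyps[OF _ q(1)] submodule_over_mult[OF M] by blast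
      then show ?thesis
        using shift[OF q(2)] q(3) False by (intro bexI[of _ "w * q"]) auto
    qed
    then obtain f where f: "f \<in> M" "degree f \<le> ?d" "coeff f ?d = lead_coeff p"
      by blast
    have "p - f \<in> M"
    proof (cases "p - f = 0")
      case True
      then show ?thesis using submodule_over_zero[OF M] by simp
    next
      case False
      have "coeff (p - f) ?d = 0" "degree (p - f) \<le> ?d"
        using f by (auto intro: degree_diff_le)
      then have "degree (p - f) < ?d"
        using False by (metis le_neq_implies_less leading_coeff_neq_0)
      moreover have "p - f \<in> P"
        using submodule_over_diff[OF P one less.prems] f(1) MP by blast
      ultimately show ?thesis
        using less.hyps by blast
    qed
    then have "(p - f) + f \<in> M"
      using f(1) submodule_over_add[OF M] by blast
    then show ?case by simp
  qed
  then show ?thesis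
    using F MP unfolding M_def by blast
qed

section \<open>Subalgebras and adjunction of a generator\<close>

lemma is_subalgebra_const: "is_subalgebra \<iota> A \<Longrightarrow> \<iota> c \<in> A"
  and is_subalgebra_add: "is_subalgebra \<iota> A \<Longrightarrow> a \<in> A \<Longrightarrow> b \<in> A \<Longrightarrow> a + b \<in> A"
  and is_subalgebra_mult: "is_subalgebra \<iota> A \<Longrightarrow> a \<in> A \<Longrightarrow> b \<in> A \<Longrightarrow> a * b \<in> A"
  by (auto simp: is_subalgebra_def)

lemma is_subalgebraI:
  assumes "\<And>c. \<iota> c \<in> A" "\<And>a b. a \<in> A \<Longrightarrow> b \<in> A \<Longrightarrow> a + b \<in> A"
    "\<And>a b. a \<in> A \<Longrightarrow> b \<in> A \<Longrightarrow> a * b \<in> A"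
  shows "is_subalgebra \<iota> A"
  using assms by (auto simp: is_subalgebra_def)

lemma is_subalgebra_sum:
  assumes "is_subalgebra \<iota> A" "\<iota> 0 = 0" "\<And>i. i \<in> I \<Longrightarrow> f i \<in> A"
  shows "sum f I \<in> A"
  using assms(3)
proof (induction I rule: infinite_finite_induct)
  case (insert i I)
  then show ?case using is_subalgebra_add[OF assms(1)] by simp
qed (use is_subalgebra_const[OF assms(1), of 0] assms(2) in simp_all)

lemma is_subalgebra_power:
  assumes "is_subalgebra \<iota> A" "\<iota> 1 = 1" "a \<in> A"
  shows "a ^ n \<in> A"
proof (induction n)
  case (Suc n)
  then show ?case using is_subalgebra_mult[OF assms(1,3)] by simp
qed (use is_subalgebra_const[OF assms(1), of 1] assms(2) in simp)

text \<open>Presents \<open>A[g]\<close> as an image of polynomials over \<open>A\<close>, so that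
  Hilbert's argument can proceed one generator at a time.\<close>

lemma is_subalgebra_hull_insert:
  assumes "\<iota> 0 = 0" "\<iota> 1 = 1"
  shows "is_subalgebra \<iota> hull (insert g G) = {poly p g | p. \<forall>i. coeff p i \<in> is_subalgebra \<iota> hull G}"
proof (rule hull_unique)
  let ?A = "is_subalgebra \<iota> hull G"
  let ?T = "{poly p g | p. \<forall>i. coeff p i \<in> ?A}"
  note A = is_subalgebra_hull[of \<iota> G]
  note cA = is_subalgebra_const[OF A]
  have in_T: "poly p g \<in> ?T" if "\<And>i. coeff p i \<in> ?A" for p
    using that by blast
  have const: "a \<in> ?T" if "a \<in> ?A" for a
    using in_T[of "[:a:]"] that cA[of 0] assms by (auto simp: coeff_pCons split: nat.splits)
  have "g \<in> ?T"
    using in_T[of "[:0, 1:]"] cA[of 0] cA[of 1] assms by (auto simp: coeff_pCons split: nat.splits)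
  then show "insert g G \<subseteq> ?T"
    using const hull_subset[of G "is_subalgebra \<iota>"] by blast
  show "is_subalgebra \<iota> ?T"
  proof (rule is_subalgebraI)
    show "\<iota> c \<in> ?T" for c
      using const cA by blast
    fix a b assume "a \<in> ?T" "b \<in> ?T"
    then obtain p q where pq: "a = poly p g" "b = poly q g" "\<And>i. coeff p i \<in> ?A" "\<And>i. coeff q i \<in> ?A"
      by blast
    show "a + b \<in> ?T"
      using in_T[of "p + q"] pq is_subalgebra_add[OF A] by simp
    have "coeff (p * q) i \<in> ?A" for i
      unfolding coeff_mult
      by (rule is_subalgebra_sum[OF A assms(1)]) (use pq is_subalgebra_mult[OF A] in auto)
    then show "a * b \<in> ?T"
      using in_T[of "p * q"] pq by simp
  qed
  fix T assume T: "insert g G \<subseteq> T" "is_subalgebra \<iota> T"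
  have AT: "?A \<subseteq> T"
    using T by (intro hull_minimal) auto
  show "?T \<subseteq> T"
  proof
    fix a assume "a \<in> ?T"
    then obtain p where p: "a = poly p g" "\<And>i. coeff p i \<in> ?A"
      by blast
    then show "a \<in> T"
      unfolding p(1) poly_altdef using T AT
      by (intro is_subalgebra_sum[OF T(2) assms(1)] is_subalgebra_mult[OF T(2)]
          is_subalgebra_power[OF T(2) assms(2)]) auto
  qed
qed

text \<open>Induction on the generators. The image of a field has only trivial ideals. An ideal of
  \<open>A[g]\<close> is pulled back along evaluation at \<open>g\<close> to polynomials over
  \<open>A\<close>, where the leading coefficient argument applies with the indeterminate as
  \<open>w\<close>.\<close>

lemma noetherian_on_hull:
  fixes \<iota> :: "'k::field \<Rightarrow> 'b::comm_ring_1"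
  assumes \<iota>: "\<iota> 0 = 0" "\<iota> 1 = 1" "\<iota> (-1) = -1" "\<And>a b. \<iota> (a + b) = \<iota> a + \<iota> b" "\<And>a b. \<iota> (a * b) = \<iota> a * \<iota> b"
    and "finite G"
  shows "noetherian_on (is_subalgebra \<iota> hull G)"
  using \<open>finite G\<close>
proof induction
  case empty
  have "is_subalgebra \<iota> (range \<iota>)"
    unfolding is_subalgebra_def
    by (auto simp flip: \<iota>(4,5))
  then have k: "is_subalgebra \<iota> hull {} = range \<iota>"
    by (intro hull_unique) (auto simp: is_subalgebra_def)
  show ?case
    unfolding noetherian_on_def k
  proof (intro allI impI)
    fix I assume I: "I \<subseteq> range \<iota>" "submodule_over (range \<iota>) I"
    show "\<exists>F. finite F \<and> F \<subseteq> I \<and> submodule_over (range \<iota>) hull F = I"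
    proof (cases "\<exists>c. c \<noteq> 0 \<and> \<iota> c \<in> I")
      case True
      then obtain c where c: "c \<noteq> 0" "\<iota> c \<in> I" by blast
      have "I \<subseteq> submodule_over (range \<iota>) hull {\<iota> c}"
      proof
        fix a assume "a \<in> I"
        then obtain d where "a = \<iota> d" using I(1) by blast
        then have "a = \<iota> (d / c) * \<iota> c"
          using c by (simp flip: \<iota>(5))
        then show "a \<in> submodule_over (range \<iota>) hull {\<iota> c}"
          by (simp only:) (rule submodule_over_mult[OF submodule_over_hull rangeI hull_inc], simp)
      qed
      moreover have "submodule_over (range \<iota>) hull {\<iota> c} \<subseteq> I"
        using c I(2) by (intro hull_minimal) auto
      ultimately show ?thesis
        using c by (intro exI[of _ "{\<iota> c}"]) auto
    next
      case False
      then have "a = 0" if "a \<in> I" for a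
        using that I(1) \<iota>(1) by (metis imageE subsetD)
      then have "I = {0}"
        using submodule_over_zero[OF I(2)] by blast
      then show ?thesis
        using I(2) hull_same[of "submodule_over (range \<iota>)" "{0}"]
        by (intro exI[of _ "{0}"]) simp
    qed
  qed
next
  case (insert g G)
  let ?A = "is_subalgebra \<iota> hull G"
  let ?B = "is_subalgebra \<iota> hull (insert g G)"
  note A = is_subalgebra_hull[of \<iota> G]
  note cA = is_subalgebra_const[OF A]
  have B: "?B = {poly p g | p. \<forall>i. coeff p i \<in> ?A}"
    using \<iota> by (intro is_subalgebra_hull_insert)
  have X: "\<forall>i. coeff [:0, 1:] i \<in> ?A"
    using cA[of 0] cA[of 1] \<iota> by (auto simp: coeff_pCons split: nat.splits)
  show ?case
    unfolding noetherian_on_def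
  proof (intro allI impI)
    fix I assume I: "I \<subseteq> ?B" "submodule_over ?B I"
    let ?S = "insert [:0, 1:] ((\<lambda>a. [:a:]) ` ?A)"
    define pre where "pre J = {p. (\<forall>i. coeff p i \<in> ?A) \<and> poly p g \<in> J}" for J
    have pre: "submodule_over ?S (pre J)" if J: "submodule_over ?B J" for J
      unfolding submodule_over_def
    proof (intro conjI ballI)
      show "0 \<in> pre J"
        unfolding pre_def using cA[of 0] \<iota>(1) submodule_over_zero[OF J] by simp
    next
      fix p q assume "p \<in> pre J" "q \<in> pre J"
      then show "p + q \<in> pre J"
        unfolding pre_def using submodule_over_add[OF J] is_subalgebra_add[OF A] by simp
    next
      fix p q assume p: "p \<in> ?S" and q: "q \<in> pre J"
      have p': "\<forall>i. coeff p i \<in> ?A"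
        using p X cA[of 0] \<iota> by (auto simp: coeff_pCons split: nat.splits)
      have "coeff (p * q) i \<in> ?A" for i
        unfolding coeff_mult
        by (rule is_subalgebra_sum[OF A \<iota>(1)])
           (use p' q is_subalgebra_mult[OF A] in \<open>auto simp: pre_def\<close>)
      moreover have "poly p g \<in> ?B"
        unfolding B using p' by blast
      ultimately show "p * q \<in> pre J"
        using q submodule_over_mult[OF J] by (simp add: pre_def)
    qed
    have "\<exists>F. finite F \<and> F \<subseteq> pre I \<and> submodule_over ?S hull F = pre I"
    proof (rule finitely_generated_by_leading_coeffs[OF insert.IH])
      show "0 \<in> ?A" "-1 \<in> ?A"
        using cA[of 0] cA[of "-1"] \<iota> by simp_all
    qed (use pre[OF I(2)] in \<open>auto simp: pre_def\<close>)
    then obtain F where F: "finite F" "F \<subseteq> pre I" "submodule_over ?S hull F = pre I"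
      by blast
    let ?F = "(\<lambda>p. poly p g) ` F"
    let ?J = "submodule_over ?B hull ?F"
    have "F \<subseteq> pre ?J"
      using F(2) hull_subset[of ?F "submodule_over ?B"] unfolding pre_def by auto
    then have "pre I \<subseteq> pre ?J"
      using hull_minimal[of F "pre ?J" "submodule_over ?S"] pre[OF submodule_over_hull] F(3) by metis
    then have "I \<subseteq> ?J"
      using I(1) unfolding B pre_def by force
    moreover have "?F \<subseteq> I"
      using F(2) unfolding pre_def by auto
    moreover from this have "?J \<subseteq> I"
      using I(2) by (rule hull_minimal)
    ultimately show "\<exists>F. finite F \<and> F \<subseteq> I \<and> submodule_over ?B hull F = I"
      using F(1) by blast
  qed
qed

section \<open>Invariants of an extension by a translated variable\<close>

lemma algebra_hom_simps:
  assumes "algebra_hom \<iota> \<kappa> h"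
  shows "h (\<iota> c) = \<kappa> c" "h (a + b) = h a + h b" "h (a * b) = h a * h b" "h 1 = 1" "h 0 = 0"
    "h (a ^ n) = h a ^ n" "h (- a) = - h a" "h (a - b) = h a - h b" "h (numeral w) = numeral w"
proof -
  show "h (\<iota> c) = \<kappa> c" and add: "h (a + b) = h a + h b" and mult: "h (a * b) = h a * h b" and one: "h 1 = 1" for a b
    using assms by (auto simp: algebra_hom_def)
  show zero: "h 0 = 0"
    using add[of 0 0] by simp
  show "h (a ^ n) = h a ^ n"
    by (induction n) (simp_all add: mult one)
  show minus: "h (- a) = - h a" for a
    using add[of a "- a"] zero by (simp add: add_eq_0_iff)
  show "h (a - b) = h a - h b"
    using add[of a "- b"] by (simp add: minus)
  show "h (numeral w) = numeral w"
    by (induction w) (simp_all only: numeral.simps add one)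
qed

lemma algebra_hom_sum:
  assumes "algebra_hom \<iota> \<kappa> h"
  shows "h (sum g I) = (\<Sum>i\<in>I. h (g i))"
  by (induction I rule: infinite_finite_induct) (simp_all add: algebra_hom_simps[OF assms])

lemma hom_by_values_Const: "hom_by_values f (Const c) = [:Const c:]"
  using algebra_hom_hom_by_values[of f] by (simp add: algebra_hom_def)

lemmas hom_by_values_sum = algebra_hom_sum[OF algebra_hom_hom_by_values]

lemma Const_minus_one: "Const (-1) = -1"
  by (metis Const_hom(1-3) add.right_inverse add_eq_0_iff)

abbreviation subalgebra_hull :: "('v, 'k::comm_ring_1) mpoly set \<Rightarrow> ('v, 'k) mpoly set"
  where "subalgebra_hull G \<equiv> is_subalgebra Const hull G"

lemma subalgebra_hull_closed:
  "Const c \<in> subalgebra_hull G"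
  "a \<in> subalgebra_hull G \<Longrightarrow> b \<in> subalgebra_hull G \<Longrightarrow> a + b \<in> subalgebra_hull G"
  "a \<in> subalgebra_hull G \<Longrightarrow> b \<in> subalgebra_hull G \<Longrightarrow> a * b \<in> subalgebra_hull G"
  "0 \<in> subalgebra_hull G" "1 \<in> subalgebra_hull G"
  "a \<in> subalgebra_hull G \<Longrightarrow> a ^ n \<in> subalgebra_hull G"
  "numeral w \<in> subalgebra_hull G"
  "a \<in> subalgebra_hull G \<Longrightarrow> - a \<in> subalgebra_hull G"
  "a \<in> subalgebra_hull G \<Longrightarrow> b \<in> subalgebra_hull G \<Longrightarrow> a - b \<in> subalgebra_hull G"
proof -
  note sub = is_subalgebra_hull[of Const G]
  show c: "Const c \<in> subalgebra_hull G" for c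
    using is_subalgebra_const[OF sub] .
  show add: "a + b \<in> subalgebra_hull G" if "a \<in> subalgebra_hull G" "b \<in> subalgebra_hull G" for a b
    using is_subalgebra_add[OF sub that] .
  show mult: "a * b \<in> subalgebra_hull G" if "a \<in> subalgebra_hull G" "b \<in> subalgebra_hull G" for a b
    using is_subalgebra_mult[OF sub that] .
  show "0 \<in> subalgebra_hull G" and one: "1 \<in> subalgebra_hull G"
    using c[of 0] c[of 1] by (simp_all add: Const_hom)
  show "a ^ n \<in> subalgebra_hull G" if "a \<in> subalgebra_hull G"
    using is_subalgebra_power[OF sub _ that] by (simp add: Const_hom)
  show "numeral w \<in> subalgebra_hull G"
    by (induction w) (simp_all only: numeral.simps add one)
  show minus: "- a \<in> subalgebra_hull G" if "a \<in> subalgebra_hull G" for a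
    using mult[OF c[of "-1"] that] by (simp add: Const_minus_one)
  show "a - b \<in> subalgebra_hull G" if "a \<in> subalgebra_hull G" "b \<in> subalgebra_hull G"
    using add[OF that(1) minus[OF that(2)]] by simp
qed

lemma subalgebra_hull_sum: "(\<And>i. i \<in> I \<Longrightarrow> g i \<in> subalgebra_hull G) \<Longrightarrow> sum g I \<in> subalgebra_hull G"
  by (rule is_subalgebra_sum[OF is_subalgebra_hull]) (simp_all add: Const_hom)

lemma coeff_mult_in_subalgebra_hull:
  assumes "\<And>i. coeff p i \<in> subalgebra_hull G" "\<And>i. coeff q i \<in> subalgebra_hull G"
  shows "coeff (p * q) i \<in> subalgebra_hull G"
  unfolding coeff_mult by (intro subalgebra_hull_sum subalgebra_hull_closed assms)

section \<open>The polynomial ring as polynomials in one chosen variable\<close>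

definition free_of :: "'v \<Rightarrow> ('v, 'k::comm_ring_1) mpoly set"
  where "free_of v = subalgebra_hull (Var ` (- {v}))"

text \<open>The identification of \<open>B\<close> with \<open>R[v]\<close> for
  \<open>R = free_of v\<close>. The indeterminate here stands for \<open>v\<close>, not for the
  parameter \<open>U\<close> of the action; evaluation at \<open>Var v\<close> is a left
  inverse.\<close>

definition poly_in :: "'v \<Rightarrow> ('v, 'k::comm_ring_1) mpoly \<Rightarrow> ('v, 'k) mpoly poly"
  where "poly_in v = hom_by_values (\<lambda>i. if i = v then [:0, 1:] else [:Var i:])"

lemma Var_free_of: "i \<noteq> v \<Longrightarrow> Var i \<in> free_of v"
  unfolding free_of_def by (rule hull_inc) simp

lemmas free_of_closed = subalgebra_hull_closed[where G = "Var ` (- {v})" for v, folded free_of_def]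

lemma is_subalgebra_free_of: "is_subalgebra Const (free_of v)"
  unfolding free_of_def by (rule is_subalgebra_hull)

lemma free_of_induct [consumes 1, case_names Const Var add mult]:
  assumes "r \<in> free_of v" "\<And>c. Q (Const c)" "\<And>i. i \<noteq> v \<Longrightarrow> Q (Var i)"
    "\<And>a b. Q a \<Longrightarrow> Q b \<Longrightarrow> Q (a + b)" "\<And>a b. Q a \<Longrightarrow> Q b \<Longrightarrow> Q (a * b)"
  shows "Q r"
  by (rule hull_induct[OF assms(1)[unfolded free_of_def]])
     (use assms in \<open>auto simp: is_subalgebra_def\<close>)

lemma poly_in_simps:
  "poly_in v (a + b) = poly_in v a + poly_in v b"
  "poly_in v (a * b) = poly_in v a * poly_in v b"
  "poly_in v 0 = 0" "poly_in v (a ^ n) = poly_in v a ^ n"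
  "poly_in v (Const c) = [:Const c:]"
  "poly_in v (Var i) = (if i = v then [:0, 1:] else [:Var i:])"
  "poly_in v (sum g I) = (\<Sum>i\<in>I. poly_in v (g i))"
  by (simp_all add: poly_in_def hom_by_values_simps hom_by_values_Const hom_by_values_Var hom_by_values_sum)

lemma poly_poly_in: "poly (poly_in v b) (Var v) = b"
  by (induction b rule: mpoly_induct) (simp_all add: poly_in_simps)

lemma poly_in_free_of: "r \<in> free_of v \<Longrightarrow> poly_in v r = [:r:]"
  by (induction rule: free_of_induct) (simp_all add: poly_in_simps mult.commute)

lemma coeff_poly_in_free_of: "coeff (poly_in v b) i \<in> free_of v"
proof (induction b arbitrary: i rule: mpoly_induct)
  case (mult p q)
  then show ?case
    unfolding poly_in_simps free_of_def by (rule coeff_mult_in_subalgebra_hull)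
qed (auto simp: poly_in_simps free_of_closed Var_free_of coeff_pCons split: nat.splits)

locale translated_variable =
  fixes f :: "'v \<Rightarrow> ('v, 'k::field) mpoly poly" and v :: 'v and c :: "('v, 'k) mpoly"
  assumes lfihd: "lfihd Const (hom_by_values f)"
    and f_v: "f v = [:Var v, c:]" and c: "c \<in> free_of v"
    and f_other: "\<And>i j. i \<noteq> v \<Longrightarrow> coeff (f i) j \<in> free_of v"
begin

abbreviation \<theta> where "\<theta> \<equiv> hom_by_values f"

lemma coeff_in_free_of: "r \<in> free_of v \<Longrightarrow> coeff (\<theta> r) j \<in> free_of v"
proof (induction arbitrary: j rule: free_of_induct)
  case (mult p q)
  then show ?case
    unfolding hom_by_values_simps free_of_def by (rule coeff_mult_in_subalgebra_hull)
qed (auto simp: hom_by_values_simps hom_by_values_Const hom_by_values_Var f_other free_of_closed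
    coeff_pCons split: nat.splits)

text \<open>Expresses that \<open>\<theta>\<close> commutes with taking the top coefficient in
  \<open>v\<close>, as it should when \<open>v\<close> goes to \<open>v + cU\<close> with
  \<open>c\<close> in \<open>R\<close>. A bound \<open>n\<close> in place of the degree makes the
  property stable under sums and products.\<close>

definition leading_compatible :: "nat \<Rightarrow> ('v, 'k) mpoly \<Rightarrow> bool"
  where "leading_compatible n b \<longleftrightarrow> degree (poly_in v b) \<le> n \<and>
    (\<forall>j. degree (poly_in v (coeff (\<theta> b) j)) \<le> n \<and>
         coeff (poly_in v (coeff (\<theta> b) j)) n = coeff (\<theta> (coeff (poly_in v b) n)) j)"

lemma leading_compatible_add:
  "leading_compatible n a \<Longrightarrow> leading_compatible n b \<Longrightarrow> leading_compatible n (a + b)"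
  by (simp add: leading_compatible_def poly_in_simps hom_by_values_simps degree_add_le)

lemma leading_compatible_mult:
  assumes a: "leading_compatible n a" and b: "leading_compatible k b"
  shows "leading_compatible (n + k) (a * b)"
  unfolding leading_compatible_def
proof (intro conjI allI)
  have da: "degree (poly_in v a) \<le> n" "degree (poly_in v (coeff (\<theta> a) j)) \<le> n"
    and db: "degree (poly_in v b) \<le> k" "degree (poly_in v (coeff (\<theta> b) j)) \<le> k" for j
    using a b by (auto simp: leading_compatible_def)
  have le: "degree (p * q) \<le> n + k" if "degree p \<le> n" "degree q \<le> k" for p q :: "('v, 'k) mpoly poly"
    using degree_mult_le[of p q] that by linarith
  show "degree (poly_in v (a * b)) \<le> n + k"
    using le da db by (simp add: poly_in_simps)
  fix j
  have eq: "poly_in v (coeff (\<theta> (a * b)) j) =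
      (\<Sum>l\<le>j. poly_in v (coeff (\<theta> a) l) * poly_in v (coeff (\<theta> b) (j - l)))"
    by (simp add: hom_by_values_simps coeff_mult poly_in_simps)
  show "degree (poly_in v (coeff (\<theta> (a * b)) j)) \<le> n + k"
    unfolding eq by (intro degree_sum_le le da db) simp
  have "coeff (poly_in v (coeff (\<theta> (a * b)) j)) (n + k) =
      (\<Sum>l\<le>j. coeff (\<theta> (coeff (poly_in v a) n)) l * coeff (\<theta> (coeff (poly_in v b) k)) (j - l))"
    unfolding eq coeff_sum using a b da db
    by (intro sum.cong refl) (simp add: coeff_mult_degree_le leading_compatible_def)
  then show "coeff (poly_in v (coeff (\<theta> (a * b)) j)) (n + k) = coeff (\<theta> (coeff (poly_in v (a * b)) (n + k))) j"
    by (simp only: poly_in_simps coeff_mult_degree_le[OF da(1) db(1)] hom_by_values_simps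
        coeff_mult[of "\<theta> _"])
qed

lemma leading_compatible_mono:
  assumes "leading_compatible n b" "n \<le> k"
  shows "leading_compatible k b"
proof (cases "n = k")
  case False
  then have z: "coeff p k = 0" if "degree p \<le> n" for p :: "('v, 'k) mpoly poly"
    using that assms(2) by (intro coeff_eq_0) linarith
  show ?thesis
    using assms z unfolding leading_compatible_def by (auto simp: hom_by_values_simps intro: order_trans)
qed (use assms in simp)

text \<open>Elements of \<open>R\<close> have the property with bound 0 and \<open>v\<close> has it
  with bound 1; every \<open>b\<close> is a sum of products of these.\<close>

lemma leading_compatible_degree: "leading_compatible (degree (poly_in v b)) b"
proof -
  let ?n = "degree (poly_in v b)"
  have R: "leading_compatible 0 r" if "r \<in> free_of v" for r
    using that coeff_in_free_of[OF that] by (simp add: leading_compatible_def poly_in_free_of)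
  have V: "leading_compatible 1 (Var v)"
    using poly_in_free_of[OF c] by (auto simp: leading_compatible_def hom_by_values_Var f_v poly_in_simps
        hom_by_values_simps coeff_pCons split: nat.splits)
  have pow: "leading_compatible i (Var v ^ i)" for i
  proof (induction i)
    case 0
    then show ?case using R[of 1] by (simp add: free_of_closed)
  next
    case (Suc i)
    then show ?case using leading_compatible_mult[OF V Suc] by simp
  qed
  have "leading_compatible ?n (\<Sum>i\<in>I. coeff (poly_in v b) i * Var v ^ i)" if "finite I" "I \<subseteq> {..?n}" for I
    using that
  proof induction
    case empty
    then show ?case using leading_compatible_mono[OF R[of 0]] by (simp add: free_of_closed)
  next
    case (insert i I)
    have "leading_compatible i (coeff (poly_in v b) i * Var v ^ i)"
      using leading_compatible_mult[OF R[OF coeff_poly_in_free_of] pow] by simp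
    then show ?case
      using insert leading_compatible_mono by (auto intro!: leading_compatible_add)
  qed
  from this[of "{..?n}"] show ?thesis
    by (simp add: poly_poly_in flip: poly_altdef)
qed

text \<open>The components of \<open>\<theta> b\<close> of positive index vanish, and with them
  their coefficients at the top power of \<open>v\<close>.\<close>

lemma lead_coeff_invariant:
  assumes b: "b \<in> invariants \<theta>"
  shows "lead_coeff (poly_in v b) \<in> invariants \<theta>"
proof -
  let ?n = "degree (poly_in v b)"
  have "coeff (\<theta> (lead_coeff (poly_in v b))) j = 0" if "j \<ge> 1" for j
  proof -
    have "coeff (\<theta> (lead_coeff (poly_in v b))) j = coeff (poly_in v (coeff (\<theta> b) j)) ?n"
      using leading_compatible_degree[of b] unfolding leading_compatible_def by metis
    also have "coeff (\<theta> b) j = 0"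
      using b that unfolding invariants_def by blast
    finally show ?thesis
      by (simp only: poly_in_simps coeff_0)
  qed
  then show ?thesis
    unfolding invariants_def by blast
qed

text \<open>Written as polynomials in \<open>v\<close>, the invariants form a module over
  \<open>A[w]\<close> with leading coefficients in \<open>A\<close>. Its finitely many module
  generators together with \<open>w\<close> and \<open>G\<close> generate the algebra.\<close>

theorem finitely_generated_invariants:
  assumes G: "finite G" "free_of v \<inter> invariants \<theta> = subalgebra_hull G"
    and w: "w \<in> invariants \<theta>" "lead_coeff (poly_in v w) = 1" "degree (poly_in v w) > 0"
  shows "finitely_generated_algebra Const (invariants \<theta>)"
proof -
  let ?A = "subalgebra_hull G"
  let ?I = "invariants \<theta>"
  note I = is_subalgebra_invariants[OF lfihd]
  define S where "S = insert (poly_in v w) ((\<lambda>a. [:a:]) ` ?A)"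
  have A: "?A \<subseteq> free_of v" "?A \<subseteq> ?I"
    by (simp_all flip: G(2))
  have const: "poly_in v a = [:a:]" if "a \<in> ?A" for a
    using that A(1) by (intro poly_in_free_of) (rule subsetD)
  \<comment> \<open>Applied twice below: to all invariants, and to the algebra of the candidate
    generators, which must then exhaust the invariants.\<close>
  have sub: "submodule_over S (poly_in v ` B)" if B: "is_subalgebra Const B" "?A \<subseteq> B" "w \<in> B" for B
    unfolding submodule_over_def
  proof (intro conjI ballI)
    show "0 \<in> poly_in v ` B"
      using is_subalgebra_const[OF B(1), of 0] by (metis Const_hom(1) imageI poly_in_simps(3))
    fix p q assume q: "q \<in> poly_in v ` B"
    {
      assume "p \<in> poly_in v ` B"
      then show "p + q \<in> poly_in v ` B"
        using q is_subalgebra_add[OF B(1)] by (auto simp flip: poly_in_simps)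
    next
      assume "p \<in> S"
      then obtain a where "a \<in> B" "p = poly_in v a"
        unfolding S_def using const B by auto
      then show "p * q \<in> poly_in v ` B"
        using q is_subalgebra_mult[OF B(1)] by (auto simp flip: poly_in_simps)
    }
  qed
  have "\<exists>F. finite F \<and> F \<subseteq> poly_in v ` ?I \<and> submodule_over S hull F = poly_in v ` ?I"
    unfolding S_def
  proof (rule finitely_generated_by_leading_coeffs)
    show "noetherian_on ?A"
      by (rule noetherian_on_hull) (simp_all add: Const_hom Const_minus_one G(1))
    show "submodule_over (insert (poly_in v w) ((\<lambda>a. [:a:]) ` ?A)) (poly_in v ` ?I)"
      using sub[OF I A(2) w(1)] unfolding S_def .
    show "lead_coeff p \<in> ?A" if p: "p \<in> poly_in v ` ?I" for p
    proof -
      obtain b where "p = poly_in v b" "b \<in> ?I"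
        using p by (rule imageE)
      then show ?thesis
        unfolding G(2)[symmetric] by (simp only: Int_iff lead_coeff_invariant coeff_poly_in_free_of simp_thms)
    qed
  qed (use w in \<open>simp_all add: subalgebra_hull_closed\<close>)
  then obtain F where F: "finite F" "F \<subseteq> poly_in v ` ?I" "submodule_over S hull F = poly_in v ` ?I"
    by blast
  obtain F0 where F0: "finite F0" "F0 \<subseteq> ?I" "F = poly_in v ` F0"
    using finite_subset_image[OF F(1,2)] by blast
  let ?H = "G \<union> insert w F0"
  let ?B = "subalgebra_hull ?H"
  have "F0 \<subseteq> ?B"
    using hull_subset[of ?H "is_subalgebra Const"] by simp
  then have "F \<subseteq> poly_in v ` ?B"
    unfolding F0(3) by (rule image_mono)
  moreover have "submodule_over S (poly_in v ` ?B)"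
    by (intro sub is_subalgebra_hull hull_mono hull_inc) auto
  ultimately have "poly_in v ` ?I \<subseteq> poly_in v ` ?B"
    unfolding F(3)[symmetric] by (rule hull_minimal)
  moreover have "inj (poly_in v)"
    by (rule inj_on_inverseI[of _ "\<lambda>p. poly p (Var v)"]) (rule poly_poly_in)
  ultimately have "?I \<subseteq> ?B"
    by (rule inj_image_subset_iff[THEN iffD1, rotated])
  moreover have "?B \<subseteq> ?I"
    using w(1) F0(2) A(2) hull_subset[of G "is_subalgebra Const"] by (intro hull_minimal I) auto
  ultimately show ?thesis
    unfolding finitely_generated_algebra_def using G(1) F0(1) by (intro exI[of _ ?H]) auto
qed

end

section \<open>Fixed rings of actions with a slice\<close>

lemma in_invariants_iff: "lfihd \<iota> \<theta> \<Longrightarrow> b \<in> invariants \<theta> \<longleftrightarrow> \<theta> b = [:b:]"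
  by (simp add: invariants_eq_fixed)

text \<open>Allows invariance to be checked after clearing an invariant denominator, since
  \<open>[:d:]\<close> can be cancelled in the domain \<open>B[U]\<close>.\<close>

lemma invariants_cancel:
  fixes \<theta> :: "'b::idom \<Rightarrow> 'b poly"
  assumes \<theta>: "lfihd \<iota> \<theta>" and d: "d \<in> invariants \<theta>" "d \<noteq> 0" and dz: "d * z \<in> invariants \<theta>"
  shows "z \<in> invariants \<theta>"
proof -
  have "[:d:] * \<theta> z = \<theta> (d * z)"
    using \<theta> d(1) by (simp add: in_invariants_iff[OF \<theta>] lfihd_def algebra_hom_def)
  also have "\<dots> = [:d:] * [:z:]"
    using dz by (simp add: in_invariants_iff[OF \<theta>] mult.commute)
  finally have "\<theta> z = [:z:]"
    using d(2) by (metis mult_left_cancel pCons_eq_0_iff)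
  then show ?thesis
    by (simp add: in_invariants_iff[OF \<theta>])
qed

text \<open>As the coefficients of \<open>p\<close> are invariant, \<open>\<theta>\<close> sends
  \<open>p(s)\<close> to \<open>p(s + dU)\<close>, which has degree \<open>degree p\<close> in
  \<open>U\<close> because \<open>d\<close> is nonzero.\<close>

lemma degree_of_invariant_in_slice:
  fixes f :: "'v::linorder \<Rightarrow> ('v, 'k::field) mpoly poly"
  assumes \<theta>: "lfihd Const (hom_by_values f)"
    and p: "\<And>i. coeff p i \<in> invariants (hom_by_values f)"
    and s: "hom_by_values f s = [:s, d:]" "d \<noteq> 0"
    and inv: "poly p s \<in> invariants (hom_by_values f)"
  shows "degree p = 0"
proof -
  have "hom_by_values f (poly p s) = pcompose p [:s, d:]"
    using p
  proof (induction p)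
    case 0
    then show ?case by (simp add: hom_by_values_simps)
  next
    case (pCons a p)
    have "coeff p i \<in> invariants (hom_by_values f)" for i
      using pCons.prems[of "Suc i"] by simp
    moreover have "a \<in> invariants (hom_by_values f)"
      using pCons.prems[of 0] by simp
    ultimately show ?case
      using pCons.IH s(1) by (simp add: hom_by_values_simps pcompose_pCons in_invariants_iff[OF \<theta>])
  qed
  then have "pcompose p [:s, d:] = [:poly p s:]"
    using inv by (simp add: in_invariants_iff[OF \<theta>])
  then have "degree p * degree [:s, d:] = 0"
    by (metis degree_pCons_0 degree_pcompose)
  then show ?thesis using s(2) by simp
qed

text \<open>Here \<open>s\<close> is a local slice. By \<open>loc\<close>, each element of
  \<open>R\<close> times some power of \<open>x\<close> is a polynomial in \<open>s\<close> over the
  generated algebra \<open>C\<close>; for an invariant this polynomial is constant. Hence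
  \<open>x ^ N * r\<close> lies in \<open>C\<close>, and \<open>div\<close> removes the
  power.\<close>

lemma invariants_eq_hull:
  fixes f :: "'v::linorder \<Rightarrow> ('v, 'k::field) mpoly poly"
  assumes \<theta>: "lfihd Const (hom_by_values f)"
    and G: "G \<subseteq> free_of v" "G \<subseteq> invariants (hom_by_values f)"
    and x: "x \<in> subalgebra_hull G" "x \<noteq> 0"
    and s: "hom_by_values f s = [:s, d:]" "d \<noteq> 0"
    and loc: "\<And>i. i \<noteq> v \<Longrightarrow> \<exists>N. x ^ N * Var i \<in> subalgebra_hull (insert s G)"
    and div: "\<And>b. x * b \<in> subalgebra_hull G \<Longrightarrow> b \<in> subalgebra_hull G"
  shows "free_of v \<inter> invariants (hom_by_values f) = subalgebra_hull G"
proof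
  let ?\<theta> = "hom_by_values f" and ?C = "subalgebra_hull G"
  have C: "?C \<subseteq> free_of v" "?C \<subseteq> invariants ?\<theta>"
    by (intro hull_minimal G is_subalgebra_free_of is_subalgebra_invariants[OF \<theta>])+
  then show "?C \<subseteq> free_of v \<inter> invariants ?\<theta>" by (rule Int_greatest)
  have xs: "x ^ n \<in> subalgebra_hull (insert s G)" for n
    using hull_mono[of G "insert s G" "is_subalgebra Const"] x(1)
    by (intro subalgebra_hull_closed) blast
  have "\<exists>N. x ^ N * r \<in> subalgebra_hull (insert s G)" if "r \<in> free_of v" for r
    using that
  proof (induction rule: free_of_induct)
    case (Const c)
    then show ?case by (intro exI[of _ 0]) (simp add: subalgebra_hull_closed)
  next
    case (add a b)
    then obtain N M where "x ^ N * a \<in> subalgebra_hull (insert s G)" "x ^ M * b \<in> subalgebra_hull (insert s G)"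
      by blast
    then have "x ^ M * (x ^ N * a) + x ^ N * (x ^ M * b) \<in> subalgebra_hull (insert s G)"
      by (rule subalgebra_hull_closed(2)[OF subalgebra_hull_closed(3)[OF xs] subalgebra_hull_closed(3)[OF xs]])
    then show ?case by (intro exI[of _ "N + M"]) (simp add: algebra_simps power_add)
  next
    case (mult a b)
    then obtain N M where "x ^ N * a \<in> subalgebra_hull (insert s G)" "x ^ M * b \<in> subalgebra_hull (insert s G)"
      by blast
    then have "(x ^ N * a) * (x ^ M * b) \<in> subalgebra_hull (insert s G)"
      by (rule subalgebra_hull_closed)
    then show ?case by (intro exI[of _ "N + M"]) (simp add: algebra_simps power_add)
  qed (rule loc)
  moreover have "x ^ N * r \<in> ?C" if r: "r \<in> invariants ?\<theta>" "x ^ N * r \<in> subalgebra_hull (insert s G)" for r N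
  proof -
    obtain p where p: "x ^ N * r = poly p s" "\<And>i. coeff p i \<in> ?C"
      using r(2) by (subst (asm) is_subalgebra_hull_insert) (auto simp: Const_hom)
    have "x ^ N \<in> invariants ?\<theta>"
      using x(1) C(2) subalgebra_hull_closed(6) by blast
    then have "poly p s \<in> invariants ?\<theta>"
      using r(1) is_subalgebra_mult[OF is_subalgebra_invariants[OF \<theta>]] unfolding p(1)[symmetric] by blast
    moreover have "coeff p i \<in> invariants ?\<theta>" for i
      using p(2) C(2) by blast
    ultimately have "degree p = 0"
      using degree_of_invariant_in_slice[OF \<theta> _ s] by blast
    then obtain a where "p = [:a:]"
      by (rule degree_eq_zeroE)
    then show ?thesis
      using p(1) p(2)[of 0] by simp
  qed
  moreover have "r \<in> ?C" if "x ^ N * r \<in> ?C" for r N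
    using that by (induction N) (auto simp: mult.assoc intro: div)
  ultimately show "free_of v \<inter> invariants ?\<theta> \<subseteq> ?C" by blast
qed

text \<open>By \<open>step\<close>, the \<open>\<mu> i\<close> span the generated algebra
  \<open>C\<close> linearly modulo \<open>x C\<close>. As \<open>\<sigma>\<close> kills
  \<open>x\<close> and sends the \<open>\<mu> i\<close> to nonzero multiples of distinct monomials,
  an element \<open>x * b\<close> of \<open>C\<close> has only zero coefficients at the
  \<open>\<mu> i\<close>. So it lies in \<open>x C\<close>, and \<open>x\<close> is
  cancelled.\<close>

lemma hull_saturated_by_monomials:
  fixes \<mu> :: "'i \<Rightarrow> ('v::linorder, 'k::field) mpoly" and \<sigma> :: "('v, 'k) mpoly \<Rightarrow> ('w, 'k) mpoly"
  assumes \<sigma>: "algebra_hom Const Const \<sigma>"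
    and x: "x \<in> subalgebra_hull G" "x \<noteq> 0" "\<sigma> x = 0"
    and \<mu>: "\<And>i. i \<in> I \<Longrightarrow> \<sigma> (\<mu> i) = Poly_Mapping.single (\<nu> i) (\<kappa> i)" "\<And>i. i \<in> I \<Longrightarrow> \<kappa> i \<noteq> 0"
    and inj: "inj_on \<nu> I"
    and one: "start \<in> I" "\<mu> start = 1"
    and step: "\<And>g i. g \<in> G \<Longrightarrow> i \<in> I \<Longrightarrow>
      \<exists>a c j. j \<in> I \<and> c \<in> subalgebra_hull G \<and> g * \<mu> i = Const a * \<mu> j + x * c"
    and b: "x * b \<in> subalgebra_hull G"
  shows "b \<in> subalgebra_hull G"
proof -
  let ?C = "subalgebra_hull G"
  note C = subalgebra_hull_closed[where G = G]
  define S where "S = {p. \<exists>F a c. finite F \<and> F \<subseteq> I \<and> c \<in> ?C \<and> p = (\<Sum>i\<in>F. Const (a i) * \<mu> i) + x * c}"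
  have S_add: "p + q \<in> S" if pq: "p \<in> S" "q \<in> S" for p q
  proof -
    obtain F a c where p: "finite F" "F \<subseteq> I" "c \<in> ?C" "p = (\<Sum>i\<in>F. Const (a i) * \<mu> i) + x * c"
      using pq(1) unfolding S_def by blast
    obtain F' a' c' where q: "finite F'" "F' \<subseteq> I" "c' \<in> ?C" "q = (\<Sum>i\<in>F'. Const (a' i) * \<mu> i) + x * c'"
      using pq(2) unfolding S_def by blast
    define e where "e i = (if i \<in> F then a i else 0) + (if i \<in> F' then a' i else 0)" for i
    have "(\<Sum>i\<in>F. Const (a i) * \<mu> i) = (\<Sum>i\<in>F \<union> F'. Const (if i \<in> F then a i else 0) * \<mu> i)"
      using p q by (intro sum.mono_neutral_cong_left) (auto simp: Const_hom)
    moreover have "(\<Sum>i\<in>F'. Const (a' i) * \<mu> i) = (\<Sum>i\<in>F \<union> F'. Const (if i \<in> F' then a' i else 0) * \<mu> i)"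
      using p q by (intro sum.mono_neutral_cong_left) (auto simp: Const_hom)
    ultimately have "p + q = (\<Sum>i\<in>F \<union> F'. Const (e i) * \<mu> i) + x * (c + c')"
      by (simp add: p q e_def Const_hom algebra_simps sum.distrib)
    then show ?thesis
      unfolding S_def using p(1-3) q(1-3) C(2)
      by (intro CollectI exI[of _ "F \<union> F'"] exI[of _ e] exI[of _ "c + c'"]) simp
  qed
  have S_term: "Const a * \<mu> i + x * c \<in> S" if "i \<in> I" "c \<in> ?C" for a i c
    unfolding S_def using that by (intro CollectI exI[of _ "{i}"] exI[of _ "\<lambda>_. a"] exI[of _ c]) simp
  have S_x: "x * c \<in> S" if "c \<in> ?C" for c
    using S_term[OF one(1) that, of 0] by (simp add: Const_hom)
  have S_mult: "t * p \<in> S"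
    if t: "t \<in> ?C" "\<And>i a. i \<in> I \<Longrightarrow> t * (Const a * \<mu> i) \<in> S" and p: "p \<in> S" for t p
  proof -
    obtain F a c where F: "finite F" "F \<subseteq> I" "c \<in> ?C" "p = (\<Sum>i\<in>F. Const (a i) * \<mu> i) + x * c"
      using p unfolding S_def by blast
    have "(\<Sum>i\<in>F. t * (Const (a i) * \<mu> i)) \<in> S"
      using F(1,2)
    proof induction
      case empty
      then show ?case using S_x[OF C(4)] by simp
    next
      case (insert i F)
      then show ?case using t(2) S_add by simp
    qed
    moreover have "x * (t * c) \<in> S"
      using S_x C(3) t(1) F(3) by blast
    ultimately show ?thesis
      unfolding F(4) using S_add by (simp add: distrib_left sum_distrib_left mult.left_commute)
  qed
  \<comment> \<open>The multipliers preserving \<open>S\<close> form a subalgebra containing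
    \<open>G\<close>, hence all of \<open>?C\<close>; applied to \<open>1 \<in> S\<close> this gives
    \<open>?C \<subseteq> S\<close>.\<close>
  define T where "T = {t \<in> ?C. \<forall>p\<in>S. t * p \<in> S}"
  have "?C \<subseteq> T"
  proof (rule hull_minimal)
    show "is_subalgebra Const T"
    proof (rule is_subalgebraI)
      show "Const c \<in> T" for c
      proof -
        have "Const c * (Const a * \<mu> i) \<in> S" if "i \<in> I" for a i
          using S_term[OF that C(4), of "c * a"] by (simp add: Const_hom mult.assoc)
        then show ?thesis
          unfolding T_def using S_mult[OF C(1)] C(1) by simp
      qed
    qed (auto simp: T_def C S_add distrib_right mult.assoc)
    show "G \<subseteq> T"
    proof
      fix g assume g: "g \<in> G"
      then have gC: "g \<in> ?C" by (rule hull_inc)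
      have "g * (Const a * \<mu> i) \<in> S" if i: "i \<in> I" for a i
      proof -
        obtain e c j where j: "j \<in> I" "c \<in> ?C" and eq: "g * \<mu> i = Const e * \<mu> j + x * c"
          using step[OF g i] by blast
        have "g * (Const a * \<mu> i) = Const a * (g * \<mu> i)"
          by (rule mult.left_commute)
        also have "\<dots> = Const (a * e) * \<mu> j + x * (Const a * c)"
          unfolding eq by (simp add: Const_hom algebra_simps)
        finally show ?thesis
          using S_term[OF j(1)] C(1,3) j(2) by simp
      qed
      then show "g \<in> T"
        unfolding T_def using gC S_mult by blast
    qed
  qed
  moreover have "1 \<in> S"
    using S_term[OF one(1) C(4), of 1] one(2) by (simp add: Const_hom)
  ultimately have "x * b \<in> S"
    using b unfolding T_def by force
  then obtain F a c where F: "finite F" "F \<subseteq> I" "c \<in> ?C" "x * b = (\<Sum>i\<in>F. Const (a i) * \<mu> i) + x * c"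
    unfolding S_def by blast
  note h = algebra_hom_simps[OF \<sigma>] algebra_hom_sum[OF \<sigma>]
  have "0 = \<sigma> (x * b)"
    by (simp add: h x(3))
  also have "\<dots> = (\<Sum>i\<in>F. Const (a i) * \<sigma> (\<mu> i))"
    unfolding F(4) by (simp add: h x(3))
  also have "\<dots> = (\<Sum>i\<in>F. Poly_Mapping.single (\<nu> i) (a i * \<kappa> i))"
    using F(2) \<mu>(1) by (intro sum.cong) (auto simp: Const_def mult_single)
  finally have 0: "(\<Sum>i\<in>F. Poly_Mapping.single (\<nu> i) (a i * \<kappa> i)) = 0" ..
  have "a j = 0" if j: "j \<in> F" for j
  proof -
    have "0 = (\<Sum>i\<in>F. if \<nu> i = \<nu> j then a i * \<kappa> i else 0)"
      using arg_cong[OF 0, of "\<lambda>p. Poly_Mapping.lookup p (\<nu> j)"]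
      by (simp add: lookup_sum lookup_single when_def)
    also have "\<dots> = (\<Sum>i\<in>F. if i = j then a i * \<kappa> i else 0)"
      using F(2) j inj by (intro sum.cong refl if_cong) (auto dest: inj_onD)
    finally show ?thesis
      using j F(1,2) \<mu>(2)[of j] by auto
  qed
  then have "x * b = x * c"
    unfolding F(4) by (simp add: Const_hom)
  then show ?thesis
    using x(2) F(3) by simp
qed

section \<open>Monic invariants from powers of a cubic\<close>

lemma of_nat_eq_0_if_dvd: "of_nat p = (0::'a::comm_ring_1) \<Longrightarrow> p dvd n \<Longrightarrow> of_nat n = (0::'a)"
  by (auto elim!: dvdE)

text \<open>The prime divides \<open>fact n\<close> but neither \<open>fact k\<close> nor
  \<open>fact (n - k)\<close>.\<close>

lemma prime_dvd_choose_carry: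
  fixes p :: nat
  assumes "prime p" "k < p" "n - k < p" "p \<le> n"
  shows "p dvd n choose k"
proof -
  have "fact k * fact (n - k) * (n choose k) = fact n"
    using assms by (intro binomial_fact_lemma) linarith
  moreover have "p dvd fact n" "\<not> p dvd fact k" "\<not> p dvd fact (n - k)"
    using assms by (simp_all add: prime_dvd_fact_iff)
  ultimately show ?thesis
    using assms(1) by (metis prime_dvd_mult_iff)
qed

text \<open>A case of Lucas's theorem, by Pascal's rule: the other summand
  \<open>(n + p) choose (p - 1)\<close> vanishes by a carry.\<close>

lemma choose_prime_eq_1:
  assumes p: "prime p" "of_nat p = (0::'a::comm_ring_1)" and "n < p"
  shows "of_nat ((n + p) choose p) = (1::'a)"
  using assms(3)
proof (induction n)
  case (Suc n)
  obtain q where q: "p = Suc q"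
    using prime_gt_0_nat[OF p(1)] gr0_implies_Suc by blast
  have "p dvd (n + p) choose q"
    using Suc.prems q by (intro prime_dvd_choose_carry p) auto
  then have "of_nat ((n + p) choose q) = (0::'a)"
    by (rule of_nat_eq_0_if_dvd[OF p(2)])
  then show ?case
    using Suc q by simp
qed simp

lemma freshmans_dream_of_nat:
  fixes x y :: "'a::comm_ring_1"
  assumes p: "prime p" "of_nat p = (0::'a)"
  shows "(x + y) ^ p = x ^ p + y ^ p"
proof -
  have "CHAR('a) dvd p"
    using p(2) by (simp add: of_nat_eq_0_iff_char_dvd)
  moreover have "CHAR('a) \<noteq> 1"
    using of_nat_CHAR[where 'a = 'a] by force
  ultimately have "CHAR('a) = p"
    using p(1) by (metis prime_nat_iff)
  then show ?thesis
    using freshmans_dream[where 'a = 'a] p(1) by simp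
qed

text \<open>
  The homogenization of \<open>P\<close> to a binary form of degree \<open>n\<close>, evaluated at \<open>(1 + UW, W)\<close>. Translating the
  roots of a cubic by \<open>U\<close> acts in this way on its reciprocal polynomial, whose powers are then
  expanded in \<open>W\<close>.
\<close>

definition translated_form :: "nat \<Rightarrow> 'b::comm_ring_1 poly \<Rightarrow> 'b poly poly"
  where "translated_form n P = (\<Sum>i\<le>n. [:[:coeff P i:]:] * ([:1, [:0, 1:]:] ^ (n - i) * monom 1 i))"

lemma translated_form_sum:
  fixes g :: "'i \<Rightarrow> 'b::comm_ring_1 poly"
  shows "translated_form n (sum g I) = (\<Sum>i\<in>I. translated_form n (g i))"
proof (induction I rule: infinite_finite_induct)
  case (insert i I)
  have "translated_form n (p + q) = translated_form n p + translated_form n q" for p q :: "'b poly"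
  proof -
    have add: "[:[:x + y:]:] = [:[:x:]:] + [:[:y:]:]" for x y :: 'b
      by simp
    show ?thesis
      unfolding translated_form_def coeff_add add distrib_right sum.distrib ..
  qed
  then show ?case using insert by simp
qed (simp_all add: translated_form_def)

lemma translated_form_monom:
  assumes "i \<le> n"
  shows "translated_form n (monom a i) = [:[:a:]:] * ([:1, [:0, 1:]:] ^ (n - i) * monom 1 i)"
proof -
  have "translated_form n (monom a i) = (\<Sum>j\<in>{i}. [:[:coeff (monom a i) j:]:] * ([:1, [:0, 1:]:] ^ (n - j) * monom 1 j))"
    unfolding translated_form_def by (rule sum.mono_neutral_right) (use assms in auto)
  then show ?thesis by simp
qed

text \<open>The homogenization degree is only a bound on the degree, so it adds up under products;
  this leads from a cubic to its powers.\<close>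

lemma translated_form_mult:
  assumes "degree P \<le> n" "degree Q \<le> k"
  shows "translated_form (n + k) (P * Q) = translated_form n P * translated_form k Q"
proof -
  have P: "P = (\<Sum>i\<le>n. monom (coeff P i) i)" and Q: "Q = (\<Sum>i\<le>k. monom (coeff Q i) i)"
    using assms by (simp_all add: poly_as_sum_of_monoms')
  have "translated_form (n + k) (P * Q) =
      (\<Sum>i\<le>n. \<Sum>j\<le>k. translated_form (n + k) (monom (coeff P i * coeff Q j) (i + j)))"
    by (subst P, subst Q) (simp add: sum_product translated_form_sum mult_monom)
  also have "\<dots> = (\<Sum>i\<le>n. \<Sum>j\<le>k. ([:[:coeff P i:]:] * ([:1, [:0, 1:]:] ^ (n - i) * monom 1 i)) *
      ([:[:coeff Q j:]:] * ([:1, [:0, 1:]:] ^ (k - j) * monom 1 j)))"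
  proof (intro sum.cong refl)
    fix i j assume ij: "i \<in> {..n}" "j \<in> {..k}"
    have "[:1, [:0, 1:]:] ^ (n + k - (i + j)) = [:1, [:0, 1::'a:]:] ^ (n - i) * [:1, [:0, 1:]:] ^ (k - j)"
      using ij by (simp flip: power_add)
    moreover have "monom (1::'a poly) (i + j) = monom 1 i * monom 1 j"
      by (simp add: mult_monom)
    ultimately show "translated_form (n + k) (monom (coeff P i * coeff Q j) (i + j)) =
      ([:[:coeff P i:]:] * ([:1, [:0, 1:]:] ^ (n - i) * monom 1 i)) *
      ([:[:coeff Q j:]:] * ([:1, [:0, 1:]:] ^ (k - j) * monom 1 j))"
      using ij by (subst translated_form_monom) (simp_all add: mult_ac)
  qed
  also have "\<dots> = translated_form n P * translated_form k Q"
    by (simp only: translated_form_def sum_product)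
  finally show ?thesis .
qed

text \<open>The outer indeterminate is \<open>W\<close>, the inner one \<open>U\<close>; the formula
  is the binomial expansion of \<open>(1 + UW)^(n - i) W^i\<close>.\<close>

lemma coeff_translated_form:
  "coeff (translated_form n P) j =
    (\<Sum>i\<le>n. if i \<le> j then monom (of_nat ((n - i) choose (j - i)) * coeff P i) (j - i) else 0)"
proof -
  have U: "[:0, 1:] ^ l = monom (1::'a) l" for l
    by (simp add: monom_altdef)
  have pow: "coeff ([:1, [:0, 1:]:] ^ m) l = of_nat (m choose l) * monom (1::'a) l" for m l
  proof (cases "l \<le> m")
    case False
    then have "degree ([:1, [:0, 1::'a:]:] ^ m) < l"
      using degree_power_le[of "[:1, [:0, 1::'a:]:]" m] by simp
    then show ?thesis
      using False by (simp add: coeff_eq_0 binomial_eq_0)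
  qed (simp add: coeff_linear_poly_power U)
  have "coeff ([:[:a:]:] * ([:1, [:0, 1:]:] ^ (n - i) * monom 1 i)) j =
      (if i \<le> j then monom (of_nat ((n - i) choose (j - i)) * a) (j - i) else 0)" for a :: 'a and i
    by (simp add: mult.commute[of _ "monom 1 i"] coeff_monom_mult pow
        of_nat_poly smult_monom mult.commute)
  then show ?thesis
    by (simp add: translated_form_def coeff_sum)
qed

lemma map_poly_hom_power:
  assumes "algebra_hom \<iota> \<kappa> h"
  shows "map_poly h (P ^ n) = map_poly h P ^ n"
proof -
  note h = algebra_hom_simps[OF assms] algebra_hom_sum[OF assms]
  have "map_poly h (p * q) = map_poly h p * map_poly h q" for p q
    by (rule poly_eqI) (simp add: coeff_map_poly coeff_mult h)
  moreover have "map_poly h 1 = 1"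
    by (simp add: one_pCons map_poly_pCons h)
  ultimately show ?thesis
    by (induction n) simp_all
qed

section \<open>Powers of a cubic whose argument is translated\<close>

definition cubic_power_coeff :: "'b::comm_ring_1 \<Rightarrow> 'b \<Rightarrow> 'b \<Rightarrow> 'b \<Rightarrow> nat \<Rightarrow> nat \<Rightarrow> 'b"
  where "cubic_power_coeff a b c d e j = coeff ([:a, b, c, d:] ^ e) j"

text \<open>The hypotheses say that \<open>\<theta>\<close> maps
  \<open>f(z) = a z^3 + b z^2 + c z + d\<close> to \<open>f(z + U)\<close>. The polynomial
  \<open>[:a, b, c, d:]\<close> is the reciprocal \<open>W^3 f(1/W)\<close>, which therefore becomes
  its homogenization at \<open>(1 + UW, W)\<close>.\<close>

locale cubic_orbit =
  fixes \<iota> :: "'k \<Rightarrow> 'b::idom" and \<theta> :: "'b \<Rightarrow> 'b poly" and a b c d :: 'b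
  assumes lfihd: "lfihd \<iota> \<theta>"
    and a: "\<theta> a = [:a:]" "a \<noteq> 0" and b: "\<theta> b = [:b, 3 * a:]"
    and c: "\<theta> c = [:c, 2 * b, 3 * a:]" and d: "\<theta> d = [:d, c, b, a:]"
begin

abbreviation q where "q \<equiv> cubic_power_coeff a b c d"

lemma q_0: "q e 0 = a ^ e"
  by (simp add: cubic_power_coeff_def coeff_0_power)

lemma \<theta>_hom: "algebra_hom \<iota> (\<lambda>c. [:\<iota> c:]) \<theta>"
  using lfihd unfolding lfihd_def by blast

lemmas hom = algebra_hom_simps[OF \<theta>_hom]

lemma map_cubic: "map_poly \<theta> [:a, b, c, d:] = translated_form 3 [:a, b, c, d:]"
  by (simp add: map_poly_pCons hom a b c d translated_form_def numeral_3_eq_3 monom_altdef algebra_simps)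

lemma map_cubic_power: "map_poly \<theta> ([:a, b, c, d:] ^ e) = translated_form (3 * e) ([:a, b, c, d:] ^ e)"
proof -
  let ?Q = "[:a, b, c, d:]"
  have deg: "degree ?Q \<le> 3"
    by (simp add: degree_pCons_le)
  have "translated_form (3 * e) (?Q ^ e) = translated_form 3 ?Q ^ e"
  proof (induction e)
    case 0
    then show ?case by (simp add: translated_form_def one_pCons monom_0)
  next
    case (Suc e)
    have "degree (?Q ^ e) \<le> 3 * e"
      using degree_power_le[of ?Q e] deg by (meson mult_le_mono1 order_trans)
    then show ?case
      using translated_form_mult[OF deg, of "?Q ^ e" "3 * e"] Suc by simp
  qed
  moreover have "map_poly \<theta> (?Q ^ e) = map_poly \<theta> ?Q ^ e"
    by (rule map_poly_hom_power[OF \<theta>_hom])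
  ultimately show ?thesis
    by (simp only: map_cubic)
qed

lemma \<theta>_q:
  "\<theta> (q e j) = (\<Sum>i\<le>3 * e. if i \<le> j then monom (of_nat ((3 * e - i) choose (j - i)) * q e i) (j - i) else 0)"
  using arg_cong[OF map_cubic_power, of "\<lambda>p. coeff p j" e]
  unfolding cubic_power_coeff_def by (simp add: coeff_map_poly hom(5) coeff_translated_form)

text \<open>
  For \<open>e = \<lfloor>2p/3\<rfloor>\<close> almost all binomial coefficients in \<open>\<theta>_q\<close> vanish modulo \<open>p\<close>, since adding \<open>p - j\<close> to \<open>3e - p\<close>
  in base \<open>p\<close> produces a carry.
\<close>

lemma \<theta>_q_mod3_eq_2:
  assumes p: "prime p" "of_nat p = (0::'b)" and e: "3 * e + 1 = 2 * p"
  shows "\<theta> (q e p) = [:q e p:] + monom (a ^ e) p"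
proof -
  have p0: "p \<ge> 2"
    using p(1) by (rule prime_ge_2_nat)
  have "\<theta> (q e p) = (\<Sum>i\<in>{0, p}. monom (of_nat ((3 * e - i) choose (p - i)) * q e i) (p - i))"
    unfolding \<theta>_q
  proof (rule sum.mono_neutral_cong_right)
    show "\<forall>i\<in>{..3 * e} - {0, p}. (if i \<le> p then monom (of_nat ((3 * e - i) choose (p - i)) * q e i) (p - i) else 0) = 0"
    proof
      fix i assume i: "i \<in> {..3 * e} - {0, p}"
      have "i \<le> p \<Longrightarrow> p dvd (3 * e - i) choose (p - i)"
        using i e p0 by (intro prime_dvd_choose_carry p) auto
      then show "(if i \<le> p then monom (of_nat ((3 * e - i) choose (p - i)) * q e i) (p - i) else 0) = 0"
        using of_nat_eq_0_if_dvd[OF p(2)] by auto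
    qed
  qed (use e p0 in auto)
  also have "\<dots> = [:q e p:] + monom (of_nat ((3 * e) choose p) * a ^ e) p"
    using p0 by (simp add: monom_0 q_0)
  also have "of_nat ((3 * e) choose p) = (1::'b)"
  proof -
    have "3 * e = (p - 1) + p" using e p0 by linarith
    then show ?thesis using choose_prime_eq_1[OF p, of "p - 1"] p0 by simp
  qed
  finally show ?thesis by simp
qed

lemma \<theta>_q_mod3_eq_1:
  assumes p: "prime p" "of_nat p = (0::'b)" and e: "3 * e + 2 = 2 * p"
  shows "\<theta> (q e p) = [:q e p:] - monom (q e (p - 1)) 1 + monom (a ^ e) p"
    and "\<theta> (q e (p - 1)) = [:q e (p - 1):]"
proof -
  have p0: "p \<ge> 2"
    using p(1) by (rule prime_ge_2_nat)
  have "\<theta> (q e p) = (\<Sum>i\<in>{0, p - 1, p}. monom (of_nat ((3 * e - i) choose (p - i)) * q e i) (p - i))"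
    unfolding \<theta>_q
  proof (rule sum.mono_neutral_cong_right)
    show "\<forall>i\<in>{..3 * e} - {0, p - 1, p}. (if i \<le> p then monom (of_nat ((3 * e - i) choose (p - i)) * q e i) (p - i) else 0) = 0"
    proof
      fix i assume i: "i \<in> {..3 * e} - {0, p - 1, p}"
      have "i \<le> p \<Longrightarrow> p dvd (3 * e - i) choose (p - i)"
        using i e p0 by (intro prime_dvd_choose_carry p) auto
      then show "(if i \<le> p then monom (of_nat ((3 * e - i) choose (p - i)) * q e i) (p - i) else 0) = 0"
        using of_nat_eq_0_if_dvd[OF p(2)] by auto
    qed
  qed (use e p0 in auto)
  \<comment> \<open>The index \<open>i = p - 1\<close> survives since
    \<open>3 * e - i = p - 1\<close> stays below \<open>p\<close>; its binomial coefficient is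
    \<open>p - 1\<close>, that is, -1.\<close>
  also have "\<dots> = [:q e p:] + monom (of_nat (p - 1) * q e (p - 1)) 1 + monom (of_nat ((3 * e) choose p) * a ^ e) p"
  proof -
    have "3 * e - (p - 1) = p - 1" "p - (p - 1) = 1"
      using e p0 by simp_all
    then show ?thesis
      using p0 by (simp add: monom_0 q_0)
  qed
  also have "of_nat ((3 * e) choose p) = (1::'b)"
  proof -
    have "3 * e = (p - 2) + p" using e p0 by linarith
    then show ?thesis using choose_prime_eq_1[OF p, of "p - 2"] p0 by simp
  qed
  also have "of_nat (p - 1) = (-1::'b)"
    using p0 p(2) by (simp add: of_nat_diff)
  finally show "\<theta> (q e p) = [:q e p:] - monom (q e (p - 1)) 1 + monom (a ^ e) p"
    by (simp flip: minus_monom)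
  \<comment> \<open>Now the carry kills every term with \<open>i < p - 1\<close>, because
    \<open>3 * e - i - (p - 1 - i) = p - 1\<close>.\<close>
  have "\<theta> (q e (p - 1)) = (\<Sum>i\<in>{p - 1}. monom (of_nat ((3 * e - i) choose (p - 1 - i)) * q e i) (p - 1 - i))"
    unfolding \<theta>_q
  proof (rule sum.mono_neutral_cong_right)
    show "\<forall>i\<in>{..3 * e} - {p - 1}. (if i \<le> p - 1 then monom (of_nat ((3 * e - i) choose (p - 1 - i)) * q e i) (p - 1 - i) else 0) = 0"
    proof
      fix i assume i: "i \<in> {..3 * e} - {p - 1}"
      have "i \<le> p - 1 \<Longrightarrow> p dvd (3 * e - i) choose (p - 1 - i)"
        using i e p0 by (intro prime_dvd_choose_carry p) auto
      then show "(if i \<le> p - 1 then monom (of_nat ((3 * e - i) choose (p - 1 - i)) * q e i) (p - 1 - i) else 0) = 0"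
        using of_nat_eq_0_if_dvd[OF p(2)] by auto
    qed
  qed (use e p0 in auto)
  then show "\<theta> (q e (p - 1)) = [:q e (p - 1):]"
    by (simp add: monom_0)
qed

lemma \<theta>_prime_power:
  assumes p: "prime p" "of_nat p = (0::'b)" and v: "\<theta> v = [:v, t:]"
  shows "\<theta> (v ^ p) = [:v ^ p:] + monom (t ^ p) p"
proof -
  have "[:v, t:] ^ p = ([:v:] + monom t 1) ^ p"
    by (simp add: monom_altdef)
  also have "\<dots> = [:v:] ^ p + monom t 1 ^ p"
    by (rule freshmans_dream_of_nat[OF p(1)]) (simp add: of_nat_poly p(2))
  finally show ?thesis
    by (simp add: hom v monom_power const_power)
qed

text \<open>\<open>z\<close> and \<open>z'\<close> are the quotients by \<open>a ^ e\<close> that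
  each example has to provide. After multiplication by \<open>a ^ e\<close> the terms at
  \<open>U^p\<close> cancel, and for \<open>p mod 3 = 1\<close> also those at \<open>U\<close>,
  because \<open>t * t ^ (p - 1) = t ^ p\<close>.\<close>

lemma monic_invariant:
  assumes p: "prime p" "of_nat p = (0::'b)" "p \<noteq> 3" and e: "e = 2 * p div 3"
    and v: "\<theta> v = [:v, t:]" "\<theta> t = [:t:]"
    and z: "a ^ e * z = t ^ p * q e p" and z': "p mod 3 = 1 \<Longrightarrow> a ^ e * z' = t ^ (p - 1) * q e (p - 1)"
  shows "v ^ p - z - (if p mod 3 = 1 then z' else 0) * v \<in> invariants \<theta>"
proof (rule invariants_cancel[OF lfihd])
  note vp = \<theta>_prime_power[OF p(1,2) v(1)]
  have ae: "\<theta> (a ^ n) = [:a ^ n:]" and te: "\<theta> (t ^ n) = [:t ^ n:]" for n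
    by (simp_all add: hom a v const_power)
  show "a ^ e \<in> invariants \<theta>"
    by (simp add: in_invariants_iff[OF lfihd] ae)
  show "a ^ e \<noteq> 0"
    using a by simp
  have "p mod 3 \<noteq> 0"
    using p primes_dvd_imp_eq[of 3 p] by (auto simp: mod_eq_0_iff_dvd)
  then consider "p mod 3 = 1" | "p mod 3 = 2"
    by linarith
  then show "a ^ e * (v ^ p - z - (if p mod 3 = 1 then z' else 0) * v) \<in> invariants \<theta>"
  proof cases
    case 1
    then have e2: "3 * e + 2 = 2 * p"
      unfolding e by presburger
    have tp: "t ^ p = t * t ^ (p - 1)"
      using prime_gt_0_nat[OF p(1)] by (simp flip: power_Suc)
    have vt: "[:v, t:] = [:v:] + monom t 1"
      by (simp add: monom_altdef)
    let ?r = "a ^ e * v ^ p - t ^ p * q e p - t ^ (p - 1) * q e (p - 1) * v"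
    have "\<theta> ?r = [:a ^ e:] * ([:v ^ p:] + monom (t ^ p) p) -
        [:t ^ p:] * ([:q e p:] - monom (q e (p - 1)) 1 + monom (a ^ e) p) -
        [:t ^ (p - 1):] * [:q e (p - 1):] * ([:v:] + monom t 1)"
      by (simp only: hom(3,8) ae te vp \<theta>_q_mod3_eq_1[OF p(1,2) e2] v(1) vt)
    also have "\<dots> = [:?r:]"
      by (simp add: smult_monom smult_add_right algebra_simps tp)
    finally have "?r \<in> invariants \<theta>"
      by (simp only: in_invariants_iff[OF lfihd])
    moreover have "a ^ e * (v ^ p - z - z' * v) = ?r"
      using z z'[OF 1] by (simp only: algebra_simps)
    ultimately show ?thesis
      using 1 by simp
  next
    case 2
    then have e1: "3 * e + 1 = 2 * p"
      unfolding e by presburger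
    let ?r = "a ^ e * v ^ p - t ^ p * q e p"
    have "\<theta> ?r = [:a ^ e:] * ([:v ^ p:] + monom (t ^ p) p) - [:t ^ p:] * ([:q e p:] + monom (a ^ e) p)"
      by (simp only: hom(3,8) ae te vp \<theta>_q_mod3_eq_2[OF p(1,2) e1])
    also have "\<dots> = [:?r:]"
      by (simp add: smult_monom algebra_simps)
    finally have "?r \<in> invariants \<theta>"
      by (simp only: in_invariants_iff[OF lfihd])
    moreover have "a ^ e * (v ^ p - z) = ?r"
      using z by (simp only: algebra_simps)
    ultimately show ?thesis
      using 2 by simp
  qed
qed

end

text \<open>The common shape of the invariants constructed below; \<open>n \<ge> 2\<close> keeps the
  linear term away from the leading one.\<close>

lemma monic_poly_in:
  fixes r0 r1 :: "('v, 'k::field) mpoly"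
  assumes "r0 \<in> free_of v" "r1 \<in> free_of v" "n \<ge> 2"
  shows "lead_coeff (poly_in v (Var v ^ n - r0 - r1 * Var v)) = 1"
    and "degree (poly_in v (Var v ^ n - r0 - r1 * Var v)) > 0"
proof -
  have "poly_in v (Var v ^ n - r0 - r1 * Var v) + (poly_in v r0 + poly_in v (r1 * Var v)) = poly_in v (Var v ^ n)"
    by (simp flip: poly_in_simps)
  then have "poly_in v (Var v ^ n - r0 - r1 * Var v) = monom 1 n - [:r0, r1:]"
    using assms by (simp add: eq_diff_eq poly_in_simps poly_in_free_of monom_altdef)
  moreover have "degree (monom 1 n - [:r0, r1:]) = n"
  proof (rule antisym)
    show "degree (monom 1 n - [:r0, r1:]) \<le> n"
      using assms(3) by (intro degree_diff_le) (auto simp: degree_monom_eq)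
    show "n \<le> degree (monom 1 n - [:r0, r1:])"
      using assms(3) by (intro le_degree) (simp add: coeff_pCons split: nat.splits)
  qed
  ultimately show "lead_coeff (poly_in v (Var v ^ n - r0 - r1 * Var v)) = 1"
    and "degree (poly_in v (Var v ^ n - r0 - r1 * Var v)) > 0"
    using assms(3) by (auto simp: coeff_pCons split: nat.splits)
qed

corollary (in translated_variable) finitely_generated_invariants_monic:
  assumes "finite G" "free_of v \<inter> invariants \<theta> = subalgebra_hull G"
    and "r0 \<in> free_of v" "r1 \<in> free_of v" "n \<ge> 2" "Var v ^ n - r0 - r1 * Var v \<in> invariants \<theta>"
  shows "finitely_generated_algebra Const (invariants \<theta>)"
  using assms monic_poly_in by (intro finitely_generated_invariants)

section \<open>Monomials and substitutions\<close>

lemma Var_power: "Var i ^ n = Poly_Mapping.single (Poly_Mapping.single i n) 1"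
  by (induction n) (simp_all add: Var_def mult_single flip: single_add)

lemma monomial_single:
  "Const \<kappa> * Var i ^ a * Var j ^ b * Var l ^ c = Poly_Mapping.single
     (Poly_Mapping.single i a + Poly_Mapping.single j b + Poly_Mapping.single l c) \<kappa>"
  by (simp add: Var_power Const_def mult_single)

lemma algebra_hom_subst: "algebra_hom Const Const (mpoly_eval Const g)"
  by (rule algebra_hom_mpoly_eval) (simp_all add: Const_hom)

lemmas subst_simps = algebra_hom_simps[OF algebra_hom_subst]
  mpoly_eval_Var[where \<kappa> = Const, OF Const_hom(1,2)]

lemma Var_nonzero: "Var i \<noteq> (0 :: ('v, 'k::field) mpoly)"
  unfolding Var_def by (metis lookup_single_eq lookup_zero one_neq_zero)

lemma Const_of_nat: "Const (of_nat n) = of_nat n"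
  by (induction n) (simp_all add: Const_hom)

lemma Const_numeral: "Const (numeral w) = numeral w"
  using Const_of_nat[of "numeral w"] by simp

lemma Const_power: "Const (a ^ n) = Const a ^ n"
  by (induction n) (simp_all add: Const_hom)

section \<open>The example (F6-m)\<close>

text \<open>A linear order on the variables makes the polynomial ring an instance of \<^class>\<open>idom\<close>.\<close>

instance var6 :: countable
  by countable_datatype

instantiation var6 :: linorder
begin

definition less_eq_var6 :: "var6 \<Rightarrow> var6 \<Rightarrow> bool"
  where "less_eq_var6 i j \<longleftrightarrow> to_nat i \<le> to_nat j"

definition less_var6 :: "var6 \<Rightarrow> var6 \<Rightarrow> bool"
  where "less_var6 i j \<longleftrightarrow> to_nat i < to_nat j"

instance
  by standard (auto simp: less_eq_var6_def less_var6_def)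

end

locale example6 =
  fixes m :: nat and \<theta> :: "(var6, 'k::field) mpoly \<Rightarrow> (var6, 'k) mpoly poly"
    and x y s t u v X Y :: "(var6, 'k) mpoly"
  assumes \<theta>_eq: "\<theta> = hom_by_values (values6 m)"
    and vars: "x = Var X6" "y = Var Y6" "s = Var S6" "t = Var T6" "u = Var U6" "v = Var V6"
    and XY: "X = x ^ (m + 1)" "Y = y ^ (m + 1)"
begin

lemma \<theta>_lfihd: "lfihd Const \<theta>"
  using lfihd_theta6[of m] unfolding \<theta>_eq theta6_def .

lemma \<theta>_hom: "algebra_hom Const (\<lambda>c. [:Const c:]) \<theta>"
  unfolding \<theta>_eq by (rule algebra_hom_hom_by_values)

lemmas hom = algebra_hom_simps[OF \<theta>_hom]

lemma \<theta>_vars: "\<theta> x = [:x:]" "\<theta> y = [:y:]" "\<theta> s = [:s, X:]" "\<theta> t = [:t, 2 * Y * s, X * Y:]"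
  "\<theta> u = [:u, 3 * Y * t, 3 * Y ^ 2 * s, X * Y ^ 2:]" "\<theta> v = [:v, x ^ m * y ^ m:]"
proof -
  have "y ^ (2 * (m + 1)) = Y ^ 2"
    unfolding XY by (simp only: power_mult[symmetric] mult.commute)
  then show "\<theta> u = [:u, 3 * Y * t, 3 * Y ^ 2 * s, X * Y ^ 2:]"
    by (simp only: \<theta>_eq XY vars hom_by_values_Var values6.simps)
qed (simp_all only: \<theta>_eq XY vars hom_by_values_Var values6.simps)

lemma \<theta>_XY: "\<theta> X = [:X:]" "\<theta> Y = [:Y:]"
  by (simp_all only: XY hom \<theta>_vars const_power)

lemma nonzero: "x \<noteq> 0" "y \<noteq> 0" "X \<noteq> 0" "Y \<noteq> 0"
  by (simp_all add: XY vars Var_nonzero)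

lemma inv_iff: "b \<in> invariants \<theta> \<longleftrightarrow> \<theta> b = [:b:]"
  by (rule in_invariants_iff[OF \<theta>_lfihd])

lemma free: "x \<in> free_of V6" "y \<in> free_of V6" "s \<in> free_of V6" "t \<in> free_of V6" "u \<in> free_of V6"
  "X \<in> free_of V6" "Y \<in> free_of V6"
  unfolding XY vars by (simp_all add: Var_free_of free_of_closed del: power_Suc)

sublocale ext: translated_variable "values6 m" V6 "x ^ m * y ^ m"
proof
  show "lfihd Const (hom_by_values (values6 m))"
    using lfihd_theta6[of m] unfolding theta6_def .
  show "values6 m V6 = [:Var V6, x ^ m * y ^ m:]"
    by (simp add: vars)
  show "x ^ m * y ^ m \<in> free_of V6"
    by (intro free_of_closed free)
  fix i j assume "i \<noteq> V6"
  then show "coeff (values6 m i) j \<in> free_of V6"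
    by (cases i) (auto simp: coeff_pCons free_of_closed Var_free_of simp del: power_Suc split: nat.splits)
qed

text \<open>The coefficients of \<open>\<theta> u\<close> are themselves those of the orbit cubic
  with constant term \<open>u\<close>.\<close>

sublocale orbit: cubic_orbit Const \<theta> "X * Y ^ 2" "3 * Y ^ 2 * s" "3 * Y * t" u
  by standard
     (simp_all add: \<theta>_lfihd hom \<theta>_vars \<theta>_XY const_power nonzero numeral_poly algebra_simps power2_eq_square)

text \<open>
  Up to powers of \<open>Y\<close>, these are the Hessian, the cubic covariant and the discriminant of the cubic
  with coefficients \<open>X * Y\<^sup>2\<close>, \<open>3 * Y\<^sup>2 * s\<close>, \<open>3 * Y * t\<close>, \<open>u\<close>.
\<close>

definition "H = Y * s ^ 2 - X * t"
definition "G = X ^ 2 * u - 3 * X * Y * s * t + 2 * Y ^ 2 * s ^ 3"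
definition "D = X ^ 2 * u ^ 2 - 6 * X * Y * s * t * u + 4 * X * Y * t ^ 3 + 4 * Y ^ 2 * s ^ 3 * u - 3 * Y ^ 2 * s ^ 2 * t ^ 2"

lemma H_inv: "H \<in> invariants \<theta>"
  unfolding inv_iff H_def
  by (simp add: hom \<theta>_vars \<theta>_XY numeral_poly algebra_simps power2_eq_square)

lemma G_inv: "G \<in> invariants \<theta>"
  unfolding inv_iff G_def
  by (simp add: hom \<theta>_vars \<theta>_XY numeral_poly algebra_simps power2_eq_square power3_eq_cube)

text \<open>The classical syzygy of the covariants of a cubic. It presents \<open>D\<close> as
  \<open>(G ^ 2 - 4 * Y * H ^ 3) / X ^ 2\<close> and eliminates \<open>G ^ 2\<close> modulo
  \<open>x\<close>.\<close>

lemma relation: "G ^ 2 = 4 * Y * H ^ 3 + X ^ 2 * D"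
  unfolding G_def H_def D_def by (simp add: algebra_simps power2_eq_square power3_eq_cube)

lemma xy_inv: "x \<in> invariants \<theta>" "y \<in> invariants \<theta>"
  by (simp_all add: inv_iff \<theta>_vars)

lemma D_inv: "D \<in> invariants \<theta>"
proof (rule invariants_cancel[OF \<theta>_lfihd])
  show "X ^ 2 \<in> invariants \<theta>"
    by (simp add: inv_iff hom \<theta>_XY const_power)
  have "\<theta> (G ^ 2 - 4 * Y * H ^ 3) = [:G ^ 2 - 4 * Y * H ^ 3:]"
    using G_inv H_inv by (simp add: inv_iff hom \<theta>_XY const_power numeral_poly)
  then show "X ^ 2 * D \<in> invariants \<theta>"
    by (simp add: inv_iff relation)
qed (simp add: nonzero)

lemma localized_generators:
  assumes "x \<in> K" "y \<in> K" "s \<in> K" "X * t \<in> K" "X ^ 2 * u \<in> K" and i: "i \<noteq> V6"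
  shows "\<exists>N. x ^ N * Var i \<in> K"
proof (cases i)
  case T6
  then show ?thesis using assms by (intro exI[of _ "m + 1"]) (simp only: vars XY)
next
  case U6
  then show ?thesis using assms by (intro exI[of _ "(m + 1) * 2"]) (simp only: vars XY power_mult)
qed (use assms in \<open>auto simp: vars intro: exI[of _ 0]\<close>)

lemmas invariants_eq_hull6 =
  invariants_eq_hull[where f = "values6 m :: var6 \<Rightarrow> (var6, 'k) mpoly poly" and v = V6, folded \<theta>_eq,
    OF \<theta>_lfihd]

lemma free_HGD: "H \<in> free_of V6" "G \<in> free_of V6" "D \<in> free_of V6"
  unfolding H_def G_def D_def by (intro free_of_closed free)+

lemma XY_in_hull: "x \<in> subalgebra_hull S \<Longrightarrow> X \<in> subalgebra_hull S" "y \<in> subalgebra_hull S \<Longrightarrow> Y \<in> subalgebra_hull S"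
  unfolding XY by (rule subalgebra_hull_closed; assumption)+

section \<open>Invariants without v in (F6-m)\<close>

definition \<sigma> :: "(var6 \<Rightarrow> bool) \<Rightarrow> (var6, 'k) mpoly \<Rightarrow> (var6, 'k) mpoly"
  where "\<sigma> Z = mpoly_eval Const (\<lambda>i. if Z i then 0 else Var i)"

lemma \<sigma>_simps: "\<sigma> Z (Const c) = Const c" "\<sigma> Z (a + b) = \<sigma> Z a + \<sigma> Z b" "\<sigma> Z (a * b) = \<sigma> Z a * \<sigma> Z b"
  "\<sigma> Z 1 = 1" "\<sigma> Z 0 = 0" "\<sigma> Z (a ^ n) = \<sigma> Z a ^ n" "\<sigma> Z (- a) = - \<sigma> Z a" "\<sigma> Z (a - b) = \<sigma> Z a - \<sigma> Z b"
  "\<sigma> Z (numeral w) = numeral w" "\<sigma> Z (Var i) = (if Z i then 0 else Var i)"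
  unfolding \<sigma>_def by (simp_all only: subst_simps)

definition \<mu> where "\<mu> = (\<lambda>(a, b, c, e). y ^ a * H ^ b * D ^ c * G ^ e)"

text \<open>The local slice is \<open>s\<close>. At \<open>x = t = 0\<close> the generators
  \<open>H\<close>, \<open>G\<close>, \<open>D\<close> become \<open>Y s^2\<close>,
  \<open>2 Y^2 s^3\<close>, \<open>4 Y^2 s^3 u\<close>, with nonzero constants. The relation leaves
  at most one factor \<open>G\<close>. Then the exponent of \<open>u\<close> gives that of
  \<open>D\<close>, the parity of the remaining exponent of \<open>s\<close> gives that of
  \<open>G\<close>, and those of \<open>H\<close> and \<open>y\<close> follow.\<close>

lemma fixed_ring_char_not_2:
  assumes two: "(2::'k) \<noteq> 0"
  shows "free_of V6 \<inter> invariants \<theta> = subalgebra_hull {x, y, H, G, D}"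
proof (rule invariants_eq_hull6)
  let ?gens = "{x, y, H, G, D}"
  show "?gens \<subseteq> free_of V6" "?gens \<subseteq> invariants \<theta>"
    using free free_HGD xy_inv H_inv G_inv D_inv by auto
  show "x \<in> subalgebra_hull ?gens"
    by (rule hull_inc) simp
  show "x \<noteq> 0"
    by (rule nonzero)
  show "\<theta> s = [:s, X:]" "X \<noteq> 0"
    by (rule \<theta>_vars nonzero)+
  fix i assume i: "i \<noteq> V6"
  let ?K = "subalgebra_hull (insert s ?gens)"
  have K: "x \<in> ?K" "y \<in> ?K" "s \<in> ?K" "H \<in> ?K" "G \<in> ?K"
    by (rule hull_inc; simp)+
  have XYK: "X \<in> ?K" "Y \<in> ?K"
    by (intro XY_in_hull K)+
  have "X * t = Y * s ^ 2 - H"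
    by (simp add: H_def)
  then have Xt: "X * t \<in> ?K"
    by (simp only:) (intro subalgebra_hull_closed K XYK)
  have "X ^ 2 * u = G + 3 * Y * s * (X * t) - 2 * Y ^ 2 * s ^ 3"
    by (simp add: G_def)
  then have "X ^ 2 * u \<in> ?K"
    by (simp only:) (intro subalgebra_hull_closed K XYK Xt)
  then show "\<exists>N. x ^ N * Var i \<in> ?K"
    using K Xt i by (intro localized_generators)
next
  let ?gens = "{x, y, H, G, D}"
  let ?C = "subalgebra_hull ?gens"
  have C: "x \<in> ?C" "y \<in> ?C" "H \<in> ?C" "G \<in> ?C" "D \<in> ?C"
    by (rule hull_inc; simp)+
  fix b assume "x * b \<in> ?C"
  define \<nu> where "\<nu> = (\<lambda>(a, b, c, e). Poly_Mapping.single Y6 (a + (m + 1) * (b + 2 * c + 2 * e)) +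
    Poly_Mapping.single S6 (2 * b + 3 * c + 3 * e) + Poly_Mapping.single U6 c)"
  define \<kappa> :: "nat \<times> nat \<times> nat \<times> nat \<Rightarrow> 'k" where "\<kappa> = (\<lambda>(a, b, c, e). 4 ^ c * 2 ^ e)"
  show "b \<in> ?C"
  proof (rule hull_saturated_by_monomials[where \<sigma> = "\<sigma> (\<lambda>i. i = X6 \<or> i = T6)" and \<mu> = \<mu> and \<nu> = \<nu> and \<kappa> = \<kappa>
        and I = "{i. snd (snd (snd i)) \<le> 1}" and x = x and start = "(0, 0, 0, 0)"])
    let ?\<sigma> = "\<sigma> (\<lambda>i. i = X6 \<or> i = T6)"
    show "algebra_hom Const Const ?\<sigma>"
      unfolding \<sigma>_def by (rule algebra_hom_subst)
    show "?\<sigma> x = 0"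
      by (simp add: \<sigma>_simps vars)
    show "inj_on \<nu> {i. snd (snd (snd i)) \<le> 1}"
    proof (rule inj_onI)
      fix i j :: "nat \<times> nat \<times> nat \<times> nat"
      assume ij: "i \<in> {i. snd (snd (snd i)) \<le> 1}" "j \<in> {i. snd (snd (snd i)) \<le> 1}" and eq: "\<nu> i = \<nu> j"
      obtain a b c e where i: "i = (a, b, c, e)" by (cases i)
      obtain a' b' c' e' where j: "j = (a', b', c', e')" by (cases j)
      have c: "c' = c"
        using arg_cong[OF eq, of "\<lambda>p. Poly_Mapping.lookup p U6"]
        by (simp add: \<nu>_def i j lookup_add lookup_single when_def)
      have s_eq: "2 * b + 3 * e = 2 * b' + 3 * e'"
        using arg_cong[OF eq, of "\<lambda>p. Poly_Mapping.lookup p S6"]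
        by (simp add: \<nu>_def i j lookup_add lookup_single when_def c)
      have "even e \<longleftrightarrow> even e'"
        using arg_cong[OF s_eq, of even] by simp
      moreover have "e \<le> 1" "e' \<le> 1"
        using ij by (simp_all add: i j)
      ultimately have be: "e' = e"
        by (auto simp: le_Suc_eq)
      then have be: "e' = e" "b' = b"
        using s_eq by simp_all
      have "a' = a"
        using arg_cong[OF eq, of "\<lambda>p. Poly_Mapping.lookup p Y6"]
        by (simp add: \<nu>_def i j lookup_add lookup_single when_def c be)
      then show "i = j"
        by (simp add: i j c be)
    qed
    fix i :: "nat \<times> nat \<times> nat \<times> nat"
    assume i1: "i \<in> {i. snd (snd (snd i)) \<le> 1}"
    obtain a b c e where i: "i = (a, b, c, e)" by (cases i)
    have e: "e \<le> 1"
      using i1 i by simp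
    have \<sigma>X: "?\<sigma> X = 0" "?\<sigma> Y = Y" "?\<sigma> y = y" "?\<sigma> s = s" "?\<sigma> t = 0" "?\<sigma> u = u"
      by (simp_all add: XY vars \<sigma>_simps)
    have \<sigma>H: "?\<sigma> H = Y * s ^ 2" "?\<sigma> G = 2 * Y ^ 2 * s ^ 3" "?\<sigma> D = 4 * Y ^ 2 * s ^ 3 * u"
      by (simp_all add: H_def G_def D_def \<sigma>_simps \<sigma>X)
    have "?\<sigma> (\<mu> i) = 4 ^ c * 2 ^ e * (y ^ a * Y ^ b * (Y ^ 2) ^ c * (Y ^ 2) ^ e) * ((s ^ 2) ^ b * (s ^ 3) ^ c * (s ^ 3) ^ e) * u ^ c"
      by (simp add: \<mu>_def i \<sigma>_simps \<sigma>X \<sigma>H power_mult_distrib mult_ac)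
    also have "y ^ a * Y ^ b * (Y ^ 2) ^ c * (Y ^ 2) ^ e = y ^ (a + (m + 1) * (b + 2 * c + 2 * e))"
      by (simp only: XY power_mult[symmetric] power_add[symmetric] distrib_left mult_ac add_ac)
    also have "(s ^ 2) ^ b * (s ^ 3) ^ c * (s ^ 3) ^ e = s ^ (2 * b + 3 * c + 3 * e)"
      by (simp only: power_mult[symmetric] power_add[symmetric])
    also have "4 ^ c * 2 ^ e = Const (\<kappa> i)"
      by (simp add: \<kappa>_def i Const_hom Const_power Const_numeral)
    finally show "?\<sigma> (\<mu> i) = Poly_Mapping.single (\<nu> i) (\<kappa> i)"
      by (simp only: vars monomial_single \<nu>_def i prod.case)
    have "(2::'k) * 2 \<noteq> 0"
      using two mult_eq_0_iff[of "2::'k" 2] by blast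
    then show "\<kappa> i \<noteq> 0"
      using two by (simp add: \<kappa>_def i)
    fix g assume g: "g \<in> ?gens"
    have \<mu>C: "\<mu> (a, b, c, e) \<in> ?C" for a b c e
      unfolding \<mu>_def prod.case by (intro subalgebra_hull_closed C)
    consider "g = x" | "g = y" | "g = H" | "g = D" | "g = G" "e = 0" | "g = G" "e = 1"
      using g e by fastforce
    then show "\<exists>a c j. j \<in> {i. snd (snd (snd i)) \<le> 1} \<and> c \<in> ?C \<and> g * \<mu> i = Const a * \<mu> j + x * c"
    proof cases
      case 1
      then show ?thesis using e \<mu>C
        by (intro exI[of _ 0] exI[of _ "\<mu> i"] exI[of _ i]) (simp add: i Const_hom)
    next
      case 2
      then show ?thesis using e
        by (intro exI[of _ 1] exI[of _ 0] exI[of _ "(a + 1, b, c, e)"]) (simp add: i \<mu>_def Const_hom subalgebra_hull_closed mult_ac)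
    next
      case 3
      then show ?thesis using e
        by (intro exI[of _ 1] exI[of _ 0] exI[of _ "(a, b + 1, c, e)"]) (simp add: i \<mu>_def Const_hom subalgebra_hull_closed mult_ac)
    next
      case 4
      then show ?thesis using e
        by (intro exI[of _ 1] exI[of _ 0] exI[of _ "(a, b, c + 1, e)"]) (simp add: i \<mu>_def Const_hom subalgebra_hull_closed mult_ac)
    next
      case 5
      then show ?thesis
        by (intro exI[of _ 1] exI[of _ 0] exI[of _ "(a, b, c, 1)"]) (simp add: i \<mu>_def Const_hom subalgebra_hull_closed mult_ac)
    next
      case 6
      \<comment> \<open>\<open>?r\<close> is the contribution of the term \<open>X ^ 2 * D\<close>
        of the relation, divided by \<open>x\<close>.\<close>
      let ?r = "x ^ m * X * (y ^ a * H ^ b * D ^ (c + 1))"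
      have "X ^ 2 = x * (x ^ m * X)"
        by (simp add: XY power2_eq_square mult_ac)
      moreover have "g * \<mu> i = G ^ 2 * (y ^ a * H ^ b * D ^ c)"
        using 6 by (simp add: i \<mu>_def power2_eq_square mult_ac)
      ultimately have "g * \<mu> i = Const 4 * (Y * y ^ a * H ^ (b + 3) * D ^ c) + x * ?r"
        by (simp add: relation Const_numeral power_add algebra_simps)
      also have "Y * y ^ a = y ^ (a + (m + 1))"
        by (simp add: XY power_add mult_ac)
      finally have "g * \<mu> i = Const 4 * \<mu> (a + (m + 1), b + 3, c, 0) + x * ?r"
        by (simp add: \<mu>_def)
      moreover have "?r \<in> ?C"
        by (intro subalgebra_hull_closed C XY_in_hull)
      ultimately show ?thesis
        by (intro exI[of _ 4] exI[of _ ?r] exI[of _ "(a + (m + 1), b + 3, c, 0)"]) simp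
    qed
  qed (use C nonzero \<open>x * b \<in> ?C\<close> in \<open>simp_all add: \<mu>_def\<close>)
qed

text \<open>In characteristic 2 the cubic covariant \<open>G\<close> is divisible by \<open>X\<close>.\<close>

definition "E = X * u - Y * s * t"

lemma E_inv:
  assumes two: "(2::'k) = 0"
  shows "E \<in> invariants \<theta>"
proof -
  have "(3::'k) = 2 + 1"
    by simp
  then have "(2 :: (var6, 'k) mpoly) = 0" "(3 :: (var6, 'k) mpoly) = 1"
    using two by (simp_all only: Const_numeral[symmetric] Const_hom add_0)
  then show ?thesis
    unfolding inv_iff E_def
    by (simp add: hom \<theta>_vars \<theta>_XY algebra_simps power2_eq_square)
qed

text \<open>Setting only \<open>x\<close> to zero turns \<open>H\<close> and \<open>E\<close> into
  \<open>Y s^2\<close> and \<open>- Y s t\<close>, so the monomials in \<open>y\<close>,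
  \<open>H\<close>, \<open>E\<close> stay distinct: the exponents of \<open>t\<close>,
  \<open>s\<close>, \<open>y\<close> determine those of \<open>E\<close>, \<open>H\<close>,
  \<open>y\<close> in this order.\<close>

lemma fixed_ring_char_2:
  assumes two: "(2::'k) = 0"
  shows "free_of V6 \<inter> invariants \<theta> = subalgebra_hull {x, y, H, E}"
proof (rule invariants_eq_hull6)
  let ?gens = "{x, y, H, E}"
  have "E \<in> free_of V6"
    unfolding E_def by (intro free_of_closed free)
  then show "?gens \<subseteq> free_of V6" "?gens \<subseteq> invariants \<theta>"
    using free free_HGD xy_inv H_inv E_inv[OF two] by auto
  show "x \<in> subalgebra_hull ?gens"
    by (rule hull_inc) simp
  show "x \<noteq> 0"
    by (rule nonzero)
  show "\<theta> s = [:s, X:]" "X \<noteq> 0"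
    by (rule \<theta>_vars nonzero)+
  fix i assume i: "i \<noteq> V6"
  let ?K = "subalgebra_hull (insert s ?gens)"
  have K: "x \<in> ?K" "y \<in> ?K" "s \<in> ?K" "H \<in> ?K" "E \<in> ?K"
    by (rule hull_inc; simp)+
  have XYK: "X \<in> ?K" "Y \<in> ?K"
    by (intro XY_in_hull K)+
  have "X * t = Y * s ^ 2 - H"
    by (simp add: H_def)
  then have Xt: "X * t \<in> ?K"
    by (simp only:) (intro subalgebra_hull_closed K XYK)
  have "X ^ 2 * u = X * E + Y * s * (X * t)"
    by (simp add: E_def algebra_simps power2_eq_square)
  then have "X ^ 2 * u \<in> ?K"
    by (simp only:) (intro subalgebra_hull_closed K XYK Xt)
  then show "\<exists>N. x ^ N * Var i \<in> ?K"
    using K Xt i by (intro localized_generators)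
next
  let ?gens = "{x, y, H, E}"
  let ?C = "subalgebra_hull ?gens"
  have C: "x \<in> ?C" "y \<in> ?C" "H \<in> ?C" "E \<in> ?C"
    by (rule hull_inc; simp)+
  fix b assume "x * b \<in> ?C"
  define \<mu> where "\<mu> = (\<lambda>(a, b, c). y ^ a * H ^ b * E ^ c)"
  define \<nu> where "\<nu> = (\<lambda>(a, b, c). Poly_Mapping.single Y6 (a + (m + 1) * (b + c)) +
    Poly_Mapping.single S6 (2 * b + c) + Poly_Mapping.single T6 c)"
  define \<kappa> :: "nat \<times> nat \<times> nat \<Rightarrow> 'k" where "\<kappa> = (\<lambda>(a, b, c). (-1) ^ c)"
  show "b \<in> ?C"
  proof (rule hull_saturated_by_monomials[where \<sigma> = "\<sigma> (\<lambda>i. i = X6)" and \<mu> = \<mu> and \<nu> = \<nu> and \<kappa> = \<kappa>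
        and I = UNIV and x = x and start = "(0, 0, 0)"])
    let ?\<sigma> = "\<sigma> (\<lambda>i. i = X6)"
    show "algebra_hom Const Const ?\<sigma>"
      unfolding \<sigma>_def by (rule algebra_hom_subst)
    show "?\<sigma> x = 0"
      by (simp add: \<sigma>_simps vars)
    show "inj_on \<nu> UNIV"
    proof (rule inj_onI)
      fix i j :: "nat \<times> nat \<times> nat"
      assume eq: "\<nu> i = \<nu> j"
      obtain a b c where i: "i = (a, b, c)" by (cases i)
      obtain a' b' c' where j: "j = (a', b', c')" by (cases j)
      have c: "c' = c"
        using arg_cong[OF eq, of "\<lambda>p. Poly_Mapping.lookup p T6"]
        by (simp add: \<nu>_def i j lookup_add lookup_single when_def)
      have b: "b' = b"
        using arg_cong[OF eq, of "\<lambda>p. Poly_Mapping.lookup p S6"]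
        by (simp add: \<nu>_def i j lookup_add lookup_single when_def c)
      have "a' = a"
        using arg_cong[OF eq, of "\<lambda>p. Poly_Mapping.lookup p Y6"]
        by (simp add: \<nu>_def i j lookup_add lookup_single when_def c b)
      then show "i = j"
        by (simp add: i j c b)
    qed
    fix i :: "nat \<times> nat \<times> nat"
    obtain a b c where i: "i = (a, b, c)" by (cases i)
    have \<sigma>X: "?\<sigma> X = 0" "?\<sigma> Y = Y" "?\<sigma> y = y" "?\<sigma> s = s" "?\<sigma> t = t" "?\<sigma> u = u"
      by (simp_all add: XY vars \<sigma>_simps)
    have \<sigma>H: "?\<sigma> H = Y * s ^ 2" "?\<sigma> E = - 1 * Y * s * t"
      by (simp_all add: H_def E_def \<sigma>_simps \<sigma>X)
    have "?\<sigma> (\<mu> i) = (-1) ^ c * (y ^ a * Y ^ b * Y ^ c) * ((s ^ 2) ^ b * s ^ c) * t ^ c"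
      by (simp only: \<mu>_def i prod.case \<sigma>_simps \<sigma>X \<sigma>H power_mult_distrib mult_ac)
    also have "y ^ a * Y ^ b * Y ^ c = y ^ (a + (m + 1) * (b + c))"
      by (simp only: XY power_mult[symmetric] power_add[symmetric] distrib_left mult_ac add_ac)
    also have "(s ^ 2) ^ b * s ^ c = s ^ (2 * b + c)"
      by (simp only: power_mult[symmetric] power_add[symmetric])
    also have "(-1) ^ c = Const (\<kappa> i)"
      by (simp add: \<kappa>_def i Const_power Const_minus_one)
    finally show "?\<sigma> (\<mu> i) = Poly_Mapping.single (\<nu> i) (\<kappa> i)"
      by (simp only: vars monomial_single \<nu>_def i prod.case)
    show "\<kappa> i \<noteq> 0"
      by (simp add: \<kappa>_def i)
    fix g assume g: "g \<in> ?gens"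
    have \<mu>C: "\<mu> i \<in> ?C"
      unfolding \<mu>_def i prod.case by (intro subalgebra_hull_closed C)
    consider "g = x" | "g = y" | "g = H" | "g = E"
      using g by blast
    then show "\<exists>a c j. j \<in> UNIV \<and> c \<in> ?C \<and> g * \<mu> i = Const a * \<mu> j + x * c"
    proof cases
      case 1
      then show ?thesis using \<mu>C
        by (intro exI[of _ 0] exI[of _ "\<mu> i"] exI[of _ i]) (simp add: i Const_hom)
    next
      case 2
      then show ?thesis
        by (intro exI[of _ 1] exI[of _ 0] exI[of _ "(a + 1, b, c)"]) (simp add: i \<mu>_def Const_hom subalgebra_hull_closed mult_ac)
    next
      case 3
      then show ?thesis
        by (intro exI[of _ 1] exI[of _ 0] exI[of _ "(a, b + 1, c)"]) (simp add: i \<mu>_def Const_hom subalgebra_hull_closed mult_ac)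
    next
      case 4
      then show ?thesis
        by (intro exI[of _ 1] exI[of _ 0] exI[of _ "(a, b, c + 1)"]) (simp add: i \<mu>_def Const_hom subalgebra_hull_closed mult_ac)
    qed
  qed (use C nonzero \<open>x * b \<in> ?C\<close> in \<open>simp_all add: \<mu>_def\<close>)
qed

section \<open>Monic invariants in (F6-m)\<close>

abbreviation q where "q \<equiv> cubic_power_coeff (X * Y ^ 2) (3 * Y ^ 2 * s) (3 * Y * t) u"

text \<open>The coefficients of index 0, 1, 2, 3 of the cubic carry the factors
  \<open>Y ^ 2\<close>, \<open>Y ^ 2\<close>, \<open>Y\<close>, 1, so each falls short of
  \<open>Y ^ 2\<close> by an exponent of at most 2/3 of its index. A term of \<open>q e j\<close>
  thus lacks at most \<open>2 * j div 3\<close> factors \<open>Y\<close> of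
  \<open>Y ^ (2 * e)\<close>; the hypothesis says that \<open>l\<close> is at least this
  number.\<close>

lemma y_divides_q:
  assumes "2 * j \<le> 3 * l + 2"
  shows "\<exists>r\<in>free_of V6. Y ^ l * q e j = Y ^ (2 * e) * r"
  using assms
proof (induction e arbitrary: j l)
  case 0
  show ?case
    by (cases "j = 0") (auto simp: cubic_power_coeff_def one_pCons coeff_pCons free_of_closed free split: nat.splits
        intro!: bexI[of _ "Y ^ l"] bexI[of _ 0])
next
  case (Suc e)
  let ?qs = "\<lambda>i. if i \<le> j then q e (j - i) else 0"
  have qs: "q (Suc e) j = X * Y ^ 2 * ?qs 0 + 3 * Y ^ 2 * s * ?qs 1 + 3 * Y * t * ?qs 2 + u * ?qs 3"
  proof -
    consider "j = 0" | "j = Suc 0" | "j = Suc (Suc 0)" | k where "j = Suc (Suc (Suc k))"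
      by (metis not0_implies_Suc)
    then show ?thesis
      by cases (simp_all add: cubic_power_coeff_def numeral_2_eq_2 numeral_3_eq_3)
  qed
  have "\<exists>r\<in>free_of V6. Y ^ l * ?qs i = Y ^ (2 * e) * r" if "i \<le> 1" for i
    using Suc.IH[of "j - i" l] Suc.prems that by (auto intro: bexI[of _ 0] simp: free_of_closed)
  then obtain r0 r1 where r01: "r0 \<in> free_of V6" "Y ^ l * ?qs 0 = Y ^ (2 * e) * r0"
      "r1 \<in> free_of V6" "Y ^ l * ?qs 1 = Y ^ (2 * e) * r1"
    by (meson le_refl zero_le_one)
  \<comment> \<open>The coefficient of index \<open>i = n + 1\<close> lacks \<open>n\<close> factors
    \<open>Y\<close>; they are taken from \<open>Y ^ l\<close>.\<close>
  have lift: "\<exists>r\<in>free_of V6. Y ^ l * ?qs i = Y ^ (2 * e + n) * r"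
    if "i = Suc n" "n = 1 \<or> n = 2" for i n
  proof (cases "i \<le> j")
    case True
    have "n \<le> l" "2 * (j - i) \<le> 3 * (l - n) + 2"
      using that True Suc.prems by auto
    then obtain r where r: "r \<in> free_of V6" "Y ^ (l - n) * q e (j - i) = Y ^ (2 * e) * r"
      using Suc.IH by blast
    have "Y ^ l * q e (j - i) = Y ^ n * (Y ^ (l - n) * q e (j - i))"
      using \<open>n \<le> l\<close> by (simp flip: power_add mult.assoc)
    then have "Y ^ l * ?qs i = Y ^ n * (Y ^ (2 * e) * r)"
      using r(2) True by simp
    then have "Y ^ l * ?qs i = Y ^ (2 * e + n) * r"
      by (simp only: power_add mult_ac)
    then show ?thesis
      using r(1) by blast
  qed (auto intro: bexI[of _ 0] simp: free_of_closed)
  obtain r2 r3 where r23: "r2 \<in> free_of V6" "Y ^ l * ?qs 2 = Y ^ (2 * e + 1) * r2"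
      "r3 \<in> free_of V6" "Y ^ l * ?qs 3 = Y ^ (2 * e + 2) * r3"
    using lift[of 2 1] lift[of 3 2] by auto
  have "Y ^ l * q (Suc e) j = X * Y ^ 2 * (Y ^ l * ?qs 0) + 3 * Y ^ 2 * s * (Y ^ l * ?qs 1) +
      3 * Y * t * (Y ^ l * ?qs 2) + u * (Y ^ l * ?qs 3)"
    unfolding qs by (simp only: distrib_left mult_ac)
  also have "\<dots> = Y ^ (2 * Suc e) * (X * r0 + 3 * s * r1 + 3 * t * r2 + u * r3)"
    unfolding r01 r23 by (simp add: algebra_simps power2_eq_square)
  finally show ?case
    using r01 r23 free by (intro bexI[of _ "X * r0 + 3 * s * r1 + 3 * t * r2 + u * r3"] free_of_closed)
qed

text \<open>As \<open>(m + 1) * e \<le> m * n\<close>, the power of \<open>x ^ m * y ^ m\<close>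
  contains \<open>X ^ e * Y ^ e\<close>; the second \<open>Y ^ e\<close> of the denominator comes
  from \<open>y_divides_q\<close> with \<open>l = e\<close>.\<close>

lemma q_multiple:
  assumes "2 * j \<le> 3 * e + 2" "(m + 1) * e \<le> m * n"
  shows "\<exists>r\<in>free_of V6. (X * Y ^ 2) ^ e * r = (x ^ m * y ^ m) ^ n * q e j"
proof -
  obtain r where r: "r \<in> free_of V6" "Y ^ e * q e j = Y ^ (2 * e) * r"
    using y_divides_q[OF assms(1)] by blast
  define k where "k = m * n - (m + 1) * e"
  have k: "m * n = (m + 1) * e + k"
    using assms(2) by (simp add: k_def)
  have "X ^ e = x ^ ((m + 1) * e)" "Y ^ e = y ^ ((m + 1) * e)"
    by (simp_all only: XY power_mult)
  then have "(x ^ m * y ^ m) ^ n = (x ^ k * y ^ k) * (X ^ e * Y ^ e)"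
    by (simp only: power_mult_distrib power_mult[symmetric] k power_add mult_ac)
  then have "(x ^ m * y ^ m) ^ n * q e j = (x ^ k * y ^ k) * X ^ e * (Y ^ e * q e j)"
    by (simp only: mult_ac)
  also have "\<dots> = (X * Y ^ 2) ^ e * (x ^ k * y ^ k * r)"
    unfolding r by (simp only: power_mult_distrib power_mult[symmetric] mult_ac)
  finally show ?thesis
    using r(1) free by (intro bexI[of _ "x ^ k * y ^ k * r"] free_of_closed) simp_all
qed

theorem finitely_generated:
  assumes m: "m \<ge> 2" and char: "CHAR('k) > 0"
  shows "finitely_generated_algebra Const (invariants \<theta>)"
proof -
  define p where "p = CHAR('k)"
  have p: "prime p"
    unfolding p_def using char by (rule prime_CHAR_semidom)
  have p0: "of_nat p = (0 :: (var6, 'k) mpoly)"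
    using of_nat_CHAR[where 'a = 'k] by (simp add: p_def Const_hom flip: Const_of_nat)
  have p2: "p \<ge> 2"
    using p by (rule prime_ge_2_nat)
  have "\<exists>r0\<in>free_of V6. \<exists>r1\<in>free_of V6. v ^ p - r0 - r1 * v \<in> invariants \<theta>"
  proof (cases "p = 3")
    case True
    \<comment> \<open>In characteristic 3, \<open>u\<close> goes to \<open>u + X Y^2 U^3\<close>.
      The factor of \<open>u\<close> is \<open>(x^m y^m)^3 / (X Y^2)\<close>, whose exponent
      \<open>3 * m - 2 * (m + 1) = m - 2\<close> of \<open>y\<close> is nonnegative as
      \<open>m \<ge> 2\<close>.\<close>
    let ?r = "x ^ (2 * m - 1) * y ^ (m - 2) * u"
    have three: "(3 :: (var6, 'k) mpoly) = 0"
      using p0 True by simp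
    have "x ^ (2 * m - 1) * X = (x ^ m) ^ 3" "y ^ (m - 2) * Y ^ 2 = (y ^ m) ^ 3"
    proof -
      have "2 * m - 1 + (m + 1) = m * 3" "m - 2 + (m + 1) * 2 = m * 3"
        using m by auto
      then show "x ^ (2 * m - 1) * X = (x ^ m) ^ 3" "y ^ (m - 2) * Y ^ 2 = (y ^ m) ^ 3"
        by (simp_all only: XY power_mult[symmetric] power_add[symmetric])
    qed
    then have "(x ^ (2 * m - 1) * X) * (y ^ (m - 2) * Y ^ 2) = (x ^ m * y ^ m) ^ 3"
      by (simp only: power_mult_distrib)
    then have "x ^ (2 * m - 1) * y ^ (m - 2) * (X * Y ^ 2) = (x ^ m * y ^ m) ^ 3"
      by (simp only: mult_ac)
    moreover have "\<theta> ?r = [:?r:] + monom (x ^ (2 * m - 1) * y ^ (m - 2) * (X * Y ^ 2)) 3"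
      by (simp add: hom \<theta>_vars const_power three monom_altdef numeral_3_eq_3 mult_ac)
    moreover have "\<theta> (v ^ p) = [:v ^ p:] + monom ((x ^ m * y ^ m) ^ p) p"
      using p p0 \<theta>_vars(6) by (rule orbit.\<theta>_prime_power)
    ultimately have "\<theta> (v ^ p - ?r) = [:v ^ p - ?r:]"
      by (simp add: hom(8) True)
    then show ?thesis
      using free by (intro bexI[of _ ?r] bexI[of _ 0] free_of_closed) (simp_all add: inv_iff)
  next
    case False
    define e where "e = 2 * p div 3"
    have "3 * e \<le> 2 * p"
      unfolding e_def by simp
    then have "(m + 1) * e \<le> m * p"
    proof -
      assume "3 * e \<le> 2 * p"
      then have "(m + 1) * (3 * e) \<le> (m + 1) * (2 * p)"
        by (rule mult_le_mono2)
      also have "\<dots> \<le> 3 * m * p"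
        using m by (simp add: algebra_simps)
      finally show ?thesis by simp
    qed
    then obtain z where z: "z \<in> free_of V6" "(X * Y ^ 2) ^ e * z = (x ^ m * y ^ m) ^ p * q e p"
      using q_multiple[of p e p] unfolding e_def by fastforce
    \<comment> \<open>The linear term has only the power \<open>p - 1\<close> of
      \<open>x ^ m * y ^ m\<close> at its disposal; this suffices since here
      \<open>3 * e = 2 * (p - 1)\<close>.\<close>
    have "\<exists>z'\<in>free_of V6. p mod 3 = 1 \<longrightarrow>
        (X * Y ^ 2) ^ e * z' = (x ^ m * y ^ m) ^ (p - 1) * q e (p - 1)"
    proof (cases "p mod 3 = 1")
      case True
      then have e: "3 * e = 2 * (p - 1)"
        unfolding e_def using p2 by presburger
      have "((m + 1) * 2) * (p - 1) \<le> (3 * m) * (p - 1)"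
        using m by (intro mult_le_mono1) simp
      then have "(m + 1) * (3 * e) \<le> 3 * m * (p - 1)"
        unfolding e by (simp only: mult.assoc)
      then have "(m + 1) * e \<le> m * (p - 1)"
        by simp
      then show ?thesis
        using q_multiple[of "p - 1" e "p - 1"] e by auto
    qed (use free in auto)
    then obtain z' where z': "z' \<in> free_of V6" "p mod 3 = 1 \<Longrightarrow>
        (X * Y ^ 2) ^ e * z' = (x ^ m * y ^ m) ^ (p - 1) * q e (p - 1)"
      by blast
    have "\<theta> (x ^ m * y ^ m) = [:x ^ m * y ^ m:]"
      by (simp add: hom \<theta>_vars const_power)
    then have "v ^ p - z - (if p mod 3 = 1 then z' else 0) * v \<in> invariants \<theta>"
      using orbit.monic_invariant[OF p p0 False e_def \<theta>_vars(6) _ z(2) z'(2)] by blast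
    then show ?thesis
      using z(1) z'(1) by (intro bexI[of _ z] bexI[of _ "if p mod 3 = 1 then z' else 0"])
        (auto simp: free_of_closed)
  qed
  then obtain r0 r1 where r: "r0 \<in> free_of V6" "r1 \<in> free_of V6" "v ^ p - r0 - r1 * v \<in> invariants \<theta>"
    by blast
  note fg = ext.finitely_generated_invariants_monic[folded \<theta>_eq vars(6), OF _ _ r(1,2) p2 r(3)]
  show ?thesis
  proof (cases "(2::'k) = 0")
    case True
    show ?thesis by (rule fg[OF _ fixed_ring_char_2[OF True]]) simp
  next
    case False
    show ?thesis by (rule fg[OF _ fixed_ring_char_not_2[OF False]]) simp
  qed
qed

end

section \<open>The example (R7-m)\<close>

instance var7 :: countable
  by countable_datatype

instantiation var7 :: linorder
begin

definition less_eq_var7 :: "var7 \<Rightarrow> var7 \<Rightarrow> bool"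
  where "less_eq_var7 i j \<longleftrightarrow> to_nat i \<le> to_nat j"

definition less_var7 :: "var7 \<Rightarrow> var7 \<Rightarrow> bool"
  where "less_var7 i j \<longleftrightarrow> to_nat i < to_nat j"

instance
  by standard (auto simp: less_eq_var7_def less_var7_def)

end

locale example7 =
  fixes m :: nat and \<theta> :: "(var7, 'k::field) mpoly \<Rightarrow> (var7, 'k) mpoly poly"
    and x1 x2 x3 y1 y2 y3 v X1 X2 X3 :: "(var7, 'k) mpoly"
  assumes \<theta>_eq: "\<theta> = hom_by_values (values7 m)"
    and vars: "x1 = Var X7_1" "x2 = Var X7_2" "x3 = Var X7_3"
      "y1 = Var Y7_1" "y2 = Var Y7_2" "y3 = Var Y7_3" "v = Var V7"
    and XX: "X1 = x1 ^ (m + 1)" "X2 = x2 ^ (m + 1)" "X3 = x3 ^ (m + 1)"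
begin

lemma \<theta>_lfihd: "lfihd Const \<theta>"
  using lfihd_theta7[of m] unfolding \<theta>_eq theta7_def .

lemma \<theta>_hom: "algebra_hom Const (\<lambda>c. [:Const c:]) \<theta>"
  unfolding \<theta>_eq by (rule algebra_hom_hom_by_values)

lemmas hom = algebra_hom_simps[OF \<theta>_hom]

lemma \<theta>_vars: "\<theta> x1 = [:x1:]" "\<theta> x2 = [:x2:]" "\<theta> x3 = [:x3:]"
  "\<theta> y1 = [:y1, X1:]" "\<theta> y2 = [:y2, X2:]" "\<theta> y3 = [:y3, X3:]" "\<theta> v = [:v, x1 ^ m * x2 ^ m * x3 ^ m:]"
  by (simp_all only: \<theta>_eq XX vars hom_by_values_Var values7.simps)

lemma \<theta>_XX: "\<theta> X1 = [:X1:]" "\<theta> X2 = [:X2:]" "\<theta> X3 = [:X3:]"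
  by (simp_all only: XX hom \<theta>_vars const_power)

lemma nonzero: "x1 \<noteq> 0" "X1 \<noteq> 0" "X2 \<noteq> 0" "X3 \<noteq> 0"
  by (simp_all add: XX vars Var_nonzero)

lemma inv_iff: "b \<in> invariants \<theta> \<longleftrightarrow> \<theta> b = [:b:]"
  by (rule in_invariants_iff[OF \<theta>_lfihd])

lemma free: "x1 \<in> free_of V7" "x2 \<in> free_of V7" "x3 \<in> free_of V7"
  "y1 \<in> free_of V7" "y2 \<in> free_of V7" "y3 \<in> free_of V7"
  "X1 \<in> free_of V7" "X2 \<in> free_of V7" "X3 \<in> free_of V7"
  unfolding XX vars by (simp_all add: Var_free_of free_of_closed del: power_Suc)

sublocale ext: translated_variable "values7 m" V7 "x1 ^ m * x2 ^ m * x3 ^ m"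
proof
  show "lfihd Const (hom_by_values (values7 m))"
    using lfihd_theta7[of m] unfolding theta7_def .
  show "values7 m V7 = [:Var V7, x1 ^ m * x2 ^ m * x3 ^ m:]"
    by (simp add: vars)
  show "x1 ^ m * x2 ^ m * x3 ^ m \<in> free_of V7"
    by (intro free_of_closed free)
  fix i j assume "i \<noteq> V7"
  then show "coeff (values7 m i) j \<in> free_of V7"
    by (cases i) (auto simp: coeff_pCons free_of_closed Var_free_of simp del: power_Suc split: nat.splits)
qed

section \<open>Minors and the invariants without v in (R7-m)\<close>

definition "u12 = X1 * y2 - X2 * y1"
definition "u13 = X1 * y3 - X3 * y1"
definition "u23 = X2 * y3 - X3 * y2"

lemma u_inv: "u12 \<in> invariants \<theta>" "u13 \<in> invariants \<theta>" "u23 \<in> invariants \<theta>"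
  by (simp_all add: inv_iff u12_def u13_def u23_def hom \<theta>_vars \<theta>_XX algebra_simps)

lemma x_inv: "x1 \<in> invariants \<theta>" "x2 \<in> invariants \<theta>" "x3 \<in> invariants \<theta>"
  by (simp_all add: inv_iff \<theta>_vars)

lemma u_free: "u12 \<in> free_of V7" "u13 \<in> free_of V7" "u23 \<in> free_of V7"
  unfolding u12_def u13_def u23_def by (intro free_of_closed free)+

text \<open>\<open>u12\<close>, \<open>u13\<close>, \<open>u23\<close> are the minors of the matrix
  with rows \<open>X1, X2, X3\<close> and \<open>y1, y2, y3\<close>; the relation expands the
  vanishing determinant in which the first row is repeated.\<close>

lemma relation: "X2 * u13 = X3 * u12 + X1 * u23"
  by (simp add: u12_def u13_def u23_def algebra_simps)

lemma XX_in_hull: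
  "x1 \<in> subalgebra_hull S \<Longrightarrow> X1 \<in> subalgebra_hull S"
  "x2 \<in> subalgebra_hull S \<Longrightarrow> X2 \<in> subalgebra_hull S"
  "x3 \<in> subalgebra_hull S \<Longrightarrow> X3 \<in> subalgebra_hull S"
  unfolding XX by (rule subalgebra_hull_closed; assumption)+

lemmas invariants_eq_hull7 =
  invariants_eq_hull[where f = "values7 m :: var7 \<Rightarrow> (var7, 'k) mpoly poly" and v = V7, folded \<theta>_eq,
    OF \<theta>_lfihd]

definition \<sigma> :: "(var7, 'k) mpoly \<Rightarrow> (var7, 'k) mpoly"
  where "\<sigma> = mpoly_eval Const (\<lambda>i. if i = X7_1 \<or> i = Y7_2 then 0 else Var i)"

lemma \<sigma>_simps: "\<sigma> (Const c) = Const c" "\<sigma> (a + b) = \<sigma> a + \<sigma> b" "\<sigma> (a * b) = \<sigma> a * \<sigma> b"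
  "\<sigma> 1 = 1" "\<sigma> 0 = 0" "\<sigma> (a ^ n) = \<sigma> a ^ n" "\<sigma> (- a) = - \<sigma> a" "\<sigma> (a - b) = \<sigma> a - \<sigma> b"
  "\<sigma> (Var i) = (if i = X7_1 \<or> i = Y7_2 then 0 else Var i)"
  unfolding \<sigma>_def by (simp_all only: subst_simps)

text \<open>The local slice is \<open>y1\<close>. At \<open>x1 = y2 = 0\<close> the minors become
  \<open>- X2 y1\<close>, \<open>- X3 y1\<close>, \<open>X2 y3\<close>, and modulo \<open>x1\<close>
  the relation reads \<open>X2 u13 = X3 u12\<close>. Monomials containing both
  \<open>x2 ^ (m + 1)\<close> and \<open>u13\<close> are rewritten by it; \<open>I\<close> indexes
  the others, whose images are distinct.\<close>

lemma fixed_ring: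
  "free_of V7 \<inter> invariants \<theta> = subalgebra_hull {x1, x2, x3, u12, u13, u23}"
proof (rule invariants_eq_hull7)
  let ?gens = "{x1, x2, x3, u12, u13, u23}"
  show "?gens \<subseteq> free_of V7" "?gens \<subseteq> invariants \<theta>"
    using free u_free x_inv u_inv by auto
  show "x1 \<in> subalgebra_hull ?gens"
    by (rule hull_inc) simp
  show "x1 \<noteq> 0"
    by (rule nonzero)
  show "\<theta> y1 = [:y1, X1:]" "X1 \<noteq> 0"
    by (rule \<theta>_vars nonzero)+
  fix i assume i: "i \<noteq> V7"
  let ?K = "subalgebra_hull (insert y1 ?gens)"
  have K: "x1 \<in> ?K" "x2 \<in> ?K" "x3 \<in> ?K" "y1 \<in> ?K" "u12 \<in> ?K" "u13 \<in> ?K"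
    by (rule hull_inc; simp)+
  have eq: "X1 * y2 = u12 + X2 * y1" "X1 * y3 = u13 + X3 * y1"
    by (simp_all add: u12_def u13_def)
  have Xy: "X1 * y2 \<in> ?K" "X1 * y3 \<in> ?K"
    unfolding eq by (intro subalgebra_hull_closed K XX_in_hull)+
  have "\<exists>N. x1 ^ N * Var i \<in> K"
    if "x1 \<in> K" "x2 \<in> K" "x3 \<in> K" "y1 \<in> K" "X1 * y2 \<in> K" "X1 * y3 \<in> K" for K
  proof (cases i)
    case Y7_2
    then show ?thesis using that by (intro exI[of _ "m + 1"]) (simp only: vars XX)
  next
    case Y7_3
    then show ?thesis using that by (intro exI[of _ "m + 1"]) (simp only: vars XX)
  qed (use that i in \<open>auto simp: vars intro: exI[of _ 0]\<close>)
  then show "\<exists>N. x1 ^ N * Var i \<in> ?K"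
    using K Xy by blast
next
  let ?gens = "{x1, x2, x3, u12, u13, u23}"
  let ?C = "subalgebra_hull ?gens"
  have C: "x1 \<in> ?C" "x2 \<in> ?C" "x3 \<in> ?C" "u12 \<in> ?C" "u13 \<in> ?C" "u23 \<in> ?C"
    by (rule hull_inc; simp)+
  fix b assume "x1 * b \<in> ?C"
  define \<mu> where "\<mu> = (\<lambda>(a, b, c, d, f). x2 ^ a * x3 ^ b * u12 ^ c * u13 ^ d * u23 ^ f)"
  define \<nu> where "\<nu> = (\<lambda>(a, b, c, d, f). Poly_Mapping.single X7_2 (a + (m + 1) * (c + f)) +
    Poly_Mapping.single X7_3 (b + (m + 1) * d) + Poly_Mapping.single Y7_1 (c + d) + Poly_Mapping.single Y7_3 f)"
  define \<kappa> :: "nat \<times> nat \<times> nat \<times> nat \<times> nat \<Rightarrow> 'k" where "\<kappa> = (\<lambda>(a, b, c, d, f). (-1) ^ (c + d))"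
  define I :: "(nat \<times> nat \<times> nat \<times> nat \<times> nat) set" where "I = {(a, b, c, d, f). a \<le> m \<or> d = 0}"
  show "b \<in> ?C"
  proof (rule hull_saturated_by_monomials[where \<sigma> = \<sigma> and \<mu> = \<mu> and \<nu> = \<nu> and \<kappa> = \<kappa>
        and I = I and x = x1 and start = "(0, 0, 0, 0, 0)"])
    show "algebra_hom Const Const \<sigma>"
      unfolding \<sigma>_def by (rule algebra_hom_subst)
    show "\<sigma> x1 = 0"
      by (simp add: \<sigma>_simps vars)
    show "inj_on \<nu> I"
    proof (rule inj_onI)
      fix i j :: "nat \<times> nat \<times> nat \<times> nat \<times> nat"
      assume ij: "i \<in> I" "j \<in> I" and eq: "\<nu> i = \<nu> j"
      obtain a b c d f where i: "i = (a, b, c, d, f)" by (cases i)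
      obtain a' b' c' d' f' where j: "j = (a', b', c', d', f')" by (cases j)
      have f: "f' = f"
        using arg_cong[OF eq, of "\<lambda>p. Poly_Mapping.lookup p Y7_3"]
        by (simp add: \<nu>_def i j lookup_add lookup_single when_def)
      have cd: "c + d = c' + d'"
        using arg_cong[OF eq, of "\<lambda>p. Poly_Mapping.lookup p Y7_1"]
        by (simp add: \<nu>_def i j lookup_add lookup_single when_def)
      have ac: "a + (m + 1) * c = a' + (m + 1) * c'"
        using arg_cong[OF eq, of "\<lambda>p. Poly_Mapping.lookup p X7_2"]
        by (simp add: \<nu>_def i j lookup_add lookup_single when_def f algebra_simps)
      \<comment> \<open>If \<open>d1 \<noteq> 0\<close> then \<open>a1 \<le> m\<close>, so
        \<open>c1\<close> is the quotient of the exponent of \<open>x2\<close> by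
        \<open>m + 1\<close> and cannot be exceeded; if \<open>d1 = 0\<close> then \<open>c1\<close>
        is the whole sum \<open>c2 + d2\<close>. Used in both directions.\<close>
      have le: "c2 \<le> c1"
        if "a1 \<le> m \<or> d1 = 0" "c1 + d1 = c2 + d2" "a1 + (m + 1) * c1 = a2 + (m + 1) * c2"
        for a1 c1 d1 a2 c2 d2
      proof (cases "d1 = 0")
        case False
        then have "(m + 1) * c2 < (m + 1) * (c1 + 1)"
          using that by (simp add: algebra_simps)
        then show ?thesis by (simp only: mult_less_cancel1) simp
      qed (use that in simp)
      have "c' = c"
        using le[of a d c c' d' a'] le[of a' d' c' c d a] ij cd ac by (simp add: I_def i j)
      then have cda: "c' = c" "d' = d" "a' = a"
        using cd ac by simp_all
      have "b' = b"
        using arg_cong[OF eq, of "\<lambda>p. Poly_Mapping.lookup p X7_3"]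
        by (simp add: \<nu>_def i j lookup_add lookup_single when_def cda)
      then show "i = j"
        by (simp add: i j cda f)
    qed
    fix i :: "nat \<times> nat \<times> nat \<times> nat \<times> nat"
    assume iI: "i \<in> I"
    obtain a b c d f where i: "i = (a, b, c, d, f)" by (cases i)
    have ad: "a \<le> m \<or> d = 0"
      using iI by (simp add: I_def i)
    have \<sigma>X: "\<sigma> X1 = 0" "\<sigma> X2 = X2" "\<sigma> X3 = X3" "\<sigma> x2 = x2" "\<sigma> x3 = x3" "\<sigma> y1 = y1" "\<sigma> y2 = 0" "\<sigma> y3 = y3"
      by (simp_all add: XX vars \<sigma>_simps)
    have \<sigma>u: "\<sigma> u12 = - 1 * X2 * y1" "\<sigma> u13 = - 1 * X3 * y1" "\<sigma> u23 = X2 * y3"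
      by (simp_all add: u12_def u13_def u23_def \<sigma>_simps \<sigma>X)
    have "\<sigma> (\<mu> i) = ((-1) ^ c * (-1) ^ d) * (x2 ^ a * X2 ^ c * X2 ^ f) * (x3 ^ b * X3 ^ d) * (y1 ^ c * y1 ^ d) * y3 ^ f"
      by (simp only: \<mu>_def i prod.case \<sigma>_simps \<sigma>X \<sigma>u power_mult_distrib mult_ac)
    also have "x2 ^ a * X2 ^ c * X2 ^ f = x2 ^ (a + (m + 1) * (c + f))"
      by (simp only: XX power_mult[symmetric] power_add[symmetric] distrib_left mult_ac add_ac)
    also have "x3 ^ b * X3 ^ d = x3 ^ (b + (m + 1) * d)"
      by (simp only: XX power_mult[symmetric] power_add[symmetric])
    also have "(-1) ^ c * (-1) ^ d = Const (\<kappa> i)"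
      by (simp add: \<kappa>_def i Const_power Const_minus_one Const_hom power_add)
    also have "y1 ^ c * y1 ^ d = y1 ^ (c + d)"
      by (simp only: power_add)
    finally show "\<sigma> (\<mu> i) = Poly_Mapping.single (\<nu> i) (\<kappa> i)"
      by (simp add: vars Var_power Const_def mult_single \<nu>_def i)
    show "\<kappa> i \<noteq> 0"
      by (simp add: \<kappa>_def i)
    fix g assume g: "g \<in> ?gens"
    have \<mu>C: "\<mu> j \<in> ?C" for j
      unfolding \<mu>_def by (cases j) (simp only: prod.case, intro subalgebra_hull_closed C)
    have rC: "x1 ^ m * \<mu> j \<in> ?C" for j
      by (intro subalgebra_hull_closed C \<mu>C)
    \<comment> \<open>The relation times a monomial; its term with \<open>X1\<close> is divisible by
      \<open>x1\<close>.\<close>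
    have swap: "X2 * u13 * \<mu> (a, b, c, d, f) =
        Const 1 * \<mu> (a, b + (m + 1), c + 1, d, f) + x1 * (x1 ^ m * \<mu> (a, b, c, d, f + 1))" for a b c d f
      unfolding relation by (simp add: \<mu>_def XX Const_hom power_add algebra_simps)
    \<comment> \<open>Multiplication leaves \<open>I\<close> in two situations only: by
      \<open>u13\<close> when \<open>a > m\<close>, and by \<open>x2\<close> when
      \<open>a = m\<close> and \<open>d\<close> is positive.\<close>
    consider "g = x1" | "g = x3" | "g = u12" | "g = u23" | "g = u13" "a \<le> m" | "g = u13" "a > m" "d = 0"
      | "g = x2" "a < m \<or> d = 0" | d' where "g = x2" "a = m" "d = Suc d'"
      using g ad less_linear[of a m] by (cases d) (auto simp: not_less le_less)
    then show "\<exists>a c j. j \<in> I \<and> c \<in> ?C \<and> g * \<mu> i = Const a * \<mu> j + x1 * c"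
    proof cases
      case 1
      then show ?thesis using iI \<mu>C
        by (intro exI[of _ 0] exI[of _ "\<mu> i"] exI[of _ i]) (simp add: Const_hom)
    next
      case 2
      then show ?thesis using ad
        by (intro exI[of _ 1] exI[of _ 0] exI[of _ "(a, b + 1, c, d, f)"])
           (simp add: i I_def \<mu>_def Const_hom subalgebra_hull_closed mult_ac)
    next
      case 3
      then show ?thesis using ad
        by (intro exI[of _ 1] exI[of _ 0] exI[of _ "(a, b, c + 1, d, f)"])
           (simp add: i I_def \<mu>_def Const_hom subalgebra_hull_closed mult_ac)
    next
      case 4
      then show ?thesis using ad
        by (intro exI[of _ 1] exI[of _ 0] exI[of _ "(a, b, c, d, f + 1)"])
           (simp add: i I_def \<mu>_def Const_hom subalgebra_hull_closed mult_ac)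
    next
      case 5
      then show ?thesis
        by (intro exI[of _ 1] exI[of _ 0] exI[of _ "(a, b, c, d + 1, f)"])
           (simp add: i I_def \<mu>_def Const_hom subalgebra_hull_closed mult_ac)
    next
      case 6
      define a' where "a' = a - (m + 1)"
      have "a = (m + 1) + a'"
        using 6 by (simp add: a'_def)
      then have "x2 ^ a = X2 * x2 ^ a'"
        unfolding XX by (simp only: power_add)
      then have "g * \<mu> i = X2 * u13 * \<mu> (a', b, c, 0, f)"
        using 6 by (simp add: i \<mu>_def mult_ac)
      then show ?thesis
        unfolding swap using rC
        by (intro exI[of _ 1] exI[of _ "x1 ^ m * \<mu> (a', b, c, 0, f + 1)"]
            exI[of _ "(a', b + (m + 1), c + 1, 0, f)"]) (simp add: I_def)
    next
      case 7
      then show ?thesis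
        by (intro exI[of _ 1] exI[of _ 0] exI[of _ "(a + 1, b, c, d, f)"])
           (auto simp: i I_def \<mu>_def Const_hom subalgebra_hull_closed mult_ac)
    next
      case 8
      then have "g * \<mu> i = X2 * u13 * \<mu> (0, b, c, d', f)"
        by (simp add: i \<mu>_def XX mult_ac)
      then show ?thesis
        unfolding swap using rC
        by (intro exI[of _ 1] exI[of _ "x1 ^ m * \<mu> (0, b, c, d', f + 1)"]
            exI[of _ "(0, b + (m + 1), c + 1, d', f)"]) (simp add: I_def)
    qed
  qed (use C nonzero \<open>x1 * b \<in> ?C\<close> in \<open>simp_all add: \<mu>_def I_def\<close>)
qed

section \<open>Monic invariants in (R7-m)\<close>

definition "a0 = X1 * X2 * X3"
definition "a1 = y1 * X2 * X3 + X1 * y2 * X3 + X1 * X2 * y3"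
definition "a2 = y1 * y2 * X3 + y1 * X2 * y3 + X1 * y2 * y3"
definition "a3 = y1 * y2 * y3"

text \<open>The coefficients are those of \<open>(X1 z + y1) (X2 z + y2) (X3 z + y3)\<close>, and
  the action on \<open>y1\<close>, \<open>y2\<close>, \<open>y3\<close> replaces \<open>z\<close> by
  \<open>z + U\<close>.\<close>

sublocale orbit: cubic_orbit Const \<theta> a0 a1 a2 a3
  by standard
     (simp_all add: \<theta>_lfihd a0_def a1_def a2_def a3_def hom \<theta>_vars \<theta>_XX nonzero algebra_simps)

abbreviation "q \<equiv> cubic_power_coeff a0 a1 a2 a3"

lemma q_free: "q e j \<in> free_of V7"
proof -
  have a: "a0 \<in> free_of V7" "a1 \<in> free_of V7" "a2 \<in> free_of V7" "a3 \<in> free_of V7"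
    unfolding a0_def a1_def a2_def a3_def by (intro free_of_closed free)+
  have "coeff ([:a0, a1, a2, a3:] ^ e) j \<in> free_of V7" for j
  proof (induction e arbitrary: j)
    case 0
    then show ?case by (simp add: free_of_closed)
  next
    case (Suc e)
    have "coeff [:a0, a1, a2, a3:] j \<in> free_of V7" for j
      using a by (auto simp: coeff_pCons free_of_closed split: nat.splits)
    then show ?case
      using Suc unfolding free_of_def power_Suc by (intro coeff_mult_in_subalgebra_hull)
  qed
  then show ?thesis by (simp add: cubic_power_coeff_def)
qed

text \<open>\<open>a0 ^ e\<close> is the monomial in \<open>x1\<close>, \<open>x2\<close>,
  \<open>x3\<close> with all exponents \<open>(m + 1) * e\<close>, so it divides the power of
  \<open>x1 ^ m * x2 ^ m * x3 ^ m\<close>.\<close>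

lemma q_multiple:
  assumes "(m + 1) * e \<le> m * n"
  shows "\<exists>r\<in>free_of V7. a0 ^ e * r = (x1 ^ m * x2 ^ m * x3 ^ m) ^ n * q e j"
proof -
  define k where "k = m * n - (m + 1) * e"
  have k: "m * n = (m + 1) * e + k"
    using assms by (simp add: k_def)
  have "X1 ^ e = x1 ^ ((m + 1) * e)" "X2 ^ e = x2 ^ ((m + 1) * e)" "X3 ^ e = x3 ^ ((m + 1) * e)"
    by (simp_all only: XX power_mult)
  then have "a0 ^ e * (x1 ^ k * x2 ^ k * x3 ^ k * q e j) = (x1 ^ m * x2 ^ m * x3 ^ m) ^ n * q e j"
    by (simp only: a0_def power_mult_distrib power_mult[symmetric] k power_add mult_ac)
  then show ?thesis
    using free q_free by (intro bexI[of _ "x1 ^ k * x2 ^ k * x3 ^ k * q e j"] free_of_closed)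
qed

text \<open>
  In characteristic 3, \<open>N / (X1\<^sup>2 * X2\<^sup>2 * X3\<^sup>2)\<close> is a cubic form in the \<open>y\<^sub>i / X\<^sub>i\<close> of degree at most 2 in each of
  them that is translated by \<open>U\<^sup>3\<close>.
\<close>

definition "N = y3 * y1 ^ 2 * X2 ^ 2 * X3 + y1 * y2 * y3 * X1 * X2 * X3 + y3 * y2 ^ 2 * X1 ^ 2 * X3
  - y1 ^ 2 * y2 * X2 * X3 ^ 2 - y1 * y2 ^ 2 * X1 * X3 ^ 2"

lemma \<theta>_N: "\<theta> N = [:N, 3 * (y1 * y3 * X1 * X2 ^ 2 * X3 + y2 * y3 * X1 ^ 2 * X2 * X3 - y1 * y2 * X1 * X2 * X3 ^ 2),
  3 * (y3 * X1 ^ 2 * X2 ^ 2 * X3), a0 ^ 2:]"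
  by (simp add: N_def a0_def hom \<theta>_vars \<theta>_XX power2_eq_square algebra_simps)

theorem finitely_generated:
  assumes m: "m \<ge> 2" and char: "CHAR('k) > 0"
  shows "finitely_generated_algebra Const (invariants \<theta>)"
proof -
  define p where "p = CHAR('k)"
  have p: "prime p"
    unfolding p_def using char by (rule prime_CHAR_semidom)
  have p0: "of_nat p = (0 :: (var7, 'k) mpoly)"
    using of_nat_CHAR[where 'a = 'k] by (simp add: p_def Const_hom flip: Const_of_nat)
  have p2: "p \<ge> 2"
    using p by (rule prime_ge_2_nat)
  have "\<exists>r0\<in>free_of V7. \<exists>r1\<in>free_of V7. v ^ p - r0 - r1 * v \<in> invariants \<theta>"
  proof (cases "p = 3")
    case True
    \<comment> \<open>\<open>?k\<close> is \<open>(x1^m x2^m x3^m)^3 / a0^2\<close>, with exponents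
      \<open>3 * m - 2 * (m + 1) = m - 2\<close>.\<close>
    let ?k = "x1 ^ (m - 2) * x2 ^ (m - 2) * x3 ^ (m - 2)"
    have three: "(3 :: (var7, 'k) mpoly) = 0"
      using p0 True by simp
    have "m - 2 + (m + 1) * 2 = m * 3"
      using m by simp
    then have "x1 ^ (m - 2) * X1 ^ 2 = (x1 ^ m) ^ 3" "x2 ^ (m - 2) * X2 ^ 2 = (x2 ^ m) ^ 3"
      "x3 ^ (m - 2) * X3 ^ 2 = (x3 ^ m) ^ 3"
      by (simp_all only: XX power_mult[symmetric] power_add[symmetric])
    then have "(x1 ^ (m - 2) * X1 ^ 2) * (x2 ^ (m - 2) * X2 ^ 2) * (x3 ^ (m - 2) * X3 ^ 2) = (x1 ^ m * x2 ^ m * x3 ^ m) ^ 3"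
      by (simp only: power_mult_distrib)
    then have "?k * a0 ^ 2 = (x1 ^ m * x2 ^ m * x3 ^ m) ^ 3"
      by (simp only: a0_def power_mult_distrib mult_ac)
    moreover have "\<theta> (?k * N) = [:?k * N:] + monom (?k * a0 ^ 2) 3"
      by (simp add: hom \<theta>_vars \<theta>_N const_power three monom_altdef numeral_3_eq_3 mult_ac)
    moreover have "\<theta> (v ^ p) = [:v ^ p:] + monom ((x1 ^ m * x2 ^ m * x3 ^ m) ^ p) p"
      using p p0 \<theta>_vars(7) by (rule orbit.\<theta>_prime_power)
    ultimately have "\<theta> (v ^ p - ?k * N) = [:v ^ p - ?k * N:]"
      by (simp add: hom(8) True)
    moreover have "?k * N \<in> free_of V7"
      unfolding N_def by (intro free_of_closed free)
    moreover have "v ^ p - ?k * N - 0 * v = v ^ p - ?k * N"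
      by simp
    ultimately show ?thesis
      using free_of_closed(4) unfolding inv_iff by metis
  next
    case False
    define e where "e = 2 * p div 3"
    have "3 * e \<le> 2 * p"
      unfolding e_def by simp
    then have "(m + 1) * e \<le> m * p"
    proof -
      assume "3 * e \<le> 2 * p"
      then have "(m + 1) * (3 * e) \<le> (m + 1) * (2 * p)"
        by (rule mult_le_mono2)
      also have "\<dots> \<le> 3 * m * p"
        using m by (simp add: algebra_simps)
      finally show ?thesis by simp
    qed
    then obtain z where z: "z \<in> free_of V7" "a0 ^ e * z = (x1 ^ m * x2 ^ m * x3 ^ m) ^ p * q e p"
      using q_multiple by blast
    have "\<exists>z'\<in>free_of V7. p mod 3 = 1 \<longrightarrow>
        a0 ^ e * z' = (x1 ^ m * x2 ^ m * x3 ^ m) ^ (p - 1) * q e (p - 1)"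
    proof (cases "p mod 3 = 1")
      case True
      then have e: "3 * e = 2 * (p - 1)"
        unfolding e_def using p2 by presburger
      have "((m + 1) * 2) * (p - 1) \<le> (3 * m) * (p - 1)"
        using m by (intro mult_le_mono1) simp
      then have "(m + 1) * (3 * e) \<le> 3 * m * (p - 1)"
        unfolding e by (simp only: mult.assoc)
      then have "(m + 1) * e \<le> m * (p - 1)"
        by simp
      then show ?thesis
        using q_multiple by blast
    qed (use free in auto)
    then obtain z' where z': "z' \<in> free_of V7" "p mod 3 = 1 \<Longrightarrow>
        a0 ^ e * z' = (x1 ^ m * x2 ^ m * x3 ^ m) ^ (p - 1) * q e (p - 1)"
      by blast
    have "\<theta> (x1 ^ m * x2 ^ m * x3 ^ m) = [:x1 ^ m * x2 ^ m * x3 ^ m:]"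
      by (simp add: hom \<theta>_vars const_power)
    then have "v ^ p - z - (if p mod 3 = 1 then z' else 0) * v \<in> invariants \<theta>"
      using orbit.monic_invariant[OF p p0 False e_def \<theta>_vars(7) _ z(2) z'(2)] by blast
    then show ?thesis
      using z(1) z'(1) by (intro bexI[of _ z] bexI[of _ "if p mod 3 = 1 then z' else 0"])
        (auto simp: free_of_closed)
  qed
  then obtain r0 r1 where r: "r0 \<in> free_of V7" "r1 \<in> free_of V7" "v ^ p - r0 - r1 * v \<in> invariants \<theta>"
    by blast
  show ?thesis
    by (rule ext.finitely_generated_invariants_monic[folded \<theta>_eq vars(7), OF _ fixed_ring r(1,2) p2 r(3)]) simp
qed

end

section \<open>The example (DF5-m)\<close>

lemma algebra_hom_image_hull:
  assumes h: "algebra_hom Const Const h"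
  shows "h ` subalgebra_hull G = subalgebra_hull (h ` G)"
proof
  note simps = algebra_hom_simps[OF h]
  let ?P = "{a. h a \<in> subalgebra_hull (h ` G)}"
  have "is_subalgebra Const ?P"
    by (rule is_subalgebraI) (simp_all add: simps subalgebra_hull_closed)
  moreover have "G \<subseteq> ?P"
    using hull_inc[of _ "h ` G" "is_subalgebra Const"] by auto
  ultimately have "subalgebra_hull G \<subseteq> ?P"
    by (intro hull_minimal)
  then show "h ` subalgebra_hull G \<subseteq> subalgebra_hull (h ` G)"
    by auto
  have "is_subalgebra Const (h ` subalgebra_hull G)"
  proof (rule is_subalgebraI)
    show "Const c \<in> h ` subalgebra_hull G" for c
      by (rule image_eqI[of _ _ "Const c"]) (simp_all add: simps subalgebra_hull_closed)
    fix a b assume "a \<in> h ` subalgebra_hull G" "b \<in> h ` subalgebra_hull G"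
    then obtain a' b' where "a' \<in> subalgebra_hull G" "b' \<in> subalgebra_hull G" "a = h a'" "b = h b'"
      by blast
    then show "a + b \<in> h ` subalgebra_hull G" "a * b \<in> h ` subalgebra_hull G"
      by (auto simp flip: simps intro!: imageI subalgebra_hull_closed)
  qed
  then show "subalgebra_hull (h ` G) \<subseteq> h ` subalgebra_hull G"
    by (intro hull_minimal image_mono hull_subset)
qed

lemma finitely_generated_algebra_image:
  assumes "algebra_hom Const Const h" "finitely_generated_algebra Const A"
  shows "finitely_generated_algebra Const (h ` A)"
proof -
  obtain G where "finite G" "subalgebra_hull G = A"
    using assms(2) unfolding finitely_generated_algebra_def by blast
  then show ?thesis
    unfolding finitely_generated_algebra_def using algebra_hom_image_hull[OF assms(1), of G]
    by (intro exI[of _ "h ` G"]) simp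
qed

text \<open>
  Setting \<open>y = 1\<close> turns the second example into the first. Conversely, the substitution
  \<open>homogenize\<close> intertwines the two actions up to replacing \<open>U\<close> by \<open>y\<^sup>m\<^sup>+\<^sup>1 U\<close>, so every invariant lifts.
\<close>

fun dehomogenize_value :: "var6 \<Rightarrow> (var5, 'k::field) mpoly"
where
  "dehomogenize_value X6 = Var X5"
| "dehomogenize_value Y6 = 1"
| "dehomogenize_value S6 = Var S5"
| "dehomogenize_value T6 = Var T5"
| "dehomogenize_value U6 = Var U5"
| "dehomogenize_value V6 = Var V5"

text \<open>The factors are chosen so that the coefficient of \<open>U^j\<close> gains
  \<open>j\<close> factors \<open>y^(m + 1)\<close>. On \<open>V6\<close> a single \<open>y\<close>
  does this, since its translation already contains \<open>y^m\<close>.\<close>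

fun homogenize_value :: "nat \<Rightarrow> var5 \<Rightarrow> (var6, 'k::field) mpoly"
where
  "homogenize_value m X5 = Var X6"
| "homogenize_value m S5 = Var Y6 ^ (m + 1) * Var S6"
| "homogenize_value m T5 = Var Y6 ^ (m + 1) * Var T6"
| "homogenize_value m U5 = Var Y6 ^ (m + 1) * Var U6"
| "homogenize_value m V5 = Var Y6 * Var V6"

definition dehomogenize :: "(var6, 'k::field) mpoly \<Rightarrow> (var5, 'k) mpoly"
  where "dehomogenize = mpoly_eval Const dehomogenize_value"

definition homogenize :: "nat \<Rightarrow> (var5, 'k::field) mpoly \<Rightarrow> (var6, 'k) mpoly"
  where "homogenize m = mpoly_eval Const (homogenize_value m)"

lemma dehomogenize_hom: "algebra_hom Const Const dehomogenize"
  unfolding dehomogenize_def by (rule algebra_hom_subst)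

lemma homogenize_hom: "algebra_hom Const Const (homogenize m)"
  unfolding homogenize_def by (rule algebra_hom_subst)

lemmas dehomogenize_simps = algebra_hom_simps[OF dehomogenize_hom]
lemmas homogenize_simps = algebra_hom_simps[OF homogenize_hom]

lemma dehomogenize_Var: "dehomogenize (Var i) = dehomogenize_value i"
  unfolding dehomogenize_def by (rule subst_simps)

lemma homogenize_Var: "homogenize m (Var i) = homogenize_value m i"
  unfolding homogenize_def by (rule subst_simps)

lemma dehomogenize_homogenize: "dehomogenize (homogenize m b) = b"
proof (induction b rule: mpoly_induct)
  case (Var i)
  then show ?case
    by (cases i) (simp_all add: homogenize_Var dehomogenize_simps dehomogenize_Var)
qed (simp_all add: homogenize_simps dehomogenize_simps)

lemma coeff_theta5_dehomogenize: "coeff (theta5 m (dehomogenize b)) j = dehomogenize (coeff (theta6 m b) j)"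
proof (induction b arbitrary: j rule: mpoly_induct)
  case (Const c)
  then show ?case
    by (simp add: theta5_def theta6_def dehomogenize_simps hom_by_values_Const coeff_pCons split: nat.splits)
next
  case (Var i)
  then show ?case
    by (cases i) (simp_all add: theta5_def theta6_def dehomogenize_simps dehomogenize_Var hom_by_values_Var
        hom_by_values_simps coeff_pCons one_pCons split: nat.splits)
next
  case (add p q)
  then show ?case
    by (simp add: theta5_def theta6_def dehomogenize_simps hom_by_values_simps)
next
  case (mult p q)
  then show ?case
    by (simp add: theta5_def theta6_def dehomogenize_simps hom_by_values_simps coeff_mult
        algebra_hom_sum[OF dehomogenize_hom])
qed

lemma coeff_theta6_homogenize:
  "coeff (theta6 m (homogenize m b)) j = (Var Y6 ^ (m + 1)) ^ j * homogenize m (coeff (theta5 m b) j)"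
proof (induction b arbitrary: j rule: mpoly_induct)
  case (Const c)
  then show ?case
    by (simp add: theta5_def theta6_def homogenize_simps hom_by_values_Const coeff_pCons split: nat.splits)
next
  case (Var i)
  have Y: "(Var Y6 :: (var6, 'a) mpoly) ^ (2 * (m + 1)) = Var Y6 ^ (m + 1) * Var Y6 ^ (m + 1)"
    by (simp only: mult_2 power_add)
  show ?case
    by (cases i) (simp_all add: theta5_def theta6_def homogenize_simps homogenize_Var hom_by_values_Var
        hom_by_values_simps coeff_pCons const_power Y mult_ac del: power_Suc split: nat.splits,
        simp_all del: power_Suc flip: power_mult power_add power_Suc,
        simp add: mult_2_right numeral_3_eq_3)
next
  case (add p q)
  then show ?case
    by (simp add: theta5_def theta6_def homogenize_simps hom_by_values_simps distrib_left)
next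
  case (mult p q)
  have "coeff (theta6 m (homogenize m (p * q))) j =
      (\<Sum>l\<le>j. ((Var Y6 ^ (m + 1)) ^ l * homogenize m (coeff (theta5 m p) l)) *
        ((Var Y6 ^ (m + 1)) ^ (j - l) * homogenize m (coeff (theta5 m q) (j - l))))"
    by (simp only: mult[symmetric] coeff_mult[symmetric] homogenize_simps theta6_def hom_by_values_simps)
  also have "\<dots> = (\<Sum>l\<le>j. (Var Y6 ^ (m + 1)) ^ j *
      homogenize m (coeff (theta5 m p) l * coeff (theta5 m q) (j - l)))"
  proof (intro sum.cong refl)
    fix l assume "l \<in> {..j}"
    then have "(Var Y6 ^ (m + 1) :: (var6, 'a) mpoly) ^ j = (Var Y6 ^ (m + 1)) ^ l * (Var Y6 ^ (m + 1)) ^ (j - l)"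
      by (simp flip: power_add)
    then show "((Var Y6 ^ (m + 1)) ^ l * homogenize m (coeff (theta5 m p) l)) *
        ((Var Y6 ^ (m + 1)) ^ (j - l) * homogenize m (coeff (theta5 m q) (j - l))) =
        (Var Y6 ^ (m + 1)) ^ j * homogenize m (coeff (theta5 m p) l * coeff (theta5 m q) (j - l))"
      by (simp only: homogenize_simps mult_ac)
  qed
  also have "\<dots> = (Var Y6 ^ (m + 1)) ^ j * homogenize m (coeff (theta5 m (p * q)) j)"
    by (simp only: theta5_def hom_by_values_simps coeff_mult algebra_hom_sum[OF homogenize_hom] sum_distrib_left)
  finally show ?case .
qed

text \<open>For an invariant \<open>b\<close>, each component of positive index of its
  homogenization is a power of \<open>y\<close> times the homogenization of 0, and dehomogenizing
  recovers \<open>b\<close>. Conversely, dehomogenization commutes with all components.\<close>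

lemma invariants_theta5_eq_image:
  "invariants (theta5 m) = dehomogenize ` invariants (theta6 m :: (var6, 'k::field) mpoly \<Rightarrow> _)"
proof
  show "invariants (theta5 m) \<subseteq> dehomogenize ` invariants (theta6 m :: (var6, 'k) mpoly \<Rightarrow> _)"
  proof
    fix b :: "(var5, 'k) mpoly" assume "b \<in> invariants (theta5 m)"
    then have "homogenize m b \<in> invariants (theta6 m)"
      unfolding invariants_def by (auto simp: coeff_theta6_homogenize homogenize_simps)
    then show "b \<in> dehomogenize ` invariants (theta6 m)"
      using dehomogenize_homogenize by (metis image_eqI)
  qed
  show "dehomogenize ` invariants (theta6 m :: (var6, 'k) mpoly \<Rightarrow> _) \<subseteq> invariants (theta5 m)"
    unfolding invariants_def by (auto simp: coeff_theta5_dehomogenize dehomogenize_simps)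
qed

theorem theorem5p2:
  fixes m :: nat
  assumes "m \<ge> 2" and "CHAR('k::alg_closed_field) > 0"
  shows "finitely_generated_algebra Const (invariants (theta5 m :: (var5, 'k) mpoly \<Rightarrow> _)) \<and>
         finitely_generated_algebra Const (invariants (theta6 m :: (var6, 'k) mpoly \<Rightarrow> _)) \<and>
         finitely_generated_algebra Const (invariants (theta7 m :: (var7, 'k) mpoly \<Rightarrow> _))"
proof -
  interpret six: example6 m "theta6 m :: (var6, 'k) mpoly \<Rightarrow> _" "Var X6" "Var Y6" "Var S6" "Var T6" "Var U6" "Var V6"
    "Var X6 ^ (m + 1)" "Var Y6 ^ (m + 1)"
    by standard (rule theta6_def refl)+
  interpret seven: example7 m "theta7 m :: (var7, 'k) mpoly \<Rightarrow> _" "Var X7_1" "Var X7_2" "Var X7_3"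
    "Var Y7_1" "Var Y7_2" "Var Y7_3" "Var V7"
    "Var X7_1 ^ (m + 1)" "Var X7_2 ^ (m + 1)" "Var X7_3 ^ (m + 1)"
    by standard (rule theta7_def refl)+
  show ?thesis
    using six.finitely_generated[OF assms] seven.finitely_generated[OF assms]
      finitely_generated_algebra_image[OF dehomogenize_hom six.finitely_generated[OF assms]]
    by (simp only: invariants_theta5_eq_image simp_thms)
qed

end
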